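(* Let $n\ge 2$ and consider the Friends II process with $n$ players, with visiting probability matrices $p(t)=(p_{ij}(t))_{1\le i,j\le n}$. Then, almost surely, $p(t)$ converges as $t\to\infty$ to a random limit matrix $p$. If $n=3$, the limit is almost surely the matrix with zero diagonal all of whose off-diagonal entries are $1/2$. In general, the limit may be any symmetric matrix whose rows sum to $1$; that is, the closed support of the law of the random limit $p$ is the entire set of symmetric stochastic $n\times n$ matrices with zero diagonal.
   Context: Friends II process with $n$ players (agents) $1,\dots,n$: at each discrete time $t$ agent $i$ has a vector of weights $(w_{i1}(t),\dots,w_{in}(t))$ with $w_{ii}(t)=0$. Initially all weights $w_{ij}$ with $i\neq j$ equal $1$. In round $t$, every agent $i$ visits exactly one other agent; conditionally on the past, the agents make their choices independently, and agent $i$ visits agent $j$ with probability $p_{ij}(t)=w_{ij}(t)/\sum_k w_{ik}(t)$. Both the visitor and the host are reinforced: for each visit of some agent $i$ to some agent $j$ in round $t$, $1$ is added to both $w_{ij}$ and $w_{ji}$ (so if $i$ visits $j$ and $j$ visits $i$ in the same round, both weights increase by $2$). The weights resulting after all visits of round $t$ are the weights at time $t+1$. A stochastic matrix is a matrix with nonnegative entries whose rows each sum to $1$. *)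

theory Defs
  imports "HOL-Probability.Probability"
begin

text \<open>
  The agents are the elements of a finite type. A visit sequence \<open>v\<close> records by \<open>v t i\<close> the agent
  visited by agent \<open>i\<close> in round \<open>t\<close>; rounds and times are counted from \<open>0\<close>. The two summands
  below are the reinforcement of \<open>i\<close> as a visitor of \<open>j\<close> and as a host of \<open>j\<close>, so a mutual
  visit adds \<open>2\<close>.
\<close>

fun weight :: "(nat \<Rightarrow> 'n \<Rightarrow> 'n) \<Rightarrow> nat \<Rightarrow> 'n \<Rightarrow> 'n \<Rightarrow> real" where
  "weight v 0 i j = (if i = j then 0 else 1)"
| "weight v (Suc t) i j =
     weight v t i j + of_bool (v t i = j) + of_bool (v t j = i)"

definition visit_matrix :: "(nat \<Rightarrow> 'n \<Rightarrow> 'n) \<Rightarrow> nat \<Rightarrow> real^'n^'n::finite" where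
  "visit_matrix v t = (\<chi> i j. weight v t i j / (\<Sum>k\<in>UNIV. weight v t i k))"

text \<open>
  There are only finitely many possible histories \<open>h\<close> before round \<open>t\<close>, so conditioning on the
  past is elementary conditioning on the events that have positive probability. Note that
  \<^term>\<open>visit_matrix h t\<close> depends on \<open>h\<close> only through the rounds before \<open>t\<close>. The product
  expresses the conditional independence of the choices of the agents.
\<close>

locale friends_II = prob_space M for M :: "'a measure" +
  fixes V :: "nat \<Rightarrow> 'a \<Rightarrow> 'n::finite \<Rightarrow> 'n"
  assumes measurable_visits [measurable]: "\<And>t. V t \<in> measurable M (count_space UNIV)"
    and visits_other: "\<And>t i \<omega>. \<omega> \<in> space M \<Longrightarrow> V t \<omega> i \<noteq> i"
    and visits_cond_prob:
      "\<And>t h f. \<P>(\<omega> in M. \<forall>s<t. V s \<omega> = h s) > 0 \<Longrightarrow>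
        \<P>(\<omega> in M. V t \<omega> = f \<bar> \<forall>s<t. V s \<omega> = h s) = (\<Prod>i\<in>UNIV. visit_matrix h t $ i $ f i)"

definition stochastic_matrix :: "real^'n^'n::finite \<Rightarrow> bool" where
  "stochastic_matrix A \<longleftrightarrow> (\<forall>i j. 0 \<le> A $ i $ j) \<and> (\<forall>i. (\<Sum>j\<in>UNIV. A $ i $ j) = 1)"

definition closed_support :: "'a::topological_space measure \<Rightarrow> 'a set" where
  "closed_support \<mu> = {x. \<forall>U. open U \<longrightarrow> x \<in> U \<longrightarrow> 0 < emeasure \<mu> U}"

end

theory Submission
  imports Defs
begin

text \<open>
  Write \<open>w\<^sub>i\<^sub>j\<close> for the weights, \<open>W\<^sub>i\<close> for their row sums and \<open>m = 2 t + n - 1\<close> for the mean of the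
  row sums, and let \<open>g\<^sub>i(t)\<close> be the product of \<open>1 + 1 / W\<^sub>i(s)\<close> over \<open>s < t\<close>. For \<open>i \<noteq> j\<close> and \<open>n \<ge> 3\<close> both
  \<open>w\<^sub>i\<^sub>j / (g\<^sub>i g\<^sub>j)\<close> and, once \<open>w\<^sub>i\<^sub>j \<ge> 2\<close>, \<open>g\<^sub>i g\<^sub>j / (w\<^sub>i\<^sub>j - 1)\<close> are nonnegative supermartingales, so
  \<open>w\<^sub>i\<^sub>j / (g\<^sub>i g\<^sub>j)\<close> almost surely has a positive limit. The remaining argument is pathwise: since
  \<open>w\<^sub>i\<^sub>j \<le> n m\<close>, all products \<open>g\<^sub>i g\<^sub>j\<close> are \<open>O(t)\<close>, while the product of all \<open>g\<^sub>i\<close> is at least of order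
  \<open>t\<close> to the power \<open>n/2\<close> by Jensen. The deficit in Jensen's inequality is therefore summable, which
  forces \<open>W\<^sub>i / m \<longlonglongrightarrow> 1\<close>, and each \<open>w\<^sub>i\<^sub>j\<close> grows linearly. So the matrices \<open>w / m\<close> at two late times are
  nearly stochastic and nearly diagonal scalings of each other; such scalings are nearly trivial,
  and \<open>w / m\<close> is a Cauchy sequence. For \<open>n = 2\<close> the visit matrix is constant.

  For the support, steer the process deterministically until \<open>w / m\<close> is close to a prescribed
  matrix and all weights are large. The expectations of \<open>c\<close> and \<open>1 / c\<close>, where \<open>c\<close> is the relative
  change of \<open>w\<^sub>i\<^sub>j / (g\<^sub>i g\<^sub>j)\<close> from then on, are at most \<open>1 + O(1 / w\<^sub>i\<^sub>j)\<close>, hence all \<open>c\<close> stay close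
  to \<open>1\<close> with positive probability, and rigidity of scalings keeps the limit near the prescribed matrix.
\<close>

section \<open>Weights and one round of the process\<close>

definition row_weight :: "(nat \<Rightarrow> 'n \<Rightarrow> 'n::finite) \<Rightarrow> nat \<Rightarrow> 'n \<Rightarrow> real" where
  "row_weight v t i = (\<Sum>k\<in>UNIV. weight v t i k)"

definition mean_weight :: "nat \<Rightarrow> nat \<Rightarrow> real" where
  "mean_weight n t = 2 * real t + real n - 1"

text \<open>The conditional mean of the next weight of a pair with weight \<open>w\<close> is
  \<open>w * (1 + 1 / W\<^sub>i + 1 / W\<^sub>j)\<close>. The product of the factors of
  \<open>i\<close> and \<open>j\<close> compensates this growth up to second order.\<close>

definition growth :: "(nat \<Rightarrow> 'n \<Rightarrow> 'n::finite) \<Rightarrow> nat \<Rightarrow> 'n \<Rightarrow> real" where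
  "growth v t i = (\<Prod>s<t. 1 + 1 / row_weight v s i)"

lemma weight_cong: "(\<And>s. s < t \<Longrightarrow> v s = v' s) \<Longrightarrow> weight v t i j = weight v' t i j"
  by (induction t) auto

lemma row_weight_cong: "(\<And>s. s < t \<Longrightarrow> v s = v' s) \<Longrightarrow> row_weight v t i = row_weight v' t i"
  unfolding row_weight_def by (intro sum.cong refl weight_cong)

text \<open>The condition \<open>s + 1 < t\<close> records predictability: the last factor involves
  the row weight at time \<open>t - 1\<close>, which the choices of round \<open>t - 1\<close> do
  not affect.\<close>

lemma growth_cong: "(\<And>s. s + 1 < t \<Longrightarrow> v s = v' s) \<Longrightarrow> growth v t i = growth v' t i"
proof -
  assume *: "\<And>s. s + 1 < t \<Longrightarrow> v s = v' s"
  have "row_weight v s i = row_weight v' s i" if "s < t" for s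
    by (rule row_weight_cong) (use * that in auto)
  then show ?thesis unfolding growth_def by simp
qed

lemma weight_eq_sum:
  "weight v t i j = of_bool (i \<noteq> j) + (\<Sum>s<t. of_bool (v s i = j) + of_bool (v s j = i))"
  by (induction t) auto

lemma weight_commute: "weight v t i j = weight v t j i"
  by (induction t) auto

lemma weight_nonneg: "0 \<le> weight v t i j"
  by (induction t) auto

lemma weight_ge_1: "i \<noteq> j \<Longrightarrow> 1 \<le> weight v t i j"
  by (induction t) auto

lemma weight_eq_1_or_ge_2: "i \<noteq> j \<Longrightarrow> weight v t i j = 1 \<or> 2 \<le> weight v t i j"
  by (induction t) auto

lemma weight_diag: "(\<And>s. s < t \<Longrightarrow> v s i \<noteq> i) \<Longrightarrow> weight v t i i = 0"
  by (induction t) auto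

lemma weight_mono: "s \<le> t \<Longrightarrow> weight v s i j \<le> weight v t i j"
  by (rule lift_Suc_mono_le[of "\<lambda>t. weight v t i j"]) auto

lemma row_weight_0: "row_weight v 0 (i::'n::finite) = real CARD('n) - 1"
proof -
  have "row_weight v 0 i = (\<Sum>k\<in>UNIV. 1 - of_bool (i = k))"
    unfolding row_weight_def by (intro sum.cong) auto
  also have "\<dots> = real CARD('n) - 1" by (simp add: sum_subtractf of_bool_def)
  finally show ?thesis .
qed

lemma row_weight_Suc:
  "row_weight v (Suc t) i = row_weight v t i + 1 + real (card {k. v t k = i})"
proof -
  have 1: "(\<Sum>k\<in>UNIV. of_bool (v t i = k)) = (1::real)" by (simp add: of_bool_def)
  have 2: "(\<Sum>k\<in>UNIV. of_bool (v t k = i)) = real (card {k. v t k = i})"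
    by (simp add: of_bool_def sum.If_cases)
  show ?thesis by (simp add: row_weight_def sum.distrib 1 2)
qed

lemma row_weight_Suc_le:
  "row_weight v (Suc t) (i::'n::finite) \<le> row_weight v t i + 1 + real CARD('n)"
  by (simp add: row_weight_Suc card_mono)

lemma row_weight_ge: "real t + real CARD('n) - 1 \<le> row_weight v t (i::'n::finite)"
  by (induction t) (auto simp: row_weight_0 row_weight_Suc)

text \<open>A visit counts once in the row of the visitor and once in the row of the host, so each
  round adds \<open>2 * CARD('n)\<close> in total whatever the choices are.\<close>

lemma sum_row_weight:
  "(\<Sum>i\<in>UNIV. row_weight v t (i::'n::finite)) = real CARD('n) * mean_weight CARD('n) t"
proof (induction t)
  case 0 then show ?case by (simp add: row_weight_0 mean_weight_def)
next
  case (Suc t)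
  have "(\<Sum>i\<in>UNIV. real (card {k. v t k = i})) = (\<Sum>i\<in>UNIV. \<Sum>k\<in>UNIV. of_bool (v t k = i))"
    by (simp add: of_bool_def sum.If_cases)
  also have "\<dots> = (\<Sum>k\<in>UNIV. \<Sum>i\<in>UNIV. of_bool (v t k = i))" by (rule sum.swap)
  also have "\<dots> = real CARD('n)" by (simp add: of_bool_def)
  finally show ?case using Suc by (simp add: row_weight_Suc sum.distrib mean_weight_def algebra_simps)
qed

lemma row_weight_nonneg: "0 \<le> row_weight v t i"
  unfolding row_weight_def by (intro sum_nonneg weight_nonneg)

lemma row_weight_le: "row_weight v t (i::'n::finite) \<le> real CARD('n) * mean_weight CARD('n) t"
  unfolding sum_row_weight[of v t, symmetric]
  by (rule member_le_sum) (auto simp: row_weight_nonneg)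

lemma weight_le_row_weight: "weight v t i j \<le> row_weight v t i"
  unfolding row_weight_def by (rule member_le_sum) (auto simp: weight_nonneg)

lemma card_ge_2_distinct: "i \<noteq> (j::'n::finite) \<Longrightarrow> CARD('n) \<ge> 2"
  using card_mono[of UNIV "{i,j}"] by auto

lemma row_weight_pos: "CARD('n) \<ge> 2 \<Longrightarrow> 0 < row_weight v t (i::'n::finite)"
  using row_weight_ge[where v=v and t=t and i=i] by linarith

lemma growth_pos: "0 < growth v t i"
  unfolding growth_def by (intro prod_pos ballI add_pos_nonneg) (auto simp: row_weight_nonneg)

lemma growth_Suc: "growth v (Suc t) i = growth v t i * (1 + 1 / row_weight v t i)"
  unfolding growth_def by simp

lemma visit_matrix_nth: "visit_matrix v t $ i $ j = weight v t i j / row_weight v t i"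
  by (simp add: visit_matrix_def row_weight_def)

lemma visit_matrix_nonneg: "0 \<le> visit_matrix v t $ i $ j"
  by (simp add: visit_matrix_nth weight_nonneg row_weight_nonneg)

lemma sum_visit_matrix:
  "CARD('n) \<ge> 2 \<Longrightarrow> (\<Sum>j\<in>UNIV. visit_matrix v t $ (i::'n::finite) $ j) = 1"
  using row_weight_pos[of v t i] by (simp add: visit_matrix_nth sum_divide_distrib[symmetric] row_weight_def)

lemma visit_matrix_cong: "(\<And>s. s < t \<Longrightarrow> v s = v' s) \<Longrightarrow> visit_matrix v t = visit_matrix v' t"
  by (simp add: vec_eq_iff visit_matrix_nth weight_cong[of t v v'] row_weight_cong[of t v v'])

text \<open>The conditional expectation of the functional \<phi> given the history \<open>v\<close>
  before round \<open>t\<close>. Rounds of \<open>v\<close> after \<open>t\<close> are left in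
  place, so it has this meaning for functionals of the rounds up to \<open>t\<close>.\<close>

definition step_expectation :: "nat \<Rightarrow> ((nat \<Rightarrow> 'n \<Rightarrow> 'n::finite) \<Rightarrow> real) \<Rightarrow> (nat \<Rightarrow> 'n \<Rightarrow> 'n) \<Rightarrow> real" where
  "step_expectation t \<phi> v = (\<Sum>f\<in>UNIV. (\<Prod>i\<in>UNIV. visit_matrix v t $ i $ f i) * \<phi> (v(t := f)))"

text \<open>Independence of the agents in algebraic form: expanding the product of sums gives one
  summand per joint choice \<open>f\<close>.\<close>

lemma sum_prod_visit_matrix:
  fixes F :: "'n::finite \<Rightarrow> 'n \<Rightarrow> real"
  shows "(\<Sum>f\<in>UNIV. (\<Prod>i\<in>UNIV. visit_matrix v t $ i $ f i) * (\<Prod>i\<in>UNIV. F i (f i)))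
    = (\<Prod>i\<in>UNIV. \<Sum>j\<in>UNIV. visit_matrix v t $ i $ j * F i j)"
proof -
  have "(\<Prod>i\<in>UNIV. \<Sum>j\<in>UNIV. visit_matrix v t $ i $ j * F i j) = (\<Sum>f\<in>UNIV. \<Prod>i\<in>UNIV. visit_matrix v t $ i $ f i * F i (f i))"
    using prod_sum_PiE[where A="UNIV::'n set" and B="\<lambda>_. UNIV::'n set" and f="\<lambda>i j. visit_matrix v t $ i $ j * F i j"]
    by (simp add: PiE_UNIV_domain)
  then show ?thesis by (simp add: prod.distrib)
qed

text \<open>Every function of the two indicators that determine the increment of the weight of \<open>{i, j}\<close>
  is bilinear in them, and the choices of \<open>i\<close> and \<open>j\<close> are independent.\<close>

lemma step_expectation_pair:
  fixes i j :: "'n::finite" and \<psi> :: "bool \<Rightarrow> bool \<Rightarrow> real"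
  assumes "i \<noteq> j" and \<phi>: "\<And>f. \<phi> (v(t := f)) = \<psi> (f i = j) (f j = i)"
  defines "p \<equiv> visit_matrix v t $ i $ j" and "q \<equiv> visit_matrix v t $ j $ i"
  shows "step_expectation t \<phi> v = p * q * \<psi> True True + p * (1 - q) * \<psi> True False
    + (1 - p) * q * \<psi> False True + (1 - p) * (1 - q) * \<psi> False False"
proof -
  have n: "CARD('n) \<ge> 2" using card_ge_2_distinct[OF \<open>i \<noteq> j\<close>] .
  let ?P = "\<lambda>f. \<Prod>i\<in>UNIV. visit_matrix v t $ i $ f i"
  \<comment> \<open>Two independent choices: the factor is \<open>a\<close> for agent
    \<open>i\<close>, \<open>b\<close> for agent \<open>j\<close> and 1 for all other agents, whose
    rows sum to 1.\<close>
  have key: "(\<Sum>f\<in>UNIV. ?P f * (a (f i) * b (f j)))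
      = (\<Sum>x\<in>UNIV. visit_matrix v t $ i $ x * a x) * (\<Sum>x\<in>UNIV. visit_matrix v t $ j $ x * b x)"
    for a b :: "'n \<Rightarrow> real"
  proof -
    let ?F = "\<lambda>k x. if k = i then a x else if k = j then b x else 1"
    have 1: "(\<Prod>k\<in>UNIV. h k) = h i * h j" if "\<And>k. k \<noteq> i \<Longrightarrow> k \<noteq> j \<Longrightarrow> h k = 1" for h :: "'n \<Rightarrow> real"
    proof -
      have "(\<Prod>k\<in>UNIV. h k) = (\<Prod>k\<in>{i,j}. h k)"
        by (rule prod.mono_neutral_right) (use that in auto)
      then show ?thesis using \<open>i \<noteq> j\<close> by simp
    qed
    have "a (f i) * b (f j) = (\<Prod>k\<in>UNIV. ?F k (f k))" for f
      by (subst 1) (use \<open>i \<noteq> j\<close> in auto)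
    then have "(\<Sum>f\<in>UNIV. ?P f * (a (f i) * b (f j))) = (\<Prod>k\<in>UNIV. \<Sum>x\<in>UNIV. visit_matrix v t $ k $ x * ?F k x)"
      using sum_prod_visit_matrix[of v t ?F] by (simp only:)
    also have "\<dots> = (\<Sum>x\<in>UNIV. visit_matrix v t $ i $ x * a x) * (\<Sum>x\<in>UNIV. visit_matrix v t $ j $ x * b x)"
      by (subst 1) (use \<open>i \<noteq> j\<close> sum_visit_matrix[OF n] in auto)
    finally show ?thesis .
  qed
  have d: "(\<Sum>x\<in>UNIV. visit_matrix v t $ k $ x * of_bool (x = l)) = visit_matrix v t $ k $ l" for k l
    by (simp add: of_bool_def if_distrib cong: if_cong)
  have s1: "(\<Sum>f\<in>UNIV. ?P f) = 1" using key[of "\<lambda>_. 1" "\<lambda>_. 1"] by (simp add: sum_visit_matrix[OF n])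
  have s2: "(\<Sum>f\<in>UNIV. ?P f * of_bool (f i = j)) = p"
    using key[of "\<lambda>x. of_bool (x = j)" "\<lambda>_. 1"] by (simp add: sum_visit_matrix[OF n] d p_def)
  have s3: "(\<Sum>f\<in>UNIV. ?P f * of_bool (f j = i)) = q"
    using key[of "\<lambda>_. 1" "\<lambda>x. of_bool (x = i)"] by (simp add: sum_visit_matrix[OF n] d q_def)
  have s4: "(\<Sum>f\<in>UNIV. ?P f * (of_bool (f i = j) * of_bool (f j = i))) = p * q"
    using key[of "\<lambda>x. of_bool (x = j)" "\<lambda>x. of_bool (x = i)"] by (simp only: d p_def q_def)
  \<comment> \<open>Expansion of \<psi> in the basis 1, x, y, x y of the functions of two
    indicators.\<close>
  have "step_expectation t \<phi> v = (\<Sum>f\<in>UNIV. \<psi> False False * ?P f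
     + (\<psi> True False - \<psi> False False) * (?P f * of_bool (f i = j))
     + (\<psi> False True - \<psi> False False) * (?P f * of_bool (f j = i))
     + (\<psi> True True - \<psi> True False - \<psi> False True + \<psi> False False) * (?P f * (of_bool (f i = j) * of_bool (f j = i))))"
    unfolding step_expectation_def \<phi>
  proof (intro sum.cong refl)
    fix f
    show "?P f * \<psi> (f i = j) (f j = i) = \<psi> False False * ?P f
     + (\<psi> True False - \<psi> False False) * (?P f * of_bool (f i = j))
     + (\<psi> False True - \<psi> False False) * (?P f * of_bool (f j = i))
     + (\<psi> True True - \<psi> True False - \<psi> False True + \<psi> False False) * (?P f * (of_bool (f i = j) * of_bool (f j = i)))"
      by (cases "f i = j"; cases "f j = i") (simp_all add: algebra_simps)
  qed
  also have "\<dots> = \<psi> False False + (\<psi> True False - \<psi> False False) * p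
     + (\<psi> False True - \<psi> False False) * q
     + (\<psi> True True - \<psi> True False - \<psi> False True + \<psi> False False) * (p * q)"
    by (simp only: sum.distrib sum_distrib_left[symmetric] s1 s2 s3 s4 mult_1_right)
  finally show ?thesis by (simp add: algebra_simps)
qed

section \<open>Supermartingale inequalities\<close>

definition pair_ratio :: "(nat \<Rightarrow> 'n \<Rightarrow> 'n::finite) \<Rightarrow> nat \<Rightarrow> 'n \<Rightarrow> 'n \<Rightarrow> real" where
  "pair_ratio v t i j = weight v t i j / (growth v t i * growth v t j)"

text \<open>For weight \<open>1\<close> the quotient is \<open>0\<close> by division by zero and the supermartingale inequality fails,
  hence the indicator factors below.\<close>

definition pair_inverse :: "(nat \<Rightarrow> 'n \<Rightarrow> 'n::finite) \<Rightarrow> nat \<Rightarrow> 'n \<Rightarrow> 'n \<Rightarrow> real" where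
  "pair_inverse v t i j = growth v t i * growth v t j / (weight v t i j - 1)"

lemma pair_ratio_pos: "i \<noteq> j \<Longrightarrow> 0 < pair_ratio v t i j"
  using weight_ge_1[of i j v t] by (auto simp: pair_ratio_def growth_pos intro!: divide_pos_pos mult_pos_pos)

lemma weight_upd_Suc:
  "weight (v(t := f)) (Suc t) i j = weight v t i j + of_bool (f i = j) + of_bool (f j = i)"
  using weight_cong[of t "v(t := f)" v i j] by simp

lemma growth_upd: "growth (v(t := f)) t i = growth v t i"
  by (rule growth_cong) auto

lemma row_weight_upd: "row_weight (v(t := f)) t i = row_weight v t i"
  by (rule row_weight_cong) auto

text \<open>With \<open>a\<close> and \<open>b\<close> the reciprocal row weights, the mean of the
  new weight is \<open>w * (1 + a + b)\<close>, while the denominator grows by the factor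
  \<open>(1 + a) * (1 + b)\<close>, which is larger by \<open>a * b\<close>.\<close>

lemma step_expectation_pair_ratio:
  assumes "i \<noteq> (j::'n::finite)"
  shows "step_expectation t (\<lambda>v. pair_ratio v (Suc t) i j) v \<le> pair_ratio v t i j"
proof -
  have n: "CARD('n) \<ge> 2" using card_ge_2_distinct[OF assms] .
  define a where "a = 1 / row_weight v t i"
  define b where "b = 1 / row_weight v t j"
  define w where "w = weight v t i j"
  define G where "G = growth v t i * growth v t j"
  have ab: "a > 0" "b > 0" using row_weight_pos[OF n, of v t] by (auto simp: a_def b_def)
  have G: "G > 0" by (simp add: G_def growth_pos)
  have w: "w \<ge> 1" using weight_ge_1[OF assms] by (simp add: w_def)
  have p: "visit_matrix v t $ i $ j = w * a" "visit_matrix v t $ j $ i = w * b"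
    by (simp_all add: visit_matrix_nth w_def a_def b_def weight_commute[of v t j i])
  have "step_expectation t (\<lambda>v. pair_ratio v (Suc t) i j) v
     = (w * a) * (w * b) * ((w + 2) / (G * ((1 + a) * (1 + b))))
      + (w * a) * (1 - w * b) * ((w + 1) / (G * ((1 + a) * (1 + b))))
      + (1 - w * a) * (w * b) * ((w + 1) / (G * ((1 + a) * (1 + b))))
      + (1 - w * a) * (1 - w * b) * (w / (G * ((1 + a) * (1 + b))))"
    by (subst step_expectation_pair[OF assms, where \<psi> = "\<lambda>x y. (w + of_bool x + of_bool y) / (G * ((1 + a) * (1 + b)))"])
       (auto simp: pair_ratio_def weight_upd_Suc growth_upd row_weight_upd growth_Suc w_def[symmetric] G_def a_def b_def p mult_ac simp del: weight.simps)
  also have "\<dots> = ((w * a) * (w * b) * (w + 2) + (w * a) * (1 - w * b) * (w + 1)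
      + (1 - w * a) * (w * b) * (w + 1) + (1 - w * a) * (1 - w * b) * w) / (G * ((1 + a) * (1 + b)))"
    by (simp only: times_divide_eq_right add_divide_distrib[symmetric])
  also have "\<dots> = w * (1 + a + b) / (G * ((1 + a) * (1 + b)))"
    by (rule arg_cong[where f="\<lambda>x. x / _"]) (simp add: algebra_simps)
  also have "\<dots> \<le> w * ((1 + a) * (1 + b)) / (G * ((1 + a) * (1 + b)))"
    using ab w G by (intro divide_right_mono mult_left_mono) (auto simp: algebra_simps)
  also have "\<dots> = w / G" using ab by simp
  finally show ?thesis by (simp add: pair_ratio_def w_def G_def)
qed

text \<open>The first factor is the conditional mean of the reciprocal of the new weight minus 1.
  The shift by 1 makes it collapse to
  \<open>(1 - a - b + 2 * (a * b) * (w / (w + 1))) / (w - 1)\<close>, whose first-order decay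
  cancels the growth of \<open>(1 + a) * (1 + b)\<close>.\<close>

lemma inverse_step_bound:
  fixes a b w :: real
  assumes "0 < a" "a \<le> 1/3" "0 < b" "b \<le> 1/3" "w \<ge> 2"
  shows "((w * a) * (w * b) / (w + 1) + (w * a) * (1 - w * b) / w
      + (1 - w * a) * (w * b) / w + (1 - w * a) * (1 - w * b) / (w - 1)) * ((1 + a) * (1 + b)) \<le> 1 / (w - 1)"
proof -
  have "(w * a) * (w * b) / (w + 1) + (w * a) * (1 - w * b) / w
      + (1 - w * a) * (w * b) / w + (1 - w * a) * (1 - w * b) / (w - 1)
     = (1 - a - b + 2 * (a * b) * (w / (w + 1))) / (w - 1)"
    using assms by (simp add: divide_simps) (simp add: algebra_simps)
  also have "\<dots> \<le> (1 - a - b + 2 * (a * b)) / (w - 1)"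
    using assms mult_left_mono[of "w / (w+1)" 1 "a * b"] by (intro divide_right_mono) auto
  finally have 1: "(w * a) * (w * b) / (w + 1) + (w * a) * (1 - w * b) / w
      + (1 - w * a) * (w * b) / w + (1 - w * a) * (1 - w * b) / (w - 1) \<le> (1 - a - b + 2 * (a * b)) / (w - 1)" .
  \<comment> \<open>After the cancellation only second-order corrections remain, and they have the
    right sign: for \<open>a\<close> and \<open>b\<close> at most 1/3 the last bracket is at least
    1/9.\<close>
  have "(1 - a - b + 2 * (a * b)) * ((1 + a) * (1 + b))
     = 1 - (a - b)\<^sup>2 - a * b * (1 - (a + b) - 2 * (a * b))"
    by (simp add: algebra_simps power2_eq_square)
  also have "\<dots> \<le> 1"
  proof -
    have "a * b \<le> 1/3 * (1/3)" using assms by (intro mult_mono) auto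
    then have "0 \<le> 1 - (a + b) - 2 * (a * b)" using assms by linarith
    then have "0 \<le> a * b * (1 - (a + b) - 2 * (a * b))" using assms by (intro mult_nonneg_nonneg) auto
    then show ?thesis using zero_le_power2[of "a - b"] by linarith
  qed
  finally have 2: "(1 - a - b + 2 * (a * b)) * ((1 + a) * (1 + b)) \<le> 1" .
  have "((w * a) * (w * b) / (w + 1) + (w * a) * (1 - w * b) / w
      + (1 - w * a) * (w * b) / w + (1 - w * a) * (1 - w * b) / (w - 1)) * ((1 + a) * (1 + b))
     \<le> (1 - a - b + 2 * (a * b)) / (w - 1) * ((1 + a) * (1 + b))"
    using assms by (intro mult_right_mono[OF 1]) auto
  also have "\<dots> = (1 - a - b + 2 * (a * b)) * ((1 + a) * (1 + b)) / (w - 1)" by simp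
  also have "\<dots> \<le> 1 / (w - 1)" using 2 assms by (intro divide_right_mono) auto
  finally show ?thesis .
qed

text \<open>\<open>Q\<close> stands for an event unaffected by round \<open>t\<close>, later that
  the weight has reached 2 by a fixed time. Three agents and \<open>t \<ge> 1\<close> make all row
  weights at least 3, as \<open>inverse_step_bound\<close> requires.\<close>

lemma step_expectation_pair_inverse:
  assumes "i \<noteq> (j::'n::finite)" "CARD('n) \<ge> 3" "t \<ge> 1"
    and Q: "\<And>f. Q (v(t := f)) = Q v" "Q v \<Longrightarrow> weight v t i j \<ge> 2"
  shows "step_expectation t (\<lambda>v. of_bool (Q v) * pair_inverse v (Suc t) i j) v \<le> of_bool (Q v) * pair_inverse v t i j"
proof (cases "Q v")
  case False
  then show ?thesis by (simp add: step_expectation_def Q)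
next
  case True
  have n: "CARD('n) \<ge> 2" using assms by simp
  define a where "a = 1 / row_weight v t i"
  define b where "b = 1 / row_weight v t j"
  define w where "w = weight v t i j"
  define G where "G = growth v t i * growth v t j"
  have "row_weight v t k \<ge> 3" for k
    using row_weight_ge[where v=v and t=t and i=k] assms by linarith
  then have ab: "a > 0" "b > 0" "a \<le> 1/3" "b \<le> 1/3"
    using row_weight_pos[OF n, of v t] by (auto simp: a_def b_def intro!: divide_left_mono)
  have G: "G > 0" by (simp add: G_def growth_pos)
  have w: "w \<ge> 2" using Q(2)[OF True] by (simp add: w_def)
  have p: "visit_matrix v t $ i $ j = w * a" "visit_matrix v t $ j $ i = w * b"
    by (simp_all add: visit_matrix_nth w_def a_def b_def weight_commute[of v t j i])
  have "step_expectation t (\<lambda>v. of_bool (Q v) * pair_inverse v (Suc t) i j) v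
     = (w * a) * (w * b) * (G * ((1 + a) * (1 + b)) / (w + 1))
      + (w * a) * (1 - w * b) * (G * ((1 + a) * (1 + b)) / w)
      + (1 - w * a) * (w * b) * (G * ((1 + a) * (1 + b)) / w)
      + (1 - w * a) * (1 - w * b) * (G * ((1 + a) * (1 + b)) / (w - 1))"
    by (subst step_expectation_pair[OF assms(1), where \<psi> = "\<lambda>x y. G * ((1 + a) * (1 + b)) / (w + of_bool x + of_bool y - 1)"])
       (auto simp: pair_inverse_def Q(1) True weight_upd_Suc growth_upd row_weight_upd growth_Suc w_def[symmetric] G_def a_def b_def p mult_ac simp del: weight.simps)
  also have "\<dots> = G * (((w * a) * (w * b) / (w + 1) + (w * a) * (1 - w * b) / w
      + (1 - w * a) * (w * b) / w + (1 - w * a) * (1 - w * b) / (w - 1)) * ((1 + a) * (1 + b)))"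
    by (simp add: algebra_simps)
  also have "\<dots> \<le> G * (1 / (w - 1))"
    using G by (intro mult_left_mono inverse_step_bound ab w) auto
  finally show ?thesis using True by (simp add: pair_inverse_def w_def G_def)
qed

text \<open>A pair that has not met yet meets in round \<open>t\<close> with probability at least
  the summand with index \<open>t\<close>, because a row weight is at most \<open>CARD('n)\<close>
  times the mean. The exponential offsets this loss; its divergence will show that every pair
  meets.\<close>

lemma step_expectation_unvisited:
  fixes i j :: "'n::finite"
  assumes "i \<noteq> j"
  defines "X \<equiv> \<lambda>t v. of_bool (weight v t i j = 1) * exp (\<Sum>s<t. 1 / (real CARD('n) * mean_weight CARD('n) s))"
  shows "step_expectation t (X (Suc t)) v \<le> X t v"
proof -
  have n: "CARD('n) \<ge> 2" using card_ge_2_distinct[OF assms(1)] .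
  let ?x = "1 / (real CARD('n) * mean_weight CARD('n) t)"
  define E where "E = exp (\<Sum>s<t. 1 / (real CARD('n) * mean_weight CARD('n) s))"
  define p where "p = visit_matrix v t $ i $ j"
  define q where "q = visit_matrix v t $ j $ i"
  have w: "weight v t i j \<ge> 1" using assms(1) by (rule weight_ge_1)
  have eq: "step_expectation t (X (Suc t)) v = of_bool (weight v t i j = 1) * ((1 - p) * (1 - q) * (E * exp ?x))"
    by (subst step_expectation_pair[OF assms(1), where \<psi> = "\<lambda>x y. of_bool (weight v t i j = 1 \<and> \<not> x \<and> \<not> y) * (E * exp ?x)"])
       (use w in \<open>auto simp: X_def weight_upd_Suc E_def exp_add p_def q_def simp del: weight.simps\<close>)
  show ?thesis
  proof (cases "weight v t i j = 1")
    case False then show ?thesis unfolding eq by (simp add: X_def)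
  next
    case True
    have "?x \<le> 1 / row_weight v t i"
      using row_weight_le[where v=v and t=t and i=i] row_weight_pos[OF n, of v t i]
      by (intro divide_left_mono) auto
    then have px: "?x \<le> p" using True by (simp add: p_def visit_matrix_nth)
    have q: "0 \<le> q" "q \<le> 1"
      using weight_le_row_weight[of v t j i] row_weight_pos[OF n, of v t j]
      by (auto simp: q_def weight_nonneg visit_matrix_nth)
    have p: "p \<le> 1"
      using weight_le_row_weight[of v t i j] row_weight_pos[OF n, of v t i]
      by (auto simp: p_def visit_matrix_nth)
    have "(1 - p) * (1 - q) \<le> (1 - p) * 1" using p q by (intro mult_left_mono) auto
    also have "(1 - p) * 1 \<le> exp (- x)" if "x \<le> p" for x
      using that exp_ge_add_one_self[of "- x"] by simp
    note this[OF px]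
    finally have "(1 - p) * (1 - q) * (E * exp ?x) \<le> exp (- ?x) * (E * exp ?x)"
      by (rule mult_right_mono) (simp add: E_def)
    also have "\<dots> = E" by (simp add: exp_minus)
    finally show ?thesis unfolding eq using True by (simp add: X_def E_def)
  qed
qed

section \<open>Convergence of nonnegative supermartingales\<close>

text \<open>Buy when the price is below \<open>a\<close>, sell when it exceeds \<open>b\<close>.\<close>

primrec holding :: "(nat \<Rightarrow> real) \<Rightarrow> real \<Rightarrow> real \<Rightarrow> nat \<Rightarrow> bool" where
  "holding x a b 0 \<longleftrightarrow> x 0 < a"
| "holding x a b (Suc k) \<longleftrightarrow> (if holding x a b k then x (Suc k) \<le> b else x (Suc k) < a)"

text \<open>Each completed sale earns at least \<open>b - a\<close>, and a position still open at
  the end loses at most \<open>a\<close> because prices are nonnegative.\<close>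

lemma upcrossing_bound:
  assumes "\<And>k. 0 \<le> x k" "0 \<le> a"
  shows "(b - a) * (\<Sum>k<T. of_bool (holding x a b k \<and> \<not> holding x a b (Suc k)))
    \<le> (\<Sum>k<T. of_bool (holding x a b k) * (x (Suc k) - x k)) + a"
proof -
  define U where "U T = (\<Sum>k<T. of_bool (holding x a b k \<and> \<not> holding x a b (Suc k)) :: real)" for T
  define D where "D T = (\<Sum>k<T. of_bool (holding x a b k) * (x (Suc k) - x k))" for T
  have [simp]: "U 0 = 0" "D 0 = 0"
    "U (Suc T) = U T + of_bool (holding x a b T \<and> \<not> holding x a b (Suc T))"
    "D (Suc T) = D T + of_bool (holding x a b T) * (x (Suc T) - x T)" for T
    by (simp_all add: U_def D_def del: holding.simps)
  \<comment> \<open>The induction has to carry the value of the open position relative to the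
    purchase level \<open>a\<close>.\<close>
  have "(b - a) * U T + of_bool (holding x a b T) * (x T - a) \<le> D T"
    by (induction T) (auto simp: algebra_simps)
  moreover have "- a \<le> of_bool (holding x a b T) * (x T - a)"
    using assms(1)[of T] assms(2) by auto
  ultimately have "(b - a) * U T \<le> D T + a" by linarith
  then show ?thesis by (simp only: U_def D_def)
qed

text \<open>If no sale happens after some time, a position held at a later price below
  \<open>a\<close> is never sold, so the price cannot exceed \<open>b\<close> again.\<close>

lemma no_oscillation_if_few_upcrossings:
  assumes "a < b" "eventually (\<lambda>k. \<not> (holding x a b k \<and> \<not> holding x a b (Suc k))) sequentially"
  shows "\<not> ((\<exists>\<^sub>F k in sequentially. x k < a) \<and> (\<exists>\<^sub>F k in sequentially. b < x k))"
proof
  assume *: "(\<exists>\<^sub>F k in sequentially. x k < a) \<and> (\<exists>\<^sub>F k in sequentially. b < x k)"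
  obtain N where N: "\<And>k. k \<ge> N \<Longrightarrow> holding x a b k \<Longrightarrow> holding x a b (Suc k)"
    using assms(2) by (auto simp: eventually_sequentially)
  obtain s where s: "s \<ge> N" "x s < a" using * by (auto simp: frequently_sequentially)
  have hs: "holding x a b s" using s assms(1) by (cases s) auto
  have h: "holding x a b (s + k)" for k by (induction k) (use hs s N in auto)
  obtain u where u: "u \<ge> Suc s" "b < x u" using * by (auto simp: frequently_sequentially)
  obtain k where "u = Suc (s + k)" using u(1) by (metis add_Suc less_eqE)
  then show False using h[of k] h[of "Suc k"] u(2) by simp
qed

text \<open>The levels are rational so that almost sure statements can be combined over countably
  many pairs of levels. The bound \<open>K\<close> along a subsequence excludes divergence to
  infinity.\<close>

lemma convergent_if_no_oscillation:
  fixes x :: "nat \<Rightarrow> real"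
  assumes nn: "\<And>k. 0 \<le> x k" and K: "\<exists>\<^sub>F k in sequentially. x k < K"
    and osc: "\<And>a b. a \<in> \<rat> \<Longrightarrow> b \<in> \<rat> \<Longrightarrow> 0 \<le> a \<Longrightarrow> a < b \<Longrightarrow>
      \<not> ((\<exists>\<^sub>F k in sequentially. x k < a) \<and> (\<exists>\<^sub>F k in sequentially. b < x k))"
  shows "convergent x"
proof -
  let ?y = "\<lambda>k. ereal (x k)"
  have "limsup ?y \<le> liminf ?y"
  proof (rule ccontr)
    assume "\<not> limsup ?y \<le> liminf ?y"
    then have lt: "liminf ?y < limsup ?y" by simp
    obtain b where b: "liminf ?y < ereal (of_rat b)" "ereal (of_rat b) < limsup ?y"
      using ereal_dense3[OF lt] by auto
    obtain a where a: "liminf ?y < ereal (of_rat a)" "ereal (of_rat a) < ereal (of_rat b)"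
      using ereal_dense3[OF b(1)] by auto
    have "0 \<le> liminf ?y" by (rule Liminf_bounded) (auto simp: nn)
    then have "0 \<le> ereal (of_rat a)" using a(1) by order
    then have a0: "(0::real) \<le> of_rat a" by (simp only: ereal_less_eq zero_ereal_def)
    have 1: "\<exists>\<^sub>F k in sequentially. x k < of_rat a"
    proof (rule ccontr)
      assume "\<not> ?thesis"
      then have "eventually (\<lambda>k. ereal (of_rat a) \<le> ?y k) sequentially"
        by (auto simp: frequently_def not_less)
      from Liminf_bounded[OF this] a(1) show False by order
    qed
    have 2: "\<exists>\<^sub>F k in sequentially. of_rat b < x k"
    proof (rule ccontr)
      assume "\<not> ?thesis"
      then have "eventually (\<lambda>k. ?y k \<le> ereal (of_rat b)) sequentially"
        by (auto simp: frequently_def not_less)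
      from Limsup_bounded[OF this] b(2) show False by order
    qed
    show False using osc[of "of_rat a" "of_rat b"] a(2) a0 1 2 by auto
  qed
  then have eq: "liminf ?y = limsup ?y" using Liminf_le_Limsup[of sequentially ?y] by simp
  have "liminf ?y \<le> ereal K"
  proof (rule ccontr)
    assume "\<not> ?thesis"
    then have "eventually (\<lambda>k. ereal K < ?y k) sequentially" by (intro less_LiminfD) simp
    then have "eventually (\<lambda>k. \<not> x k < K) sequentially" by (rule eventually_mono) simp
    with K show False unfolding frequently_def by (rule notE)
  qed
  moreover have "0 \<le> liminf ?y" by (rule Liminf_bounded) (auto simp: nn)
  ultimately obtain l where l: "liminf ?y = ereal l"
    by (cases "liminf ?y") auto
  have "(?y \<longlongrightarrow> ereal l) sequentially"
    by (rule Liminf_eq_Limsup) (use eq l in auto)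
  then show ?thesis by (auto simp: convergent_def)
qed

text \<open>Plays the role of measurability with respect to the rounds before \<open>t\<close>, but
  as a property of functions of trajectories, without reference to a probability space.\<close>

definition determined :: "nat \<Rightarrow> ((nat \<Rightarrow> 'c) \<Rightarrow> 'b) \<Rightarrow> bool" where
  "determined t \<phi> \<longleftrightarrow> (\<forall>v v'. (\<forall>s<t. v s = v' s) \<longrightarrow> \<phi> v = \<phi> v')"

lemma determinedD: "determined t \<phi> \<Longrightarrow> (\<And>s. s < t \<Longrightarrow> v s = v' s) \<Longrightarrow> \<phi> v = \<phi> v'"
  by (auto simp: determined_def)

lemma determined_mono: "determined s \<phi> \<Longrightarrow> s \<le> t \<Longrightarrow> determined t \<phi>"
  unfolding determined_def by (meson order_less_le_trans)

lemma determined_binop: "determined t \<phi> \<Longrightarrow> determined t \<psi> \<Longrightarrow> determined t (\<lambda>v. F (\<phi> v) (\<psi> v))"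
  unfolding determined_def by metis

lemma determined_unop: "determined t \<phi> \<Longrightarrow> determined t (\<lambda>v. F (\<phi> v))"
  unfolding determined_def by metis

lemma determined_step_expectation:
  assumes "determined (Suc t) \<phi>" shows "determined t (step_expectation t \<phi>)"
  unfolding determined_def step_expectation_def
proof (intro allI impI sum.cong refl)
  fix v v' :: "nat \<Rightarrow> 'a \<Rightarrow> 'a" and f assume *: "\<forall>s<t. v s = v' s"
  have "visit_matrix v t = visit_matrix v' t" using * by (intro visit_matrix_cong) auto
  moreover have "\<phi> (v(t := f)) = \<phi> (v'(t := f))"
    by (rule determinedD[OF assms]) (use * in auto)
  ultimately show "(\<Prod>i\<in>UNIV. visit_matrix v t $ i $ f i) * \<phi> (v(t := f))
      = (\<Prod>i\<in>UNIV. visit_matrix v' t $ i $ f i) * \<phi> (v'(t := f))" by simp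
qed

text \<open>The inequality is required on every trajectory, not only almost surely. There is a
  starting time because the inequality for \<open>pair_inverse\<close> is available only from a
  positive time on, with the condition on the weight frozen there.\<close>

definition supermartingale_from :: "nat \<Rightarrow> (nat \<Rightarrow> (nat \<Rightarrow> 'n \<Rightarrow> 'n::finite) \<Rightarrow> real) \<Rightarrow> bool" where
  "supermartingale_from t\<^sub>0 X \<longleftrightarrow> (\<forall>t v. 0 \<le> X t v)
    \<and> (\<forall>t\<ge>t\<^sub>0. determined t (X t) \<and> (\<forall>v. step_expectation t (X (Suc t)) v \<le> X t v))"

section \<open>Expectations along the process and supermartingale convergence\<close>

context friends_II
begin

definition visits :: "'a \<Rightarrow> nat \<Rightarrow> 'n \<Rightarrow> 'n" where "visits \<omega> = (\<lambda>s. V s \<omega>)"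

definition cylinder :: "nat \<Rightarrow> (nat \<Rightarrow> 'n \<Rightarrow> 'n) \<Rightarrow> 'a set" where
  "cylinder t h = {\<omega> \<in> space M. \<forall>s<t. V s \<omega> = h s}"

text \<open>The extensional function space fixes the values from time \<open>t\<close> on, so each
  history before \<open>t\<close> has one representative and the cylinders over
  \<open>histories t\<close> partition the space.\<close>

definition histories :: "nat \<Rightarrow> (nat \<Rightarrow> 'n \<Rightarrow> 'n) set" where
  "histories t = PiE {..<t} (\<lambda>_. UNIV)"

lemma finite_histories: "finite (histories t)"
  unfolding histories_def by (intro finite_PiE) auto

lemma sets_cylinder [measurable]: "cylinder t h \<in> sets M"
  unfolding cylinder_def by measurable

text \<open>Null histories cause no exception: the longer cylinder is contained in the shorter one,
  so both sides vanish.\<close>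

lemma prob_cylinder_Suc:
  "prob (cylinder (Suc t) (h(t := f))) = prob (cylinder t h) * (\<Prod>i\<in>UNIV. visit_matrix h t $ i $ f i)"
proof (cases "prob (cylinder t h) = 0")
  case True
  have "cylinder (Suc t) (h(t := f)) \<subseteq> cylinder t h"
    by (auto simp: cylinder_def less_Suc_eq)
  then have "prob (cylinder (Suc t) (h(t := f))) \<le> prob (cylinder t h)"
    by (rule finite_measure_mono) simp
  then show ?thesis using True measure_nonneg[of M "cylinder (Suc t) (h(t := f))"] by simp
next
  case False
  then have pos: "\<P>(\<omega> in M. \<forall>s<t. V s \<omega> = h s) > 0"
    by (simp add: cylinder_def zero_less_measure_iff)
  have "cylinder (Suc t) (h(t := f)) = {\<omega> \<in> space M. V t \<omega> = f \<and> (\<forall>s<t. V s \<omega> = h s)}"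
    by (auto simp: cylinder_def less_Suc_eq)
  then show ?thesis using visits_cond_prob[OF pos, of f] pos
    by (simp add: cond_prob_def cylinder_def field_simps)
qed

lemma determined_eq_sum:
  fixes \<phi> :: "_ \<Rightarrow> real"
  assumes "determined t \<phi>" "\<omega> \<in> space M"
  shows "\<phi> (visits \<omega>) = (\<Sum>h\<in>histories t. \<phi> h * indicator (cylinder t h) \<omega>)"
proof -
  define h\<^sub>0 where "h\<^sub>0 = restrict (visits \<omega>) {..<t}"
  have h0: "h\<^sub>0 \<in> histories t" by (auto simp: h\<^sub>0_def histories_def)
  have "h = h\<^sub>0" if "h \<in> histories t" "\<omega> \<in> cylinder t h" for h
  proof
    fix s show "h s = h\<^sub>0 s"
      using that PiE_arb[of h "{..<t}" "\<lambda>_. UNIV" s]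
      by (cases "s < t") (auto simp: cylinder_def h\<^sub>0_def histories_def visits_def)
  qed
  moreover have "\<omega> \<in> cylinder t h\<^sub>0" using assms(2) by (auto simp: cylinder_def h\<^sub>0_def visits_def)
  ultimately have "\<omega> \<in> cylinder t h \<longleftrightarrow> h = h\<^sub>0" if "h \<in> histories t" for h
    using that by blast
  then have "indicator (cylinder t h) \<omega> = (if h = h\<^sub>0 then 1 else 0 :: real)" if "h \<in> histories t" for h
    using that unfolding indicator_def by simp
  then have "(\<Sum>h\<in>histories t. \<phi> h * indicator (cylinder t h) \<omega>) = (\<Sum>h\<in>histories t. if h = h\<^sub>0 then \<phi> h else 0)"
    by (intro sum.cong) auto
  also have "\<dots> = \<phi> h\<^sub>0" using h0 finite_histories by simp
  also have "\<dots> = \<phi> (visits \<omega>)" by (rule determinedD[OF assms(1)]) (simp add: h\<^sub>0_def)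
  finally show ?thesis by simp
qed

lemma measurable_determined:
  assumes "determined t \<phi>"
  shows "(\<lambda>\<omega>. \<phi> (visits \<omega>)) \<in> measurable M (count_space UNIV)"
proof (rule measurableI)
  fix U assume "U \<in> sets (count_space (UNIV :: 'b set))"
  have "(\<lambda>\<omega>. \<phi> (visits \<omega>)) -` U \<inter> space M = (\<Union>h\<in>{h \<in> histories t. \<phi> h \<in> U}. cylinder t h)"
  proof (intro equalityI subsetI)
    fix \<omega> assume \<omega>: "\<omega> \<in> (\<lambda>\<omega>. \<phi> (visits \<omega>)) -` U \<inter> space M"
    have "\<phi> (restrict (visits \<omega>) {..<t}) = \<phi> (visits \<omega>)"
      by (rule determinedD[OF assms]) simp
    then show "\<omega> \<in> (\<Union>h\<in>{h \<in> histories t. \<phi> h \<in> U}. cylinder t h)" using \<omega>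
      by (intro UN_I[of "restrict (visits \<omega>) {..<t}"]) (auto simp: histories_def cylinder_def visits_def)
  next
    fix \<omega> assume "\<omega> \<in> (\<Union>h\<in>{h \<in> histories t. \<phi> h \<in> U}. cylinder t h)"
    then obtain h where h: "\<phi> h \<in> U" "\<omega> \<in> cylinder t h" by auto
    have "\<phi> (visits \<omega>) = \<phi> h"
      by (rule determinedD[OF assms]) (use h in \<open>auto simp: cylinder_def visits_def\<close>)
    then show "\<omega> \<in> (\<lambda>\<omega>. \<phi> (visits \<omega>)) -` U \<inter> space M" using h by (auto simp: cylinder_def)
  qed
  also have "\<dots> \<in> sets M" by (intro sets.finite_UN) (auto simp: finite_histories)
  finally show "(\<lambda>\<omega>. \<phi> (visits \<omega>)) -` U \<inter> space M \<in> sets M" .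
qed simp

lemma borel_measurable_determined:
  "determined t \<phi> \<Longrightarrow> (\<lambda>\<omega>. \<phi> (visits \<omega>)) \<in> borel_measurable M"
  using measurable_compose[OF measurable_determined, of t \<phi> id borel] by simp

lemma determined_integral:
  fixes \<phi> :: "_ \<Rightarrow> real"
  assumes "determined t \<phi>"
  shows integrable_determined: "integrable M (\<lambda>\<omega>. \<phi> (visits \<omega>))"
    and expectation_determined: "expectation (\<lambda>\<omega>. \<phi> (visits \<omega>)) = (\<Sum>h\<in>histories t. \<phi> h * prob (cylinder t h))"
proof -
  have "integrable M (\<lambda>\<omega>. \<Sum>h\<in>histories t. \<phi> h * indicator (cylinder t h) \<omega>)"
    by (intro Bochner_Integration.integrable_sum integrable_mult_right integrable_real_indicator) (auto simp: emeasure_eq_measure)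
  then show "integrable M (\<lambda>\<omega>. \<phi> (visits \<omega>))"
    by (subst Bochner_Integration.integrable_cong[OF refl determined_eq_sum[OF assms]]) auto
  have "expectation (\<lambda>\<omega>. \<phi> (visits \<omega>)) = expectation (\<lambda>\<omega>. \<Sum>h\<in>histories t. \<phi> h * indicator (cylinder t h) \<omega>)"
    by (rule Bochner_Integration.integral_cong[OF refl determined_eq_sum[OF assms]])
  also have "\<dots> = (\<Sum>h\<in>histories t. \<phi> h * prob (cylinder t h))"
    by (subst Bochner_Integration.integral_sum) (auto simp: emeasure_eq_measure)
  finally show "expectation (\<lambda>\<omega>. \<phi> (visits \<omega>)) = (\<Sum>h\<in>histories t. \<phi> h * prob (cylinder t h))" .
qed

lemma expectation_of_bool:
  assumes "{\<omega> \<in> space M. P \<omega>} \<in> sets M"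
  shows "expectation (\<lambda>\<omega>. of_bool (P \<omega>)) = prob {\<omega> \<in> space M. P \<omega>}"
proof -
  have "(\<lambda>\<omega>. of_bool (P \<omega>)) \<omega> = indicator {\<omega> \<in> space M. P \<omega>} \<omega>" if "\<omega> \<in> space M" for \<omega>
    using that by (simp add: indicator_def)
  then have "expectation (\<lambda>\<omega>. of_bool (P \<omega>)) = expectation (indicator {\<omega> \<in> space M. P \<omega>})"
    by (rule Bochner_Integration.integral_cong[OF refl])
  also have "\<dots> = prob ({\<omega> \<in> space M. P \<omega>} \<inter> space M)" by (rule Bochner_Integration.integral_indicator)
  also have "{\<omega> \<in> space M. P \<omega>} \<inter> space M = {\<omega> \<in> space M. P \<omega>}" by blast
  finally show ?thesis .
qed

text \<open>The tower property for conditioning on the rounds before \<open>t\<close>.\<close>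

lemma expectation_step:
  fixes \<phi> :: "_ \<Rightarrow> real"
  assumes "determined (Suc t) \<phi>"
  shows "expectation (\<lambda>\<omega>. \<phi> (visits \<omega>)) = expectation (\<lambda>\<omega>. step_expectation t \<phi> (visits \<omega>))"
proof -
  \<comment> \<open>A history of length \<open>Suc t\<close> is one of length \<open>t\<close>
    together with a joint choice; the inverse resets coordinate \<open>t\<close> to
    \<open>undefined\<close> to stay extensional.\<close>
  have bij: "bij_betw (\<lambda>(h, f). h(t := f)) (histories t \<times> UNIV) (histories (Suc t))"
    by (rule bij_betw_byWitness[where f' = "\<lambda>h. (h(t := undefined), h t)"])
       (auto simp: histories_def PiE_iff extensional_def fun_eq_iff less_Suc_eq)
  have "expectation (\<lambda>\<omega>. \<phi> (visits \<omega>)) = (\<Sum>h\<in>histories (Suc t). \<phi> h * prob (cylinder (Suc t) h))"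
    by (rule expectation_determined[OF assms])
  also have "\<dots> = (\<Sum>(h, f)\<in>histories t \<times> UNIV. \<phi> (h(t := f)) * prob (cylinder (Suc t) (h(t := f))))"
    by (subst sum.reindex_bij_betw[OF bij, symmetric]) (simp add: case_prod_unfold)
  also have "\<dots> = (\<Sum>h\<in>histories t. \<Sum>f\<in>UNIV. \<phi> (h(t := f)) * prob (cylinder (Suc t) (h(t := f))))"
    by (rule sum.cartesian_product[symmetric])
  also have "\<dots> = (\<Sum>h\<in>histories t. step_expectation t \<phi> h * prob (cylinder t h))"
    by (simp add: prob_cylinder_Suc step_expectation_def sum_distrib_left mult_ac)
  also have "\<dots> = expectation (\<lambda>\<omega>. step_expectation t \<phi> (visits \<omega>))"
    by (rule expectation_determined[OF determined_step_expectation[OF assms], symmetric])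
  finally show ?thesis .
qed

text \<open>\<open>H\<close> is a stake fixed before round \<open>t\<close>, so it factors out of
  the one-step expectation. Indicators of holding and of past events serve as stakes.\<close>

lemma supermartingale_expectation_Suc:
  assumes X: "supermartingale_from t\<^sub>0 X" and t: "t\<^sub>0 \<le> t" and H: "determined t H" "\<And>v. 0 \<le> H v"
  shows "expectation (\<lambda>\<omega>. H (visits \<omega>) * X (Suc t) (visits \<omega>)) \<le> expectation (\<lambda>\<omega>. H (visits \<omega>) * X t (visits \<omega>))"
proof -
  have d: "determined t (X t)" "determined (Suc t) (X (Suc t))"
    using X t by (auto simp: supermartingale_from_def)
  have dH: "determined (Suc t) H" using H(1) by (rule determined_mono) simp
  have HX: "determined (Suc t) (\<lambda>v. H v * X (Suc t) v)" by (rule determined_binop[OF dH d(2)])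
  have "H (v(t := f)) = H v" for v f by (rule determinedD[OF H(1)]) simp
  then have eq: "step_expectation t (\<lambda>v. H v * X (Suc t) v) v = H v * step_expectation t (X (Suc t)) v" for v
    by (simp add: step_expectation_def sum_distrib_left mult_ac)
  have "expectation (\<lambda>\<omega>. H (visits \<omega>) * X (Suc t) (visits \<omega>))
      = expectation (\<lambda>\<omega>. step_expectation t (\<lambda>v. H v * X (Suc t) v) (visits \<omega>))"
    by (rule expectation_step[OF HX])
  also have "\<dots> \<le> expectation (\<lambda>\<omega>. H (visits \<omega>) * X t (visits \<omega>))"
  proof (rule integral_mono)
    show "integrable M (\<lambda>\<omega>. step_expectation t (\<lambda>v. H v * X (Suc t) v) (visits \<omega>))"
      by (rule integrable_determined[OF determined_step_expectation[OF HX]])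
    show "integrable M (\<lambda>\<omega>. H (visits \<omega>) * X t (visits \<omega>))"
      by (rule integrable_determined[OF determined_binop[OF H(1) d(1)]])
    show "step_expectation t (\<lambda>v. H v * X (Suc t) v) (visits \<omega>) \<le> H (visits \<omega>) * X t (visits \<omega>)" for \<omega>
      unfolding eq using X t H(2) by (intro mult_left_mono) (auto simp: supermartingale_from_def)
  qed
  finally show ?thesis .
qed

lemma supermartingale_expectation_le:
  assumes X: "supermartingale_from t\<^sub>0 X" and t: "t\<^sub>0 \<le> t"
  shows "expectation (\<lambda>\<omega>. X t (visits \<omega>)) \<le> expectation (\<lambda>\<omega>. X t\<^sub>0 (visits \<omega>))"
  using t
proof (induction t rule: dec_induct)
  case (step t)
  have "expectation (\<lambda>\<omega>. X (Suc t) (visits \<omega>)) \<le> expectation (\<lambda>\<omega>. X t (visits \<omega>))"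
    using supermartingale_expectation_Suc[OF X, of t "\<lambda>_. 1"] step by (simp add: determined_def)
  then show ?case using step by simp
qed simp

lemma determined_holding:
  assumes X: "supermartingale_from t\<^sub>0 X"
  shows "determined (t\<^sub>0 + k) (\<lambda>v. holding (\<lambda>k. X (t\<^sub>0 + k) v) a b k)"
proof (induction k)
  case 0
  have "determined t\<^sub>0 (X t\<^sub>0)" using X by (auto simp: supermartingale_from_def)
  then show ?case by (simp add: determined_unop[where F="\<lambda>x. x < a"])
next
  case (Suc k)
  have 1: "determined (Suc (t\<^sub>0 + k)) (X (Suc (t\<^sub>0 + k)))" using X by (auto simp: supermartingale_from_def)
  have 2: "determined (Suc (t\<^sub>0 + k)) (\<lambda>v. holding (\<lambda>k. X (t\<^sub>0 + k) v) a b k)"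
    by (rule determined_mono[OF Suc]) simp
  show ?case using determined_binop[OF 1 2, where F="\<lambda>x h. if h then x \<le> b else x < a"]
    unfolding holding.simps add_Suc_right .
qed

text \<open>Doob's argument: a bounded mean number of upcrossings excludes oscillation between two
  fixed levels, and Fatou's lemma excludes an infinite limit.\<close>

theorem supermartingale_convergence:
  assumes X: "supermartingale_from t\<^sub>0 X"
  shows "AE \<omega> in M. convergent (\<lambda>t. X t (visits \<omega>))"
proof -
  let ?x = "\<lambda>\<omega> k. X (t\<^sub>0 + k) (visits \<omega>)"
  have X0: "0 \<le> X t v" for t v using X by (auto simp: supermartingale_from_def)
  have d: "determined (t\<^sub>0 + k) (X (t\<^sub>0 + k))" for k using X by (auto simp: supermartingale_from_def)
  have up: "AE \<omega> in M. \<not> ((\<exists>\<^sub>F k in sequentially. ?x \<omega> k < a) \<and> (\<exists>\<^sub>F k in sequentially. b < ?x \<omega> k))"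
    if ab: "0 \<le> a" "a < b" for a b
  proof -
    let ?U = "\<lambda>k v. holding (\<lambda>k. X (t\<^sub>0 + k) v) a b k \<and> \<not> holding (\<lambda>k. X (t\<^sub>0 + k) v) a b (Suc k)"
    let ?A = "\<lambda>k. {\<omega> \<in> space M. ?U k (visits \<omega>)}"
    have dH: "determined (t\<^sub>0 + k) (\<lambda>v. of_bool (holding (\<lambda>k. X (t\<^sub>0 + k) v) a b k) :: real)" for k
      by (rule determined_unop[OF determined_holding[OF X]])
    have dU: "determined (Suc (t\<^sub>0 + k)) (?U k)" for k
    proof (rule determined_binop[where F="\<lambda>x y. x \<and> \<not> y"])
      show "determined (Suc (t\<^sub>0 + k)) (\<lambda>v. holding (\<lambda>k. X (t\<^sub>0 + k) v) a b k)"
        by (rule determined_mono[OF determined_holding[OF X]]) simp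
      show "determined (Suc (t\<^sub>0 + k)) (\<lambda>v. holding (\<lambda>k. X (t\<^sub>0 + k) v) a b (Suc k))"
        using determined_holding[OF X, where k="Suc k"] by simp
    qed
    have A [measurable]: "?A k \<in> sets M" for k
      using measurable_sets[OF measurable_determined[OF dU[of k]], of "{True}"] by (simp add: vimage_def Int_def conj_commute)
    have dU': "determined (Suc (t\<^sub>0 + k)) (\<lambda>v. of_bool (?U k v) :: real)" for k
      by (rule determined_unop[OF dU])
    have probA: "expectation (\<lambda>\<omega>. of_bool (?U k (visits \<omega>))) = prob (?A k)" for k
      by (rule expectation_of_bool[OF A])
    \<comment> \<open>Holding is decided before the next price is known, so the expected gain is
      nonpositive.\<close>
    have le: "expectation (\<lambda>\<omega>. of_bool (holding (?x \<omega>) a b k) * (?x \<omega> (Suc k) - ?x \<omega> k)) \<le> 0"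
      and int: "integrable M (\<lambda>\<omega>. of_bool (holding (?x \<omega>) a b k) * (?x \<omega> (Suc k) - ?x \<omega> k))" for k
    proof -
      have i1: "integrable M (\<lambda>\<omega>. of_bool (holding (?x \<omega>) a b k) * ?x \<omega> k)"
        by (rule integrable_determined[OF determined_binop[OF dH d]])
      have i2: "integrable M (\<lambda>\<omega>. of_bool (holding (?x \<omega>) a b k) * ?x \<omega> (Suc k))"
        by (rule integrable_determined[OF determined_binop[OF determined_mono[OF dH] d]]) simp
      have "expectation (\<lambda>\<omega>. of_bool (holding (?x \<omega>) a b k) * ?x \<omega> (Suc k))
          \<le> expectation (\<lambda>\<omega>. of_bool (holding (?x \<omega>) a b k) * ?x \<omega> k)"
        using supermartingale_expectation_Suc[OF X _ dH[of k]] by simp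
      then show "expectation (\<lambda>\<omega>. of_bool (holding (?x \<omega>) a b k) * (?x \<omega> (Suc k) - ?x \<omega> k)) \<le> 0"
        using i1 i2 by (simp add: right_diff_distrib)
      show "integrable M (\<lambda>\<omega>. of_bool (holding (?x \<omega>) a b k) * (?x \<omega> (Suc k) - ?x \<omega> k))"
        using Bochner_Integration.integrable_diff[OF i2 i1] by (simp add: right_diff_distrib)
    qed
    have bound: "(\<Sum>k<T. prob (?A k)) \<le> a / (b - a)" for T
    proof -
      have iU: "integrable M (\<lambda>\<omega>. of_bool (?U k (visits \<omega>)) :: real)" for k
        by (rule integrable_determined[OF dU'])
      have "(b - a) * (\<Sum>k<T. prob (?A k)) = expectation (\<lambda>\<omega>. (b - a) * (\<Sum>k<T. of_bool (?U k (visits \<omega>))))"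
        by (subst Bochner_Integration.integral_mult_right[OF Bochner_Integration.integrable_sum[OF iU]],
            subst Bochner_Integration.integral_sum[OF iU]) (simp only: probA)
      also have "\<dots> \<le> expectation (\<lambda>\<omega>. (\<Sum>k<T. of_bool (holding (?x \<omega>) a b k) * (?x \<omega> (Suc k) - ?x \<omega> k)) + a)"
        using iU int ab by (intro integral_mono upcrossing_bound X0 Bochner_Integration.integrable_add
            Bochner_Integration.integrable_sum integrable_mult_right) auto
      also have "\<dots> = (\<Sum>k<T. expectation (\<lambda>\<omega>. of_bool (holding (?x \<omega>) a b k) * (?x \<omega> (Suc k) - ?x \<omega> k))) + a"
        by (subst Bochner_Integration.integral_add[OF Bochner_Integration.integrable_sum[OF int]], simp,
            subst Bochner_Integration.integral_sum[OF int]) (simp add: prob_space)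
      also have "\<dots> \<le> a" using sum_nonpos[of "{..<T}" "\<lambda>k. expectation (\<lambda>\<omega>. of_bool (holding (?x \<omega>) a b k) * (?x \<omega> (Suc k) - ?x \<omega> k))"] le by simp
      finally show ?thesis using ab by (simp add: field_simps)
    qed
    \<comment> \<open>The bound is uniform in \<open>T\<close>, so by Borel-Cantelli only finitely
      many upcrossings are completed.\<close>
    have "summable (\<lambda>k. prob (?A k))"
      by (rule summableI_nonneg_bounded[OF _ bound]) simp
    from A _ this have "AE \<omega> in M. eventually (\<lambda>k. \<omega> \<in> space M - ?A k) sequentially"
      by (rule borel_cantelli_AE1) (simp add: emeasure_eq_measure)
    then show ?thesis
    proof (rule AE_mp, intro AE_I2 impI)
      fix \<omega> assume "\<omega> \<in> space M" "eventually (\<lambda>k. \<omega> \<in> space M - ?A k) sequentially"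
      then have "eventually (\<lambda>k. \<not> ?U k (visits \<omega>)) sequentially"
        by (auto elim!: eventually_mono)
      then show "\<not> ((\<exists>\<^sub>F k in sequentially. ?x \<omega> k < a) \<and> (\<exists>\<^sub>F k in sequentially. b < ?x \<omega> k))"
        by (rule no_oscillation_if_few_upcrossings[OF ab(2)])
    qed
  qed
  have osc: "AE \<omega> in M. \<forall>a\<in>\<rat>. \<forall>b\<in>\<rat>. 0 \<le> a \<longrightarrow> a < b \<longrightarrow>
      \<not> ((\<exists>\<^sub>F k in sequentially. ?x \<omega> k < a) \<and> (\<exists>\<^sub>F k in sequentially. b < ?x \<omega> k))"
    by (intro AE_ball_countable' countable_rat) (use up in \<open>auto simp: AE_conj_iff imp_conjL\<close>)
  \<comment> \<open>Fatou's lemma bounds the mean of the lower limit by the initial expectation, so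
    the lower limit is almost surely finite.\<close>
  have fin: "AE \<omega> in M. \<exists>K. \<exists>\<^sub>F k in sequentially. ?x \<omega> k < K"
  proof -
    have m [measurable]: "(\<lambda>\<omega>. ?x \<omega> k) \<in> borel_measurable M" for k
      by (rule borel_measurable_determined[OF d])
    have "(\<integral>\<^sup>+\<omega>. liminf (\<lambda>k. ennreal (?x \<omega> k)) \<partial>M) \<le> liminf (\<lambda>k. \<integral>\<^sup>+\<omega>. ennreal (?x \<omega> k) \<partial>M)"
      by (rule nn_integral_liminf) measurable
    also have "\<dots> \<le> limsup (\<lambda>k. \<integral>\<^sup>+\<omega>. ennreal (?x \<omega> k) \<partial>M)" by (rule Liminf_le_Limsup) simp
    also have "\<dots> \<le> ennreal (expectation (\<lambda>\<omega>. X t\<^sub>0 (visits \<omega>)))"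
    proof (rule Limsup_bounded, intro always_eventually allI)
      fix k
      have "(\<integral>\<^sup>+\<omega>. ennreal (?x \<omega> k) \<partial>M) = ennreal (expectation (\<lambda>\<omega>. ?x \<omega> k))"
        by (rule nn_integral_eq_integral[OF integrable_determined[OF d]]) (simp add: X0)
      also have "\<dots> \<le> ennreal (expectation (\<lambda>\<omega>. X t\<^sub>0 (visits \<omega>)))"
        by (intro ennreal_leI supermartingale_expectation_le[OF X]) simp
      finally show "(\<integral>\<^sup>+\<omega>. ennreal (?x \<omega> k) \<partial>M) \<le> ennreal (expectation (\<lambda>\<omega>. X t\<^sub>0 (visits \<omega>)))" .
    qed
    finally have "(\<integral>\<^sup>+\<omega>. liminf (\<lambda>k. ennreal (?x \<omega> k)) \<partial>M) \<noteq> \<infinity>" by (auto simp: top_unique)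
    then have "AE \<omega> in M. liminf (\<lambda>k. ennreal (?x \<omega> k)) \<noteq> \<infinity>"
      by (intro nn_integral_noteq_infinite) measurable
    then show ?thesis
    proof (rule AE_mp, intro AE_I2 impI)
      fix \<omega> assume "liminf (\<lambda>k. ennreal (?x \<omega> k)) \<noteq> \<infinity>"
      then obtain K where K: "0 \<le> K" "liminf (\<lambda>k. ennreal (?x \<omega> k)) = ennreal K"
        by (metis ennreal_cases infinity_ennreal_def)
      show "\<exists>K. \<exists>\<^sub>F k in sequentially. ?x \<omega> k < K"
      proof (rule ccontr)
        assume "\<not> ?thesis"
        then have "eventually (\<lambda>k. K + 1 \<le> ?x \<omega> k) sequentially"
          by (auto simp: frequently_def not_less)
        then have "ennreal (K + 1) \<le> liminf (\<lambda>k. ennreal (?x \<omega> k))"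
          by (intro Liminf_bounded) (auto elim!: eventually_mono intro: ennreal_leI)
        then show False using K by (simp add: ennreal_le_iff)
      qed
    qed
  qed
  from osc fin show ?thesis
  proof eventually_elim
    case (elim \<omega>)
    have "convergent (?x \<omega>)"
      using elim by (auto intro!: convergent_if_no_oscillation X0)
    then have "convergent (\<lambda>k. X (k + t\<^sub>0) (visits \<omega>))" by (simp add: add.commute)
    then show ?case by (rule convergent_ignore_initial_segment[THEN iffD1])
  qed
qed

end

section \<open>Rigidity of diagonal scalings\<close>

text \<open>Compare the rows of the largest and the smallest scaling factor \<open>r a\<close> and \<open>r b\<close>: they force
  \<open>r a * r b\<close> to be close to \<open>1\<close>, and then a third index \<open>k\<close> forces \<open>r k\<close> to be close to both.\<close>

lemma scaling_rigidity:
  fixes A :: "'n::finite \<Rightarrow> 'n \<Rightarrow> real" and r :: "'n \<Rightarrow> real"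
  assumes n: "CARD('n) \<ge> 3" and \<delta>: "0 < \<delta>" "\<delta> \<le> 1" and \<eta>: "0 \<le> \<eta>" "100 * \<eta> \<le> \<delta>"
    and A: "\<And>i j. 0 \<le> A i j" "\<And>i j. i \<noteq> j \<Longrightarrow> \<delta> \<le> A i j"
    and r: "\<And>i. 0 < r i"
    and rowA: "\<And>i. \<bar>(\<Sum>j\<in>UNIV. A i j) - 1\<bar> \<le> \<eta>"
    and rowB: "\<And>i. \<bar>(\<Sum>j\<in>UNIV. A i j * (r i * r j)) - 1\<bar> \<le> \<eta>"
  shows "\<bar>r i * r j - 1\<bar> \<le> 64 * \<eta> / \<delta>"
proof -
  have "Max (range r) \<in> range r" "Min (range r) \<in> range r" by (simp_all add: Max_in Min_in)
  then obtain a b where ab: "Max (range r) = r a" "Min (range r) = r b" by blast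
  have a: "r i \<le> r a" for i unfolding ab(1)[symmetric] by simp
  have b: "r b \<le> r i" for i unfolding ab(2)[symmetric] by simp
  have "\<not> UNIV \<subseteq> {a, b}" using card_mono[of "{a,b}" "UNIV::'n set"] n card_insert_le_m1[of 2 "{b}" a] by auto
  then obtain k where k: "k \<noteq> a" "k \<noteq> b" by auto
  define s where "s = r a * r b"
  define \<alpha> where "\<alpha> i = (\<Sum>j\<in>UNIV. A i j)" for i
  define \<beta> where "\<beta> i = (\<Sum>j\<in>UNIV. A i j * (r i * r j))" for i
  \<comment> \<open>The final factor 64 is 8 times 8: \<theta> bounds the gaps at \<open>k\<close>,
    and the squares of the extremal factors deviate from 1 by at most
    \<open>8 * \<theta>\<close>.\<close>
  define \<theta> where "\<theta> = 8 * \<eta> / \<delta>"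
  have ra: "r a > 0" and rb: "r b > 0" using r by auto
  have s0: "s > 0" by (simp add: s_def ra rb)
  have \<eta>1: "\<eta> \<le> 1/100" using \<eta> \<delta> by linarith
  have \<alpha>: "1 - \<eta> \<le> \<alpha> i" "\<alpha> i \<le> 1 + \<eta>" for i using rowA[of i] by (auto simp: \<alpha>_def abs_le_iff)
  have \<beta>: "1 - \<eta> \<le> \<beta> i" "\<beta> i \<le> 1 + \<eta>" for i using rowB[of i] by (auto simp: \<beta>_def abs_le_iff)
  \<comment> \<open>Since \<open>r b\<close> is minimal and \<open>r a\<close> maximal, all summands
    in these two identities are nonnegative, so the summand at \<open>k\<close> alone is bounded by
    the left-hand side.\<close>
  have eqa: "\<beta> a - \<alpha> a * s = (\<Sum>j\<in>UNIV. A a j * (r a * (r j - r b)))"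
    by (simp add: \<alpha>_def \<beta>_def s_def sum_distrib_left sum_distrib_right right_diff_distrib sum_subtractf mult_ac)
  have eqb: "\<alpha> b * s - \<beta> b = (\<Sum>j\<in>UNIV. A b j * (r b * (r a - r j)))"
    by (simp add: \<alpha>_def \<beta>_def s_def sum_distrib_left sum_distrib_right right_diff_distrib sum_subtractf mult_ac)
  have ga: "\<delta> * (r a * (r k - r b)) \<le> \<beta> a - \<alpha> a * s"
  proof -
    have "\<delta> * (r a * (r k - r b)) \<le> A a k * (r a * (r k - r b))"
      using A(2)[of a k] k ra b[of k] by (intro mult_right_mono) auto
    also have "\<dots> \<le> (\<Sum>j\<in>UNIV. A a j * (r a * (r j - r b)))"
      using A(1) ra b by (intro member_le_sum) auto
    finally show ?thesis by (simp add: eqa)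
  qed
  have gb: "\<delta> * (r b * (r a - r k)) \<le> \<alpha> b * s - \<beta> b"
  proof -
    have "\<delta> * (r b * (r a - r k)) \<le> A b k * (r b * (r a - r k))"
      using A(2)[of b k] k rb a[of k] by (intro mult_right_mono) auto
    also have "\<dots> \<le> (\<Sum>j\<in>UNIV. A b j * (r b * (r a - r j)))"
      using A(1) rb a by (intro member_le_sum) auto
    finally show ?thesis by (simp add: eqb)
  qed
  have "0 \<le> \<delta> * (r a * (r k - r b))" "0 \<le> \<delta> * (r b * (r a - r k))"
    using \<delta> ra rb a[of k] b[of k] by auto
  then have "\<alpha> a * s \<le> \<beta> a" "\<beta> b \<le> \<alpha> b * s" using ga gb by linarith+
  moreover have "(1 - \<eta>) * s \<le> \<alpha> a * s" "\<alpha> b * s \<le> (1 + \<eta>) * s"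
    using \<alpha> s0 by (auto intro!: mult_right_mono)
  ultimately have s1: "(1 - \<eta>) * s \<le> 1 + \<eta>" "1 - \<eta> \<le> (1 + \<eta>) * s" using \<beta>[of a] \<beta>[of b] by linarith+
  have s_le: "s \<le> 1 + 4 * \<eta>"
  proof -
    have "1 + \<eta> \<le> (1 - \<eta>) * (1 + 4 * \<eta>)" using \<eta>1 \<eta> mult_mono[of \<eta> "1/100" \<eta> \<eta>] by (simp add: algebra_simps)
    then have "(1 - \<eta>) * s \<le> (1 - \<eta>) * (1 + 4 * \<eta>)" using s1 by linarith
    then show ?thesis using \<eta>1 by simp
  qed
  have s_ge: "1 - 2 * \<eta> \<le> s"
  proof -
    have "(1 + \<eta>) * (1 - 2 * \<eta>) \<le> 1 - \<eta>" using \<eta> by (simp add: algebra_simps)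
    then have "(1 + \<eta>) * (1 - 2 * \<eta>) \<le> (1 + \<eta>) * s" using s1 by linarith
    then show ?thesis using \<eta> by simp
  qed
  have "\<eta> * s \<le> \<eta> * 2" using s_le \<eta>1 \<eta> by (intro mult_left_mono) auto
  then have "\<beta> a - \<alpha> a * s \<le> 8 * \<eta>" "\<alpha> b * s - \<beta> b \<le> 8 * \<eta>"
    using \<beta>[of a] \<beta>[of b] s_le s_ge \<open>(1 - \<eta>) * s \<le> \<alpha> a * s\<close> \<open>\<alpha> b * s \<le> (1 + \<eta>) * s\<close> \<eta>
    by (auto simp: algebra_simps)
  then have "\<delta> * (r a * (r k - r b)) \<le> \<delta> * \<theta>" "\<delta> * (r b * (r a - r k)) \<le> \<delta> * \<theta>"
    using ga gb \<delta> by (auto simp: \<theta>_def)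
  then have "r a * (r k - r b) \<le> \<theta>" "r b * (r a - r k) \<le> \<theta>"
    using mult_le_cancel_left_pos[OF \<delta>(1)] by blast+
  then have g: "r a * r k \<le> s + \<theta>" "s - \<theta> \<le> r b * r k"
    by (auto simp: s_def algebra_simps)
  have \<theta>0: "0 \<le> \<theta>" using \<eta> \<delta> by (simp add: \<theta>_def)
  have \<theta>1: "\<theta> \<le> 2/25" using \<eta> \<delta> by (simp add: \<theta>_def field_simps)
  have "8 * \<eta> \<le> \<theta>" using \<eta> \<delta> mult_left_mono[of \<delta> 1 \<eta>] by (simp add: \<theta>_def field_simps)
  then have s\<theta>: "s \<le> 1 + \<theta>" "1 - \<theta> \<le> s" using s_le s_ge \<eta> by auto
  have pos: "0 < s - \<theta>" using s\<theta> \<theta>1 by linarith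
  \<comment> \<open>The index \<open>k\<close> couples the extremes: the product of
    \<open>r a\<close>, \<open>r b\<close> and \<open>r k\<close> is bounded below through
    \<open>b\<close> and above through \<open>a\<close>.\<close>
  have key: "r a * (s - \<theta>) \<le> r b * (s + \<theta>)"
  proof -
    have "r a * (s - \<theta>) \<le> r a * (r b * r k)" using g(2) ra by (intro mult_left_mono) auto
    also have "\<dots> = r b * (r a * r k)" by simp
    also have "\<dots> \<le> r b * (s + \<theta>)" using g(1) rb by (intro mult_left_mono) auto
    finally show ?thesis .
  qed
  have up: "r a * r a \<le> 1 + 8 * \<theta>"
  proof -
    have "r a * r a * (s - \<theta>) \<le> s * (s + \<theta>)"
      using mult_left_mono[OF key, of "r a"] ra by (simp add: s_def mult_ac)
    also have "\<dots> \<le> (1 + 8 * \<theta>) * (s - \<theta>)"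
    proof -
      have "s * s \<le> (1 + \<theta>) * s" using s\<theta> s0 by (intro mult_right_mono) auto
      moreover have "\<theta> * (1 - \<theta>) \<le> \<theta> * s" using s\<theta> \<theta>0 by (intro mult_left_mono) auto
      moreover have "\<theta> * \<theta> \<le> \<theta> * (2/25)" using \<theta>0 \<theta>1 by (intro mult_left_mono) auto
      ultimately show ?thesis using \<theta>0 by (simp add: algebra_simps)
    qed
    finally show ?thesis using pos by simp
  qed
  have lo: "1 - 8 * \<theta> \<le> r b * r b"
  proof -
    have "(1 - 8 * \<theta>) * (s + \<theta>) \<le> s * (s - \<theta>)"
    proof -
      have "s - \<theta> * s \<le> s * s" using mult_right_mono[OF s\<theta>(2), of s] s0 by (simp add: algebra_simps)
      moreover have "\<theta> - \<theta> * \<theta> \<le> \<theta> * s" using mult_left_mono[OF s\<theta>(2) \<theta>0] by (simp add: algebra_simps)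
      moreover have "s + \<theta> - 8 * P - 8 * Q \<le> R - P" if "s - P \<le> R" "\<theta> - Q \<le> P" "0 \<le> Q" for P Q R
        using that \<theta>0 by linarith
      ultimately have "s + \<theta> - 8 * (\<theta> * s) - 8 * (\<theta> * \<theta>) \<le> s * s - \<theta> * s" by simp
      then show ?thesis by (simp add: algebra_simps)
    qed
    also have "\<dots> \<le> r b * r b * (s + \<theta>)"
      using mult_left_mono[OF key, of "r b"] rb by (simp add: s_def mult_ac)
    finally show ?thesis using s0 \<theta>0 by simp
  qed
  have "r i * r j \<le> r a * r a" "r b * r b \<le> r i * r j"
    using a b r by (auto intro!: mult_mono intro: less_imp_le)
  then show ?thesis using up lo by (auto simp: abs_le_iff \<theta>_def)
qed

text \<open>The factors \<open>c\<close> are absorbed into \<open>A\<close>. This costs at most half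
  of the lower bound and triples the row error, hence 600 in place of 100.\<close>

lemma perturbed_scaling_rigidity:
  fixes A B c :: "'n::finite \<Rightarrow> 'n \<Rightarrow> real" and r :: "'n \<Rightarrow> real"
  assumes n: "CARD('n) \<ge> 3" and \<delta>: "0 < \<delta>" "\<delta> \<le> 1" and \<eta>: "0 \<le> \<eta>" "600 * \<eta> \<le> \<delta>"
    and A: "\<And>i j. 0 \<le> A i j" "\<And>i j. i \<noteq> j \<Longrightarrow> \<delta> \<le> A i j"
    and r: "\<And>i. 0 < r i"
    and c: "\<And>i j. \<bar>c i j - 1\<bar> \<le> \<eta>"
    and B: "\<And>i j. B i j = A i j * c i j * (r i * r j)"
    and rowA: "\<And>i. \<bar>(\<Sum>j\<in>UNIV. A i j) - 1\<bar> \<le> \<eta>"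
    and rowB: "\<And>i. \<bar>(\<Sum>j\<in>UNIV. B i j) - 1\<bar> \<le> \<eta>"
  shows "\<bar>B i j - A i j\<bar> \<le> 1600 * \<eta> / \<delta>"
proof -
  have \<eta>1: "\<eta> \<le> 1/600" using \<eta> \<delta> by linarith
  have rr: "\<bar>r i * r j - 1\<bar> \<le> 64 * (3 * \<eta>) / (\<delta> / 2)"
  proof (rule scaling_rigidity[OF n, where A="\<lambda>i j. A i j * c i j"])
    have c0: "1/2 \<le> c i j" for i j using c[of i j] \<eta>1 by (auto simp: abs_le_iff)
    have c00: "0 \<le> c i j" for i j using c0[of i j] by linarith
    show "0 \<le> A i j * c i j" for i j using A(1) c00 by simp
    show "\<delta> / 2 \<le> A i j * c i j" if "i \<noteq> j" for i j
      using mult_mono[OF A(2)[OF that] c0[of i j]] \<delta> A(1)[of i j] by simp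
    fix i
    have "\<bar>(\<Sum>j\<in>UNIV. A i j * c i j) - (\<Sum>j\<in>UNIV. A i j)\<bar> = \<bar>\<Sum>j\<in>UNIV. A i j * (c i j - 1)\<bar>"
      by (simp add: sum_subtractf right_diff_distrib)
    also have "\<dots> \<le> (\<Sum>j\<in>UNIV. A i j * \<eta>)"
      using A(1) c by (intro sum_abs[THEN order_trans] sum_mono) (auto simp: abs_mult intro!: mult_left_mono)
    also have "\<dots> = (\<Sum>j\<in>UNIV. A i j) * \<eta>" by (simp add: sum_distrib_right)
    also have "\<dots> \<le> 2 * \<eta>" using rowA[of i] \<eta> \<eta>1 by (intro mult_right_mono) auto
    finally show "\<bar>(\<Sum>j\<in>UNIV. A i j * c i j) - 1\<bar> \<le> 3 * \<eta>" using rowA[of i] by linarith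
    show "\<bar>(\<Sum>j\<in>UNIV. A i j * c i j * (r i * r j)) - 1\<bar> \<le> 3 * \<eta>"
      using rowB[of i] \<eta> by (simp only: B)
  qed (use \<delta> \<eta> r in auto)
  have A2: "A i j \<le> 2"
    using member_le_sum[of j UNIV "A i"] A(1) rowA[of i] \<eta>1 by auto
  have "c i j * (r i * r j) - 1 = c i j * (r i * r j - 1) + (c i j - 1)" by (simp add: algebra_simps)
  then have "\<bar>c i j * (r i * r j) - 1\<bar> \<le> \<bar>c i j\<bar> * \<bar>r i * r j - 1\<bar> + \<bar>c i j - 1\<bar>"
    by (metis abs_mult abs_triangle_ineq)
  \<comment> \<open>Here 64 * 3 * 2 = 384 and 2 * 384 + 1 = 769. The entries of \<open>A\<close> are
    at most 2, and the resulting 1538 is rounded up to 1600.\<close>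
  also have "\<dots> \<le> 2 * (64 * (3 * \<eta>) / (\<delta> / 2)) + \<eta> / \<delta>"
  proof (intro add_mono mult_mono rr)
    show "\<bar>c i j\<bar> \<le> 2" using c[of i j] \<eta>1 by linarith
    have "\<eta> \<le> \<eta> / \<delta>" using \<delta> \<eta> mult_left_mono[of \<delta> 1 \<eta>] by (simp add: field_simps)
    then show "\<bar>c i j - 1\<bar> \<le> \<eta> / \<delta>" using c[of i j] by linarith
  qed auto
  also have "\<dots> = 769 * \<eta> / \<delta>" by simp
  finally have cr: "\<bar>c i j * (r i * r j) - 1\<bar> \<le> 769 * \<eta> / \<delta>" .
  have "B i j - A i j = A i j * (c i j * (r i * r j) - 1)" by (simp add: B algebra_simps)
  then have "\<bar>B i j - A i j\<bar> = A i j * \<bar>c i j * (r i * r j) - 1\<bar>" using A(1) by (simp add: abs_mult)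
  also have "\<dots> \<le> 2 * (769 * \<eta> / \<delta>)" using A(1) A2 cr by (intro mult_mono) auto
  also have "\<dots> \<le> 1600 * \<eta> / \<delta>" using \<delta> \<eta> by (simp add: divide_right_mono)
  finally show ?thesis .
qed

section \<open>Normalized weight matrices\<close>

lemma mean_weight_pos: "n \<ge> 2 \<Longrightarrow> 0 < mean_weight n t"
  by (simp add: mean_weight_def)

lemma mean_weight_Suc: "mean_weight n (Suc t) = mean_weight n t + 2"
  by (simp add: mean_weight_def)

lemma mean_weight_le: "n \<ge> 2 \<Longrightarrow> mean_weight n t \<le> real n * (real t + 1)"
  using mult_right_mono[of 2 "real n" "real t"] by (simp add: mean_weight_def algebra_simps)

lemma mean_weight_ge: "n \<ge> 2 \<Longrightarrow> real t + 1 \<le> mean_weight n t"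
  by (simp add: mean_weight_def)

lemma weight_eq_pair_ratio: "weight v t i j = pair_ratio v t i j * (growth v t i * growth v t j)"
  using growth_pos[of v t i] growth_pos[of v t j] by (simp add: pair_ratio_def)

text \<open>Writing weights as \<open>pair_ratio\<close> times growth factors exhibits the second
  normalized matrix as a diagonal scaling of the first, perturbed by the change of the ratios. Two
  trajectories are allowed so that a random one can be compared with a prescribed one.\<close>

lemma normalized_weight_close:
  fixes v v' :: "nat \<Rightarrow> 'n \<Rightarrow> 'n::finite"
  assumes n: "CARD('n) \<ge> 3" and \<delta>: "0 < \<delta>" "\<delta> \<le> 1" and \<eta>: "0 \<le> \<eta>" "600 * \<eta> \<le> \<delta>"
    and diag: "\<And>i. weight v t i i = 0" "\<And>i. weight v' t' i i = 0"
    and lower: "\<And>i j. i \<noteq> j \<Longrightarrow> \<delta> * mean_weight CARD('n) t \<le> weight v t i j"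
    and ratio: "\<And>i j. i \<noteq> j \<Longrightarrow> \<bar>pair_ratio v' t' i j / pair_ratio v t i j - 1\<bar> \<le> \<eta>"
    and row: "\<And>i. \<bar>row_weight v t i / mean_weight CARD('n) t - 1\<bar> \<le> \<eta>"
    and row': "\<And>i. \<bar>row_weight v' t' i / mean_weight CARD('n) t' - 1\<bar> \<le> \<eta>"
  shows "\<bar>weight v' t' i j / mean_weight CARD('n) t' - weight v t i j / mean_weight CARD('n) t\<bar> \<le> 1600 * \<eta> / \<delta>"
proof -
  let ?m = "mean_weight CARD('n) t" and ?m' = "mean_weight CARD('n) t'"
  have m: "?m > 0" "?m' > 0" using n by (auto intro!: mean_weight_pos)
  \<comment> \<open>The square root splits the change of normalization evenly between the two
    scaling factors of an entry.\<close>
  define \<rho> where "\<rho> = sqrt (?m / ?m')"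
  have \<rho>: "\<rho> > 0" "\<rho> * \<rho> = ?m / ?m'" using m by (simp_all add: \<rho>_def)
  define r where "r i = growth v' t' i / growth v t i * \<rho>" for i
  define c where "c i j = (if i = j then 1 else pair_ratio v' t' i j / pair_ratio v t i j)" for i j
  show ?thesis
  proof (rule perturbed_scaling_rigidity[OF n \<delta> \<eta>, where r=r and c=c
        and A="\<lambda>i j. weight v t i j / ?m" and B="\<lambda>i j. weight v' t' i j / ?m'"])
    show "0 \<le> weight v t i j / ?m" for i j using m by (simp add: weight_nonneg)
    show "\<delta> \<le> weight v t i j / ?m" if "i \<noteq> j" for i j using lower[OF that] m by (simp add: field_simps)
    show "0 < r i" for i using \<rho> by (simp add: r_def growth_pos)
    show "\<bar>c i j - 1\<bar> \<le> \<eta>" for i j using ratio[of i j] \<eta> by (simp add: c_def)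
    show "weight v' t' i j / ?m' = weight v t i j / ?m * c i j * (r i * r j)" for i j
    proof (cases "i = j")
      case True then show ?thesis by (simp add: diag)
    next
      case False
      have rr: "r i * r j = (growth v' t' i * growth v' t' j) / (growth v t i * growth v t j) * (?m / ?m')"
        unfolding \<rho>(2)[symmetric] by (simp add: r_def)
      have "weight v t i j / ?m * c i j * (r i * r j)
        = (weight v t i j / (growth v t i * growth v t j)) / pair_ratio v t i j * (pair_ratio v' t' i j * (growth v' t' i * growth v' t' j)) / ?m'"
        unfolding rr c_def using m False by simp
      also have "\<dots> = weight v' t' i j / ?m'"
        using pair_ratio_pos[OF False, of v t] by (simp add: weight_eq_pair_ratio[symmetric] pair_ratio_def[of v t, symmetric])
      finally show ?thesis by simp
    qed
    show "\<bar>(\<Sum>j\<in>UNIV. weight v t i j / ?m) - 1\<bar> \<le> \<eta>" for i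
      using row[of i] by (simp add: row_weight_def sum_divide_distrib)
    show "\<bar>(\<Sum>j\<in>UNIV. weight v' t' i j / ?m') - 1\<bar> \<le> \<eta>" for i
      using row'[of i] by (simp add: row_weight_def sum_divide_distrib)
  qed
qed

text \<open>The cubes have absolutely summable increments, so they converge.\<close>

lemma slow_square_summable_tendsto_0:
  fixes x :: "nat \<Rightarrow> real"
  assumes slow: "\<And>s. \<bar>x (Suc s) - x s\<bar> \<le> C / (real s + 1)"
    and summ: "summable (\<lambda>s. (x s)\<^sup>2 / (real s + 1))"
  shows "x \<longlonglongrightarrow> 0"
proof -
  have C: "0 \<le> C" using order_trans[OF abs_ge_zero slow[of 0]] by simp
  have cube: "\<bar>x (Suc s) ^ 3 - x s ^ 3\<bar> \<le> 3 * C * (2 * ((x (Suc s))\<^sup>2 / (real (Suc s) + 1)) + (x s)\<^sup>2 / (real s + 1))" for s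
  proof -
    define a b where "a = x (Suc s)" and "b = x s"
    have q0: "0 \<le> a\<^sup>2 + a * b + b\<^sup>2"
    proof -
      have "a\<^sup>2 + a * b + b\<^sup>2 = ((a + b)\<^sup>2 + a\<^sup>2 + b\<^sup>2) / 2" by (simp add: power2_eq_square algebra_simps)
      moreover have "0 \<le> ((a + b)\<^sup>2 + a\<^sup>2 + b\<^sup>2) / 2" by simp
      ultimately show ?thesis by (simp only:)
    qed
    have q: "a\<^sup>2 + a * b + b\<^sup>2 \<le> 3 * (a\<^sup>2 + b\<^sup>2)"
    proof -
      have "3 * (a\<^sup>2 + b\<^sup>2) - (a\<^sup>2 + a * b + b\<^sup>2) = ((a - b)\<^sup>2 + 3 * a\<^sup>2 + 3 * b\<^sup>2) / 2"
        by (simp add: power2_eq_square algebra_simps)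
      moreover have "0 \<le> ((a - b)\<^sup>2 + 3 * a\<^sup>2 + 3 * b\<^sup>2) / 2" by simp
      ultimately show ?thesis by linarith
    qed
    have "a ^ 3 - b ^ 3 = (a - b) * (a\<^sup>2 + a * b + b\<^sup>2)" by (simp add: algebra_simps power3_eq_cube power2_eq_square)
    then have "\<bar>a ^ 3 - b ^ 3\<bar> = \<bar>a - b\<bar> * (a\<^sup>2 + a * b + b\<^sup>2)" using q0 by (simp add: abs_mult)
    also have "\<dots> \<le> C / (real s + 1) * (3 * (a\<^sup>2 + b\<^sup>2))"
      using slow[of s] q q0 by (intro mult_mono) (auto simp: a_def b_def C)
    also have "\<dots> = 3 * C * (a\<^sup>2 / (real s + 1) + b\<^sup>2 / (real s + 1))"
      by (simp add: add_divide_distrib[symmetric])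
    \<comment> \<open>The factor 2 pays for the shift of the denominator from \<open>s + 1\<close>
      to \<open>s + 2\<close>.\<close>
    also have "\<dots> \<le> 3 * C * (2 * (a\<^sup>2 / (real (Suc s) + 1)) + b\<^sup>2 / (real s + 1))"
    proof (intro mult_left_mono add_mono)
      have "1 / (real s + 1) \<le> 2 / (real (Suc s) + 1)" by (simp add: field_simps)
      from mult_left_mono[OF this zero_le_power2[of a]] show "a\<^sup>2 / (real s + 1) \<le> 2 * (a\<^sup>2 / (real (Suc s) + 1))" by (simp add: mult.commute)
    qed (use C in auto)
    finally show ?thesis by (simp add: a_def b_def)
  qed
  have "summable (\<lambda>s. 3 * C * (2 * ((x (Suc s))\<^sup>2 / (real (Suc s) + 1)) + (x s)\<^sup>2 / (real s + 1)))"
    by (intro summable_mult summable_add summ summable_Suc_iff[THEN iffD2, OF summ])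
  then have "summable (\<lambda>s. x (Suc s) ^ 3 - x s ^ 3)"
    by (rule summable_comparison_test') (use cube in auto)
  then have "convergent (\<lambda>s. \<Sum>k<s. x (Suc k) ^ 3 - x k ^ 3)" by (simp add: summable_iff_convergent)
  then have "convergent (\<lambda>s. x s ^ 3 - x 0 ^ 3)" by (simp add: sum_lessThan_telescope[of "\<lambda>s. x s ^ 3"])
  then obtain l where l: "(\<lambda>s. x s ^ 3) \<longlonglongrightarrow> l"
    using convergent_add[OF _ convergent_const[of "x 0 ^ 3"]] by (fastforce simp: convergent_def)
  have "(\<lambda>s. root 3 (x s ^ 3)) \<longlonglongrightarrow> root 3 l" by (rule tendsto_real_root[OF l])
  then have lim: "x \<longlonglongrightarrow> root 3 l" by (simp add: odd_real_root_power_cancel)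
  \<comment> \<open>With a nonzero limit the given summable series would dominate a multiple of the
    harmonic series.\<close>
  have "root 3 l = 0"
  proof (rule ccontr)
    assume ne: "root 3 l \<noteq> 0"
    define d where "d = (root 3 l)\<^sup>2 / 2"
    have d: "d > 0" using ne by (simp add: d_def)
    have "(\<lambda>s. (x s)\<^sup>2) \<longlonglongrightarrow> (root 3 l)\<^sup>2" by (intro tendsto_intros lim)
    moreover have "d < (root 3 l)\<^sup>2" using ne by (simp add: d_def)
    ultimately have "eventually (\<lambda>s. d < (x s)\<^sup>2) sequentially" by (rule order_tendstoD(1))
    then have ev: "eventually (\<lambda>s. norm (inverse (real (Suc s))) \<le> (x s)\<^sup>2 / (real s + 1) / d) sequentially"
    proof eventually_elim
      case (elim s)
      have "1 / (real s + 1) \<le> ((x s)\<^sup>2 / d) / (real s + 1)" using elim d by (intro divide_right_mono) auto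
      then show ?case by (simp add: inverse_eq_divide add.commute mult.commute)
    qed
    have "summable (\<lambda>s. inverse (real (Suc s)))"
      by (rule summable_comparison_test_ev[OF ev summable_divide[OF summ]])
    then show False using not_summable_harmonic[where 'a=real] summable_Suc_iff[of "\<lambda>n. inverse (real n)"] by simp
  qed
  then show ?thesis using lim by simp
qed

text \<open>Summing over ordered pairs counts each value \<open>2 * (card S - 1)\<close> times. The
  values will be logarithmic growth factors, for which only bounds on pairs are available.\<close>

lemma sum_le_if_pairs_le:
  fixes h :: "'b \<Rightarrow> real"
  assumes "finite S" "card S \<ge> 2" "\<And>j k. j \<in> S \<Longrightarrow> k \<in> S \<Longrightarrow> j \<noteq> k \<Longrightarrow> h j + h k \<le> K"
  shows "(\<Sum>j\<in>S. h j) \<le> real (card S) * K / 2"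
proof -
  have "(\<Sum>j\<in>S. \<Sum>k\<in>S - {j}. h j + h k) = (\<Sum>j\<in>S. (real (card S) - 2) * h j + sum h S)"
  proof (rule sum.cong[OF refl])
    fix j assume j: "j \<in> S"
    have "(\<Sum>k\<in>S - {j}. h j + h k) = real (card S - 1) * h j + (sum h S - h j)"
      using assms(1) j by (simp add: sum.distrib sum_diff1 card_Diff_singleton)
    then show "(\<Sum>k\<in>S - {j}. h j + h k) = (real (card S) - 2) * h j + sum h S"
      using assms(2) by (simp add: of_nat_diff algebra_simps)
  qed
  also have "\<dots> = (2 * (real (card S) - 1)) * sum h S"
    by (simp add: sum.distrib sum_distrib_left[symmetric]) (simp add: algebra_simps)
  finally have "(2 * (real (card S) - 1)) * sum h S = (\<Sum>j\<in>S. \<Sum>k\<in>S - {j}. h j + h k)" by simp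
  also have "\<dots> \<le> (\<Sum>j\<in>S. \<Sum>k\<in>S - {j}. K)"
    using assms(3) by (intro sum_mono) auto
  also have "\<dots> = real (card S) * (real (card S - 1) * K)"
    using assms(1) by (simp add: card_Diff_singleton)
  also have "\<dots> = (2 * (real (card S) - 1)) * (real (card S) * K / 2)"
    using assms(2) by (simp add: of_nat_diff)
  finally show ?thesis using assms(2) by (simp add: mult_le_cancel_left)
qed

section \<open>Pathwise convergence\<close>

text \<open>\<open>mean_weight\<close> increases by 2 per round, so half the increment of its
  logarithm is at most its reciprocal.\<close>

lemma sum_inverse_mean_weight_ge:
  assumes "n \<ge> 2"
  shows "(ln (mean_weight n t) - ln (mean_weight n 0)) / 2 \<le> (\<Sum>s<t. 1 / mean_weight n s)"
proof (induction t)
  case (Suc t)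
  have m: "mean_weight n t > 0" using assms by (rule mean_weight_pos)
  have "ln (mean_weight n (Suc t)) = ln (mean_weight n t * (1 + 2 / mean_weight n t))"
    using m by (simp add: mean_weight_Suc distrib_left)
  also have "\<dots> = ln (mean_weight n t) + ln (1 + 2 / mean_weight n t)"
    using m by (intro ln_mult_pos) (auto intro: add_pos_pos)
  also have "\<dots> \<le> ln (mean_weight n t) + 2 / mean_weight n t"
    using m by (intro add_left_mono ln_add_one_self_le_self) auto
  finally show ?case using Suc by simp
qed simp

lemma tendsto_pos_bounds:
  fixes f :: "nat \<Rightarrow> real"
  assumes "f \<longlonglongrightarrow> c" "c > 0" "\<And>t. f t > 0"
  shows "\<exists>K. \<forall>t. \<bar>ln (f t)\<bar> \<le> K"
proof -
  have "(\<lambda>t. ln (f t)) \<longlonglongrightarrow> ln c" using assms by (intro tendsto_ln) auto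
  then have "Bseq (\<lambda>t. ln (f t))" by (intro convergent_imp_Bseq convergentI)
  then show ?thesis by (auto simp: Bseq_def)
qed

text \<open>Collects what holds almost surely; from here on convergence is a deterministic statement
  about a single trajectory.\<close>

locale limiting_ratios =
  fixes v :: "nat \<Rightarrow> 'n \<Rightarrow> 'n::finite"
  assumes n: "CARD('n) \<ge> 3"
    and visits_other: "\<And>s i. v s i \<noteq> i"
    and ratios: "\<And>i j. i \<noteq> j \<Longrightarrow> \<exists>c>0. (\<lambda>t. pair_ratio v t i j) \<longlonglongrightarrow> c"
begin

abbreviation W where "W \<equiv> row_weight v"
abbreviation L where "L t i \<equiv> ln (growth v t i)"

lemma m_pos: "mean_weight CARD('n) t > 0"
  using n by (intro mean_weight_pos) auto

lemma W_pos: "W t i > 0"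
  using n by (intro row_weight_pos) auto

lemma ratio_bounds: "\<exists>K\<ge>0. \<forall>t i j. i \<noteq> j \<longrightarrow> \<bar>ln (pair_ratio v t i j)\<bar> \<le> K"
proof -
  have "\<exists>K. \<forall>t. i \<noteq> j \<longrightarrow> \<bar>ln (pair_ratio v t i j)\<bar> \<le> K" for i j
    using tendsto_pos_bounds[of "\<lambda>t. pair_ratio v t i j"] ratios[of i j] pair_ratio_pos[of i j v] by (cases "i = j") auto
  then obtain K where K: "\<And>i j t. i \<noteq> j \<Longrightarrow> \<bar>ln (pair_ratio v t i j)\<bar> \<le> K i j" by metis
  have "K i j \<le> (\<Sum>i\<in>UNIV. \<Sum>j\<in>UNIV. \<bar>K i j\<bar>)" for i j
  proof -
    have "K i j \<le> (\<Sum>j\<in>UNIV. \<bar>K i j\<bar>)" using member_le_sum[of j UNIV "\<lambda>j. \<bar>K i j\<bar>"] by auto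
    also have "\<dots> \<le> (\<Sum>i\<in>UNIV. \<Sum>j\<in>UNIV. \<bar>K i j\<bar>)"
      by (rule member_le_sum[of i UNIV "\<lambda>i. \<Sum>j\<in>UNIV. \<bar>K i j\<bar>"]) (auto intro: sum_nonneg)
    finally show ?thesis .
  qed
  then have "\<bar>ln (pair_ratio v t i j)\<bar> \<le> (\<Sum>i\<in>UNIV. \<Sum>j\<in>UNIV. \<bar>K i j\<bar>)" if "i \<noteq> j" for t i j
    using K[OF that] order_trans by blast
  then show ?thesis by (intro exI[of _ "\<Sum>i\<in>UNIV. \<Sum>j\<in>UNIV. \<bar>K i j\<bar>"]) (auto intro!: sum_nonneg)
qed

lemma ln_weight: "i \<noteq> j \<Longrightarrow> ln (weight v t i j) = ln (pair_ratio v t i j) + (L t i + L t j)"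
  using pair_ratio_pos[of i j v t] growth_pos[of v t i] growth_pos[of v t j]
  by (subst weight_eq_pair_ratio) (simp add: ln_mult_pos)

text \<open>Weights are at most \<open>CARD('n)\<close> times the mean weight, and bounded pair
  ratios transfer this to products of two growth factors.\<close>

lemma pair_growth_le: "\<exists>K\<ge>0. \<forall>t i j. i \<noteq> j \<longrightarrow> L t i + L t j \<le> ln (mean_weight CARD('n) t) + K"
proof -
  obtain K where K: "K \<ge> 0" "\<And>t i j. i \<noteq> j \<Longrightarrow> \<bar>ln (pair_ratio v t i j)\<bar> \<le> K" using ratio_bounds by auto
  have "L t i + L t j \<le> ln (mean_weight CARD('n) t) + (K + ln (real CARD('n)))" if "i \<noteq> j" for t i j
  proof -
    have "weight v t i j \<le> real CARD('n) * mean_weight CARD('n) t"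
      using weight_le_row_weight[of v t i j] row_weight_le[of v t i] by linarith
    then have "ln (weight v t i j) \<le> ln (real CARD('n) * mean_weight CARD('n) t)"
      using weight_ge_1[OF that, of v t] by (intro ln_mono) auto
    also have "\<dots> = ln (real CARD('n)) + ln (mean_weight CARD('n) t)" using m_pos n by (intro ln_mult_pos) auto
    finally show ?thesis using K(2)[OF that, of t] ln_weight[OF that, of t] by linarith
  qed
  moreover have "K + ln (real CARD('n)) \<ge> 0" using K n by simp
  ultimately show ?thesis by blast
qed

text \<open>Jensen's inequality for the reciprocal with its exact deficit, which measures the
  dispersion of the row weights.\<close>

lemma inverse_row_weight: "(\<Sum>i\<in>UNIV. 1 / W t i) = real CARD('n) / mean_weight CARD('n) t + (\<Sum>i\<in>UNIV. (mean_weight CARD('n) t - W t i)\<^sup>2 / (W t i * (mean_weight CARD('n) t)\<^sup>2))"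
proof -
  \<comment> \<open>Exact second-order expansion around the mean; the linear terms cancel in the sum
    because the row weights average to the mean weight.\<close>
  have "(\<Sum>i\<in>UNIV. 1 / W t i) = (\<Sum>i\<in>UNIV. 1 / mean_weight CARD('n) t + ((mean_weight CARD('n) t - W t i) / (mean_weight CARD('n) t)\<^sup>2 + (mean_weight CARD('n) t - W t i)\<^sup>2 / (W t i * (mean_weight CARD('n) t)\<^sup>2)))"
    using W_pos[of t] m_pos[of t]
    by (intro sum.cong refl) (simp add: divide_simps power2_eq_square less_imp_neq[THEN not_sym], simp add: algebra_simps)
  also have "\<dots> = real CARD('n) / mean_weight CARD('n) t + (\<Sum>i\<in>UNIV. mean_weight CARD('n) t - W t i) / (mean_weight CARD('n) t)\<^sup>2 + (\<Sum>i\<in>UNIV. (mean_weight CARD('n) t - W t i)\<^sup>2 / (W t i * (mean_weight CARD('n) t)\<^sup>2))"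
    by (simp add: sum.distrib sum_divide_distrib)
  also have "(\<Sum>i\<in>UNIV. mean_weight CARD('n) t - W t i) = 0" by (simp add: sum_subtractf sum_row_weight)
  finally show ?thesis by simp
qed

text \<open>For \<open>x\<close> between 0 and 1, \<open>ln (1 + x) \<ge> x - x\<^sup>2\<close>, and
  the squares are summable because the row weight at time \<open>s\<close> is at least
  \<open>s + 1\<close>.\<close>

lemma sum_growth_ge: "\<exists>K\<ge>0. \<forall>t. (\<Sum>s<t. \<Sum>i\<in>UNIV. 1 / W s i) \<le> (\<Sum>i\<in>UNIV. L t i) + K"
proof -
  have summ: "summable (\<lambda>s. real CARD('n) * inverse ((real (Suc s))\<^sup>2))"
    using inverse_power_summable[of 2, where 'a=real]
    by (intro summable_mult summable_Suc_iff[THEN iffD2]) (simp add: power_inverse)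
  define K where "K = (\<Sum>s. real CARD('n) * inverse ((real (Suc s))\<^sup>2))"
  have K0: "K \<ge> 0" unfolding K_def by (intro suminf_nonneg summ) auto
  have step: "1 / W s i - inverse ((real (Suc s))\<^sup>2) \<le> ln (1 + 1 / W s i)" for s i
  proof -
    have W: "W s i \<ge> real (Suc s)" using row_weight_ge[where v=v and t=s and i=i] n by simp
    then have a: "0 \<le> 1 / W s i" "1 / W s i \<le> 1" "1 / W s i \<le> 1 / real (Suc s)"
      using W_pos[of s i] by (auto simp: field_simps)
    have "(1 / W s i)\<^sup>2 \<le> (1 / real (Suc s))\<^sup>2" using a by (intro power_mono) auto
    then have "(1 / W s i)\<^sup>2 \<le> inverse ((real (Suc s))\<^sup>2)" by (simp add: power_divide inverse_eq_divide)
    then show ?thesis using ln_one_plus_pos_lower_bound[OF a(1,2)] by linarith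
  qed
  have L: "L t i = (\<Sum>s<t. ln (1 + 1 / W s i))" for t i
    unfolding growth_def using W_pos by (intro ln_prod) (auto simp: add_pos_pos less_imp_neq[THEN not_sym])
  have "(\<Sum>s<t. \<Sum>i\<in>UNIV. 1 / W s i) \<le> (\<Sum>i\<in>UNIV. L t i) + K" for t
  proof -
    have "(\<Sum>s<t. \<Sum>i\<in>UNIV. 1 / W s i) - (\<Sum>s<t. real CARD('n) * inverse ((real (Suc s))\<^sup>2))
       = (\<Sum>s<t. \<Sum>i\<in>UNIV. 1 / W s i - inverse ((real (Suc s))\<^sup>2))"
      by (simp add: sum_subtractf)
    also have "\<dots> \<le> (\<Sum>s<t. \<Sum>i\<in>UNIV. ln (1 + 1 / W s i))" by (intro sum_mono step)
    also have "\<dots> = (\<Sum>i\<in>UNIV. L t i)" unfolding L by (rule sum.swap)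
    finally have 1: "(\<Sum>s<t. \<Sum>i\<in>UNIV. 1 / W s i) \<le> (\<Sum>i\<in>UNIV. L t i) + (\<Sum>s<t. real CARD('n) * inverse ((real (Suc s))\<^sup>2))" by simp
    have "(\<Sum>s<t. real CARD('n) * inverse ((real (Suc s))\<^sup>2)) \<le> K" unfolding K_def by (intro sum_le_suminf summ) auto
    then show ?thesis using 1 by linarith
  qed
  then show ?thesis using K0 by blast
qed

lemma N_over_m_ge: "real CARD('n) / 2 * (ln (mean_weight CARD('n) t) - ln (mean_weight CARD('n) 0)) \<le> (\<Sum>s<t. real CARD('n) / mean_weight CARD('n) s)"
proof -
  have "real CARD('n) * ((ln (mean_weight CARD('n) t) - ln (mean_weight CARD('n) 0)) / 2) \<le> real CARD('n) * (\<Sum>s<t. 1 / mean_weight CARD('n) s)"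
    using n by (intro mult_left_mono sum_inverse_mean_weight_ge) auto
  then show ?thesis by (simp add: sum_distrib_left)
qed

text \<open>The upper bound on the total logarithmic growth from pairs and the lower bound from
  Jensen share the leading term \<open>CARD('n) / 2 * ln (mean_weight CARD('n) t)\<close>, so the
  accumulated deficit stays bounded.\<close>

lemma dispersion_summable: "summable (\<lambda>s. \<Sum>i\<in>UNIV. (mean_weight CARD('n) s - W s i)\<^sup>2 / (W s i * (mean_weight CARD('n) s)\<^sup>2))"
proof -
  obtain K1 where K1: "\<And>t i j. i \<noteq> j \<Longrightarrow> L t i + L t j \<le> ln (mean_weight CARD('n) t) + K1" using pair_growth_le by blast
  obtain K2 where K2: "\<And>t. (\<Sum>s<t. \<Sum>i\<in>UNIV. 1 / W s i) \<le> (\<Sum>i\<in>UNIV. L t i) + K2" using sum_growth_ge by blast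
  have "(\<Sum>s<t. \<Sum>i\<in>UNIV. (mean_weight CARD('n) s - W s i)\<^sup>2 / (W s i * (mean_weight CARD('n) s)\<^sup>2)) \<le> real CARD('n) * K1 / 2 + K2 + real CARD('n) / 2 * ln (mean_weight CARD('n) 0)" for t
  proof -
    have "(\<Sum>i\<in>UNIV. L t i) \<le> real (card (UNIV::'n set)) * (ln (mean_weight CARD('n) t) + K1) / 2"
      using n K1 by (intro sum_le_if_pairs_le) auto
    moreover have "(\<Sum>s<t. \<Sum>i\<in>UNIV. (mean_weight CARD('n) s - W s i)\<^sup>2 / (W s i * (mean_weight CARD('n) s)\<^sup>2))
        = (\<Sum>s<t. \<Sum>i\<in>UNIV. 1 / W s i) - (\<Sum>s<t. real CARD('n) / mean_weight CARD('n) s)"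
      by (simp add: inverse_row_weight sum.distrib)
    ultimately show ?thesis using K2[of t] N_over_m_ge[of t] by (simp add: algebra_simps)
  qed
  then show ?thesis
    using W_pos by (intro summableI_nonneg_bounded) (auto intro!: sum_nonneg divide_nonneg_nonneg mult_nonneg_nonneg intro: less_imp_le)
qed

text \<open>The relative deviation moves by order \<open>1 / s\<close> per round, and its square
  divided by \<open>s + 1\<close> is dominated by the summable dispersion.\<close>

lemma row_weight_limit: "(\<lambda>t. W t i / mean_weight CARD('n) t) \<longlonglongrightarrow> 1"
proof -
  let ?e = "\<lambda>t. W t i / mean_weight CARD('n) t - 1"
  have "?e \<longlonglongrightarrow> 0"
  proof (rule slow_square_summable_tendsto_0)
    fix s
    have m': "mean_weight CARD('n) (Suc s) = mean_weight CARD('n) s + 2" by (rule mean_weight_Suc)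
    have mp: "mean_weight CARD('n) s > 0" "mean_weight CARD('n) (Suc s) > 0" by (rule m_pos)+
    have "?e (Suc s) - ?e s = ((W (Suc s) i - W s i) - 2 * (W s i / mean_weight CARD('n) s)) / mean_weight CARD('n) (Suc s)"
      using mp by (simp add: m' field_simps)
    \<comment> \<open>One round adds at most \<open>1 + CARD('n)\<close> to a row, and twice its
      quotient by the mean is at most \<open>2 * CARD('n)\<close>.\<close>
    moreover have "\<bar>(W (Suc s) i - W s i) - 2 * (W s i / mean_weight CARD('n) s)\<bar> \<le> 3 * real CARD('n) + 1"
    proof -
      have "0 \<le> W (Suc s) i - W s i" "W (Suc s) i - W s i \<le> 1 + real CARD('n)"
        using row_weight_Suc_le[where v=v and t=s and i=i] by (auto simp: row_weight_Suc)
      moreover have "0 \<le> W s i / mean_weight CARD('n) s" "W s i / mean_weight CARD('n) s \<le> real CARD('n)"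
        using mp W_pos[of s i] row_weight_le[where v=v and t=s and i=i] by (auto simp: field_simps)
      ultimately show ?thesis by linarith
    qed
    ultimately have "\<bar>?e (Suc s) - ?e s\<bar> \<le> (3 * real CARD('n) + 1) / mean_weight CARD('n) (Suc s)"
      using mp by (simp add: divide_right_mono)
    also have "\<dots> \<le> (3 * real CARD('n) + 1) / (real s + 1)"
      using mean_weight_ge[of "CARD('n)" s] n mp by (intro divide_left_mono mult_pos_pos) (auto simp: m')
    finally show "\<bar>?e (Suc s) - ?e s\<bar> \<le> (3 * real CARD('n) + 1) / (real s + 1)" .
  next
    have "summable (\<lambda>s. (real CARD('n))\<^sup>2 * (\<Sum>i\<in>UNIV. (mean_weight CARD('n) s - W s i)\<^sup>2 / (W s i * (mean_weight CARD('n) s)\<^sup>2)))"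
      by (intro summable_mult dispersion_summable)
    then show "summable (\<lambda>s. (?e s)\<^sup>2 / (real s + 1))"
    proof (rule summable_comparison_test')
      fix s :: nat
      have mp: "mean_weight CARD('n) s > 0" by (rule m_pos)
      have "W s i \<le> (real CARD('n))\<^sup>2 * (real s + 1)"
      proof -
        have "W s i \<le> real CARD('n) * mean_weight CARD('n) s" by (rule row_weight_le)
        also have "\<dots> \<le> real CARD('n) * (real CARD('n) * (real s + 1))" using n by (intro mult_left_mono mean_weight_le) auto
        finally show ?thesis by (simp add: power2_eq_square mult_ac)
      qed
      then have "1 / (real s + 1) \<le> (real CARD('n))\<^sup>2 / W s i" using W_pos[of s i] by (simp add: field_simps)
      then have "(?e s)\<^sup>2 * (1 / (real s + 1)) \<le> (?e s)\<^sup>2 * ((real CARD('n))\<^sup>2 / W s i)" by (intro mult_left_mono) auto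
      also have sq: "(?e s)\<^sup>2 = (mean_weight CARD('n) s - W s i)\<^sup>2 / (mean_weight CARD('n) s)\<^sup>2"
        using mp by (simp add: power_divide[symmetric] diff_divide_distrib power2_commute)
      also have "(mean_weight CARD('n) s - W s i)\<^sup>2 / (mean_weight CARD('n) s)\<^sup>2 * ((real CARD('n))\<^sup>2 / W s i) = (real CARD('n))\<^sup>2 * ((mean_weight CARD('n) s - W s i)\<^sup>2 / (W s i * (mean_weight CARD('n) s)\<^sup>2))"
        by (simp add: mult_ac)
      also have "\<dots> \<le> (real CARD('n))\<^sup>2 * (\<Sum>i\<in>UNIV. (mean_weight CARD('n) s - W s i)\<^sup>2 / (W s i * (mean_weight CARD('n) s)\<^sup>2))"
        using W_pos by (intro mult_left_mono member_le_sum[of i UNIV "\<lambda>i. (mean_weight CARD('n) s - W s i)\<^sup>2 / (W s i * (mean_weight CARD('n) s)\<^sup>2)"])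
          (auto intro!: divide_nonneg_nonneg mult_nonneg_nonneg intro: less_imp_le)
      finally show "norm ((?e s)\<^sup>2 / (real s + 1)) \<le> (real CARD('n))\<^sup>2 * (\<Sum>i\<in>UNIV. (mean_weight CARD('n) s - W s i)\<^sup>2 / (W s i * (mean_weight CARD('n) s)\<^sup>2))"
        by (simp add: sq)
    qed
  qed
  then show ?thesis by (simp add: LIM_zero_iff)
qed

text \<open>Up to constants, the total logarithmic growth is at least \<open>CARD('n) / 2\<close>
  times the logarithm of the mean, and the other \<open>CARD('n) - 1\<close> agents account for at
  most half of it each on average. So every agent keeps one half of that logarithm, and every pair
  all of it.\<close>

lemma weight_lower_bound: "\<exists>\<delta>>0. \<delta> \<le> 1 \<and> (\<forall>t i j. i \<noteq> j \<longrightarrow> \<delta> * mean_weight CARD('n) t \<le> weight v t i j)"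
proof -
  obtain K0 where K0: "K0 \<ge> 0" "\<And>t i j. i \<noteq> j \<Longrightarrow> \<bar>ln (pair_ratio v t i j)\<bar> \<le> K0" using ratio_bounds by blast
  obtain K1 where K1: "K1 \<ge> 0" "\<And>t i j. i \<noteq> j \<Longrightarrow> L t i + L t j \<le> ln (mean_weight CARD('n) t) + K1" using pair_growth_le by blast
  obtain K2 where K2: "K2 \<ge> 0" "\<And>t. (\<Sum>s<t. \<Sum>i\<in>UNIV. 1 / W s i) \<le> (\<Sum>i\<in>UNIV. L t i) + K2" using sum_growth_ge by blast
  define K3 where "K3 = K2 + real CARD('n) / 2 * ln (mean_weight CARD('n) 0) + real CARD('n) * K1 / 2"
  have m0: "0 \<le> ln (mean_weight CARD('n) 0)" using n by (simp add: mean_weight_def)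
  have K3: "K3 \<ge> 0" using K1(1) K2(1) m0 by (simp add: K3_def)
  have Lge: "ln (mean_weight CARD('n) t) / 2 - K3 \<le> L t i" for t i
  proof -
    have disp0: "0 \<le> (\<Sum>s<t. \<Sum>i\<in>UNIV. (mean_weight CARD('n) s - W s i)\<^sup>2 / (W s i * (mean_weight CARD('n) s)\<^sup>2))"
      using W_pos by (auto intro!: sum_nonneg divide_nonneg_nonneg mult_nonneg_nonneg intro: less_imp_le)
    have "(\<Sum>s<t. real CARD('n) / mean_weight CARD('n) s) \<le> (\<Sum>s<t. \<Sum>i\<in>UNIV. 1 / W s i)"
      using disp0 by (simp add: inverse_row_weight sum.distrib)
    then have "real CARD('n) / 2 * (ln (mean_weight CARD('n) t) - ln (mean_weight CARD('n) 0)) - K2 \<le> (\<Sum>i\<in>UNIV. L t i)"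
      using K2(2)[of t] N_over_m_ge[of t] by linarith
    also have "\<dots> = L t i + (\<Sum>i\<in>UNIV - {i}. L t i)" by (simp add: sum.remove[of UNIV i])
    \<comment> \<open>Three agents are needed here: the complement must contain a pair.\<close>
    also have "(\<Sum>i\<in>UNIV - {i}. L t i) \<le> real (card (UNIV - {i})) * (ln (mean_weight CARD('n) t) + K1) / 2"
      using n K1(2) by (intro sum_le_if_pairs_le) auto
    also have "\<dots> = (real CARD('n) - 1) * (ln (mean_weight CARD('n) t) + K1) / 2" using n by (simp add: of_nat_diff)
    also have "\<dots> = (real CARD('n) * ln (mean_weight CARD('n) t) + real CARD('n) * K1 - ln (mean_weight CARD('n) t) - K1) / 2"
      by (simp add: algebra_simps)
    finally have "real CARD('n) * ln (mean_weight CARD('n) t) / 2 - real CARD('n) * ln (mean_weight CARD('n) 0) / 2 - K2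
      \<le> L t i + (real CARD('n) * ln (mean_weight CARD('n) t) + real CARD('n) * K1 - ln (mean_weight CARD('n) t) - K1) / 2"
      by (simp add: algebra_simps)
    then show ?thesis using K1(1) unfolding K3_def by argo
  qed
  define \<delta> where "\<delta> = exp (- (K0 + 2 * K3))"
  have "\<delta> * mean_weight CARD('n) t \<le> weight v t i j" if "i \<noteq> j" for t i j
  proof -
    have "ln (mean_weight CARD('n) t) - (K0 + 2 * K3) \<le> ln (weight v t i j)"
      using ln_weight[OF that, of t] K0(2)[OF that, of t] Lge[of t i] Lge[of t j] by linarith
    then have "exp (ln (mean_weight CARD('n) t) - (K0 + 2 * K3)) \<le> weight v t i j"
      using weight_ge_1[OF that, of v t] by (subst ln_ge_iff[symmetric]) auto
    moreover have "exp (ln (mean_weight CARD('n) t) - (K0 + 2 * K3)) = \<delta> * mean_weight CARD('n) t"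
      unfolding \<delta>_def using m_pos[of t] by (subst diff_conv_add_uminus, subst exp_add) (simp add: mult.commute)
    ultimately show ?thesis by simp
  qed
  moreover have "\<delta> > 0" "\<delta> \<le> 1" using K0(1) K3 by (auto simp: \<delta>_def)
  ultimately show ?thesis by blast
qed

lemma eventually_row_weight:
  assumes "\<epsilon> > 0" shows "eventually (\<lambda>t. \<forall>i. \<bar>W t i / mean_weight CARD('n) t - 1\<bar> < \<epsilon>) sequentially"
  unfolding eventually_all_finite
  using tendstoD[OF row_weight_limit assms] by (simp add: eventually_all_finite dist_real_def)

text \<open>Late pair ratios change by factors near 1, row sums are near the mean and off-diagonal
  entries have a uniform lower bound, so \<open>normalized_weight_close\<close> yields the Cauchy
  property.\<close>

lemma normalized_weight_convergent: "convergent (\<lambda>t. weight v t i j / mean_weight CARD('n) t)"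
proof -
  obtain \<delta> where \<delta>: "\<delta> > 0" "\<delta> \<le> 1" "\<And>t i j. i \<noteq> j \<Longrightarrow> \<delta> * mean_weight CARD('n) t \<le> weight v t i j"
    using weight_lower_bound by blast
  have "Cauchy (\<lambda>t. weight v t i j / mean_weight CARD('n) t)"
  proof (rule CauchyI')
    fix \<epsilon> :: real assume \<epsilon>: "\<epsilon> > 0"
    \<comment> \<open>The first bound is the hypothesis of the rigidity lemma, the second makes its
      conclusion at most \<open>\<epsilon> / 2\<close>.\<close>
    define \<eta> where "\<eta> = min (\<delta> / 600) (\<epsilon> * \<delta> / 3200)"
    have \<eta>: "\<eta> > 0" "600 * \<eta> \<le> \<delta>" "1600 * \<eta> / \<delta> < \<epsilon>"
      using \<epsilon> \<delta> by (auto simp: \<eta>_def min_def field_simps)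
    have "\<exists>N0. \<forall>t\<ge>N0. \<forall>t'\<ge>N0. i \<noteq> j \<longrightarrow> \<bar>pair_ratio v t' i j / pair_ratio v t i j - 1\<bar> \<le> \<eta>" for i j
    proof (cases "i = j")
      case False
      then obtain c where c: "c > 0" "(\<lambda>t. pair_ratio v t i j) \<longlonglongrightarrow> c" using ratios by blast
      \<comment> \<open>Two late ratios differ by at most \<open>2 * d\<close>, and the denominator
        is at least \<open>c / 2\<close>.\<close>
      define d where "d = min (c / 2) (\<eta> * c / 4)"
      have d: "d > 0" "d \<le> c / 2" "2 * d \<le> \<eta> * (c / 2)" using c \<eta> by (auto simp: d_def min_def)
      obtain N0 where N0: "\<And>t. t \<ge> N0 \<Longrightarrow> \<bar>pair_ratio v t i j - c\<bar> < d"
        using tendstoD[OF c(2) d(1)] by (auto simp: eventually_sequentially dist_real_def)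
      have "\<bar>pair_ratio v t' i j / pair_ratio v t i j - 1\<bar> \<le> \<eta>" if t: "t \<ge> N0" "t' \<ge> N0" for t t'
      proof -
        have r: "c / 2 \<le> pair_ratio v t i j" using N0[OF t(1)] d by (auto simp: abs_if split: if_splits)
        have "\<bar>pair_ratio v t' i j - pair_ratio v t i j\<bar> \<le> 2 * d" using N0[OF t(1)] N0[OF t(2)] by linarith
        also have "\<dots> \<le> \<eta> * (c / 2)" by (rule d)
        also have "\<dots> \<le> \<eta> * pair_ratio v t i j" using r \<eta> by (intro mult_left_mono) auto
        finally have "\<bar>pair_ratio v t' i j - pair_ratio v t i j\<bar> / pair_ratio v t i j \<le> \<eta>"
          using r c by (simp add: field_simps)
        moreover have "pair_ratio v t' i j / pair_ratio v t i j - 1 = (pair_ratio v t' i j - pair_ratio v t i j) / pair_ratio v t i j"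
          using r c by (simp add: field_simps)
        ultimately show ?thesis using r c by simp
      qed
      then show ?thesis by blast
    qed auto
    then obtain N0 where N0: "\<And>i j t t'. t \<ge> N0 i j \<Longrightarrow> t' \<ge> N0 i j \<Longrightarrow> i \<noteq> j \<Longrightarrow> \<bar>pair_ratio v t' i j / pair_ratio v t i j - 1\<bar> \<le> \<eta>"
      by metis
    define N1 where "N1 = (\<Sum>i\<in>UNIV. \<Sum>j\<in>UNIV. N0 i j)"
    have N1: "N0 i j \<le> N1" for i j
      unfolding N1_def using member_le_sum[of j UNIV "N0 i"] member_le_sum[of i UNIV "\<lambda>i. \<Sum>j\<in>UNIV. N0 i j"]
      by (meson order_trans UNIV_I finite zero_le)
    obtain N2 where N2: "\<And>t i. t \<ge> N2 \<Longrightarrow> \<bar>W t i / mean_weight CARD('n) t - 1\<bar> < \<eta>"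
      using eventually_row_weight[OF \<eta>(1)] by (auto simp: eventually_sequentially)
    have diag: "weight v t i i = 0" for t i using visits_other by (intro weight_diag) auto
    have "\<bar>weight v t' i j / mean_weight CARD('n) t' - weight v t i j / mean_weight CARD('n) t\<bar> \<le> 1600 * \<eta> / \<delta>"
      if t: "t \<ge> max N1 N2" "t' \<ge> max N1 N2" for t t'
    proof (rule normalized_weight_close[OF n \<delta>(1,2) _ \<eta>(2)])
      show "\<bar>pair_ratio v t' i j / pair_ratio v t i j - 1\<bar> \<le> \<eta>" if "i \<noteq> j" for i j
        using N0[OF _ _ that, of t t'] t N1[of i j] by linarith
      show "\<bar>W t i / mean_weight CARD('n) t - 1\<bar> \<le> \<eta>" "\<bar>W t' i / mean_weight CARD('n) t' - 1\<bar> \<le> \<eta>" for i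
        using N2[of t i] N2[of t' i] t by auto
    qed (use \<eta> \<delta> diag in auto)
    then have "dist (weight v t i j / mean_weight CARD('n) t) (weight v t' i j / mean_weight CARD('n) t') < \<epsilon>"
      if "t \<ge> max N1 N2" "t' \<ge> max N1 N2" for t t'
      using that \<eta>(3) by (fastforce simp: dist_real_def abs_minus_commute)
    then show "\<exists>M. \<forall>t\<ge>M. \<forall>t'>t. dist (weight v t i j / mean_weight CARD('n) t) (weight v t' i j / mean_weight CARD('n) t') < \<epsilon>"
      by (meson less_imp_le order_trans)
  qed
  then show ?thesis by (simp add: Cauchy_convergent)
qed

lemma visit_matrix_limit:
  "\<exists>P. (\<lambda>t. visit_matrix v t) \<longlonglongrightarrow> P \<and> (\<forall>i j. (\<lambda>t. weight v t i j / mean_weight CARD('n) t) \<longlonglongrightarrow> P $ i $ j)"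
proof -
  obtain p where p: "\<And>i j. (\<lambda>t. weight v t i j / mean_weight CARD('n) t) \<longlonglongrightarrow> p i j"
    using normalized_weight_convergent unfolding convergent_def by metis
  define P :: "real^'n^'n" where "P = (\<chi> i j. p i j)"
  have "(\<lambda>t. visit_matrix v t) \<longlonglongrightarrow> P"
  proof (intro vec_tendstoI)
    fix i j
    have "(\<lambda>t. (weight v t i j / mean_weight CARD('n) t) / (W t i / mean_weight CARD('n) t)) \<longlonglongrightarrow> p i j / 1"
      by (intro tendsto_divide p row_weight_limit) simp
    moreover have "(weight v t i j / mean_weight CARD('n) t) / (W t i / mean_weight CARD('n) t) = visit_matrix v t $ i $ j" for t
      using m_pos[of t] by (simp add: visit_matrix_nth)
    ultimately show "(\<lambda>t. visit_matrix v t $ i $ j) \<longlonglongrightarrow> P $ i $ j" by (simp add: P_def)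
  qed
  then show ?thesis using p by (auto simp: P_def)
qed

end

section \<open>Almost sure limits of the pair ratios\<close>

lemma determined_weight: "determined t (\<lambda>v. weight v t i j)"
  unfolding determined_def by (auto intro: weight_cong)

lemma determined_growth: "determined t (\<lambda>v. growth v t i)"
  unfolding determined_def by (auto intro: growth_cong)

lemma determined_pair_ratio: "determined t (\<lambda>v. pair_ratio v t i j)"
  unfolding pair_ratio_def
  by (intro determined_binop[where F="(/)"] determined_binop[where F="(*)"] determined_weight determined_growth)

lemma determined_pair_inverse: "determined t (\<lambda>v. pair_inverse v t i j)"
  unfolding pair_inverse_def
  by (intro determined_binop[where F="(/)"] determined_binop[where F="(*)"] determined_growth
      determined_unop[where F="\<lambda>x. x - 1"] determined_weight)

text \<open>Links the two supermartingales: the shift of the weight by 1 only enlarges the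
  reciprocal.\<close>

lemma pair_ratio_inverse_le:
  assumes "weight v t i j \<ge> 2"
  shows "inverse (pair_ratio v t i j) \<le> pair_inverse v t i j"
  using assms growth_pos[of v t i] growth_pos[of v t j]
  by (auto simp: pair_ratio_def pair_inverse_def intro!: divide_left_mono)

lemma supermartingale_pair_ratio:
  assumes "i \<noteq> j" shows "supermartingale_from T (\<lambda>t v. pair_ratio v t i j)"
  unfolding supermartingale_from_def
  using assms by (auto simp: determined_pair_ratio step_expectation_pair_ratio intro: less_imp_le[OF pair_ratio_pos])

text \<open>Freezing the condition at time \<open>T\<close> makes the indicator constant from then
  on, and the condition persists because weights never decrease.\<close>

lemma supermartingale_pair_inverse:
  assumes "i \<noteq> (j::'n::finite)" "CARD('n) \<ge> 3" "T \<ge> 1"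
  shows "supermartingale_from T (\<lambda>t v. of_bool (2 \<le> weight v T i j) * pair_inverse v t i j)"
  unfolding supermartingale_from_def
proof (intro conjI allI impI)
  fix t v
  show "0 \<le> of_bool (2 \<le> weight v T i j) * pair_inverse v t i j"
    using weight_ge_1[OF assms(1), of v t] growth_pos[of v t]
    by (auto simp: pair_inverse_def intro!: divide_nonneg_nonneg mult_nonneg_nonneg intro: less_imp_le)
  assume t: "t \<ge> T"
  show "determined t (\<lambda>v. of_bool (2 \<le> weight v T i j) * pair_inverse v t i j)"
    by (intro determined_binop[where F="(*)"] determined_pair_inverse
        determined_mono[OF _ t] determined_unop[where F="\<lambda>x. of_bool (2 \<le> x)"] determined_weight)
  show "step_expectation t (\<lambda>v. of_bool (2 \<le> weight v T i j) * pair_inverse v (Suc t) i j) v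
    \<le> of_bool (2 \<le> weight v T i j) * pair_inverse v t i j"
  proof (rule step_expectation_pair_inverse)
    show "(2 \<le> weight (v(t := f)) T i j) = (2 \<le> weight v T i j)" for f
      using weight_cong[of T "v(t := f)" v i j] t by auto
    show "2 \<le> weight v T i j \<Longrightarrow> 2 \<le> weight v t i j"
      using weight_mono[OF t, of v i j] by linarith
  qed (use assms t in auto)
qed

lemma not_summable_mean_weight:
  assumes "n \<ge> 2" shows "\<not> summable (\<lambda>s. 1 / (real n * mean_weight n s))"
proof
  assume *: "summable (\<lambda>s. 1 / (real n * mean_weight n s))"
  have "summable (\<lambda>s. real n ^ 2 * (1 / (real n * mean_weight n s)))"
    by (rule summable_mult[OF *])
  then have "summable (\<lambda>s. inverse (real (Suc s)))"
  proof (rule summable_comparison_test')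
    fix s :: nat
    have m: "0 < mean_weight n s" using assms by (simp add: mean_weight_def)
    have "2 * real s \<le> real n * real s" using assms by (intro mult_right_mono) auto
    then have "mean_weight n s \<le> real n * real (Suc s)" by (simp add: mean_weight_def algebra_simps)
    then have "real n / (real n * real (Suc s)) \<le> real n / mean_weight n s"
      using m assms by (intro divide_left_mono mult_pos_pos) auto
    moreover have "real n / (real n * real (Suc s)) = norm (inverse (real (Suc s)))"
      using assms by (simp add: inverse_eq_divide del: of_nat_Suc)
    moreover have "real n / mean_weight n s = real n ^ 2 * (1 / (real n * mean_weight n s))"
      using assms m by (simp add: power2_eq_square)
    ultimately show "norm (inverse (real (Suc s))) \<le> real n ^ 2 * (1 / (real n * mean_weight n s))"
      by simp
  qed
  then show False using not_summable_harmonic[where 'a=real] summable_Suc_iff[of "\<lambda>n. inverse (real n)"] by simp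
qed

context friends_II
begin

text \<open>With \<open>H\<close> the indicator of a history before \<open>T\<close> this is a bound
  conditional on that history.\<close>

lemma supermartingale_expectation_le_weighted:
  assumes X: "supermartingale_from T X" and t: "T \<le> t" and H: "determined T H" "\<And>v. 0 \<le> H v"
  shows "expectation (\<lambda>\<omega>. H (visits \<omega>) * X t (visits \<omega>)) \<le> expectation (\<lambda>\<omega>. H (visits \<omega>) * X T (visits \<omega>))"
  using t
proof (induction t rule: dec_induct)
  case (step t)
  have "expectation (\<lambda>\<omega>. H (visits \<omega>) * X (Suc t) (visits \<omega>)) \<le> expectation (\<lambda>\<omega>. H (visits \<omega>) * X t (visits \<omega>))"
    by (rule supermartingale_expectation_Suc[OF X step(1) determined_mono[OF H(1) step(1)] H(2)])
  then show ?case using step by simp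
qed simp

text \<open>If the pair never met, the convergent supermartingale of
  \<open>step_expectation_unvisited\<close> would be the exponential of a divergent sum.\<close>

lemma AE_weight_ge_2:
  assumes "i \<noteq> j"
  shows "AE \<omega> in M. \<exists>T. 2 \<le> weight (visits \<omega>) T i j"
proof -
  have n: "CARD('n) \<ge> 2" using card_ge_2_distinct[OF assms] .
  define S where "S t = (\<Sum>s<t. 1 / (real CARD('n) * mean_weight CARD('n) s))" for t
  let ?X = "\<lambda>t v. of_bool (weight v t i j = 1) * exp (S t)"
  have "supermartingale_from 0 ?X"
    unfolding supermartingale_from_def S_def
    using step_expectation_unvisited[OF assms]
    by (auto intro!: determined_unop[where F="\<lambda>x. of_bool (x = 1) * exp _"] determined_weight)
  then have "AE \<omega> in M. convergent (\<lambda>t. ?X t (visits \<omega>))" by (rule supermartingale_convergence)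
  then show ?thesis
  proof (rule AE_mp, intro AE_I2 impI)
    fix \<omega> assume "convergent (\<lambda>t. ?X t (visits \<omega>))"
    then have "Bseq (\<lambda>t. ?X t (visits \<omega>))" by (rule convergent_imp_Bseq)
    then obtain K where K: "K > 0" "\<And>t. norm (?X t (visits \<omega>)) \<le> K" by (auto simp: Bseq_def)
    show "\<exists>T. 2 \<le> weight (visits \<omega>) T i j"
    proof (rule ccontr)
      assume "\<nexists>T. 2 \<le> weight (visits \<omega>) T i j"
      then have "weight (visits \<omega>) t i j = 1" for t using weight_eq_1_or_ge_2[OF assms, of "visits \<omega>" t] by auto
      then have "exp (S t) \<le> K" for t using K(2)[of t] by simp
      then have "S t \<le> ln K" for t using K(1) by (simp add: ln_ge_iff)
      then have "summable (\<lambda>s. 1 / (real CARD('n) * mean_weight CARD('n) s))"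
        unfolding S_def using n by (intro summableI_nonneg_bounded[where x="ln K"]) (auto simp: mean_weight_def)
      then show False using not_summable_mean_weight[OF n] by simp
    qed
  qed
qed

text \<open>One supermartingale gives a finite limit; the other bounds the reciprocals and thus
  keeps the limit positive.\<close>

lemma AE_pair_ratio_limit:
  assumes "i \<noteq> j" "CARD('n) \<ge> 3"
  shows "AE \<omega> in M. \<exists>c>0. (\<lambda>t. pair_ratio (visits \<omega>) t i j) \<longlonglongrightarrow> c"
proof -
  \<comment> \<open>The time at which the weight reaches 2 is random, so all starting times are
    treated at once; \<open>Suc T\<close> makes them positive.\<close>
  have inv: "AE \<omega> in M. \<forall>T. convergent (\<lambda>t. of_bool (2 \<le> weight (visits \<omega>) (Suc T) i j) * pair_inverse (visits \<omega>) t i j)"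
    unfolding AE_all_countable
    by (intro allI supermartingale_convergence[OF supermartingale_pair_inverse[OF assms]]) simp
  from inv AE_weight_ge_2[OF assms(1)] supermartingale_convergence[OF supermartingale_pair_ratio[OF assms(1)]]
  show ?thesis
  proof eventually_elim
    case (elim \<omega>)
    let ?v = "visits \<omega>"
    obtain T where T: "2 \<le> weight ?v T i j" using elim(2) by auto
    have w2: "2 \<le> weight ?v t i j" if "t \<ge> T" for t using weight_mono[OF that, of ?v i j] T by linarith
    have "convergent (\<lambda>t. pair_inverse ?v t i j)" using elim(1)[rule_format, of T] w2[of "Suc T"] by simp
    then have "Bseq (\<lambda>t. pair_inverse ?v t i j)" by (rule convergent_imp_Bseq)
    then obtain K where K: "K > 0" "\<And>t. norm (pair_inverse ?v t i j) \<le> K"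
      by (auto simp: Bseq_def)
    obtain c where c: "(\<lambda>t. pair_ratio ?v t i j) \<longlonglongrightarrow> c" using elim(3) by (auto simp: convergent_def)
    have "1 / K \<le> pair_ratio ?v t i j" if "t \<ge> T" for t
    proof -
      have "inverse (pair_ratio ?v t i j) \<le> K"
        using pair_ratio_inverse_le[OF w2[OF that]] K(2)[of t] unfolding real_norm_def by linarith
      then show ?thesis using pair_ratio_pos[OF assms(1), of ?v t] K(1) by (simp add: field_simps)
    qed
    then have "1 / K \<le> c"
      by (intro tendsto_lowerbound[OF c]) (auto simp: eventually_sequentially)
    moreover have "0 < 1 / K" using K(1) by simp
    ultimately have "0 < c" by (rule less_le_trans[rotated])
    then show ?case using c by blast
  qed
qed

text \<open>Let \<open>w\<close> be the weight of the pair at time \<open>T\<close> and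
  \<open>c\<close> the relative change of the ratio. Given the history, \<open>c\<close> has mean at
  most 1 and \<open>1 / c\<close> has mean at most \<open>w / (w - 1)\<close>, so
  \<open>c + 1 / c - 2 = (c - 1)\<^sup>2 / c\<close> has mean at most \<open>1 / (w - 1)\<close>,
  and Markov's inequality applies.\<close>

lemma prob_pair_ratio_deviation:
  assumes ij: "i \<noteq> j" and n: "CARD('n) \<ge> 3" and T: "1 \<le> T" "T \<le> t" and w: "2 \<le> weight h T i j" and \<eta>: "0 < \<eta>" "\<eta> \<le> 1"
  shows "prob {\<omega> \<in> space M. (\<forall>s<T. visits \<omega> s = h s) \<and> \<eta> < \<bar>pair_ratio (visits \<omega>) t i j / pair_ratio h T i j - 1\<bar>}
    \<le> 2 / (\<eta>\<^sup>2 * (weight h T i j - 1)) * prob (cylinder T h)"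
proof -
  define Q where "Q v \<longleftrightarrow> (\<forall>s<T. v s = h s)" for v
  define \<rho> where "\<rho> = pair_ratio h T i j"
  define I where "I t v = of_bool (2 \<le> weight v T i j) * pair_inverse v t i j" for t v
  have \<rho>: "\<rho> > 0" by (simp add: \<rho>_def pair_ratio_pos ij)
  have dQ: "determined T Q" by (auto simp: determined_def Q_def)
  have dQ1: "determined T (\<lambda>v. of_bool (Q v) :: real)" by (rule determined_unop[OF dQ])
  have dQt: "determined t (\<lambda>v. of_bool (Q v) :: real)" by (rule determined_mono[OF dQ1 T(2)])
  have sI: "supermartingale_from T I" unfolding I_def by (rule supermartingale_pair_inverse[OF ij n T(1)])
  have dI: "determined t (I t)" using sI T(2) by (auto simp: supermartingale_from_def)
  have atT: "of_bool (Q v) * pair_ratio v T i j = \<rho> * of_bool (Q v)"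
    "of_bool (Q v) * I T v = (G / (weight h T i j - 1)) * of_bool (Q v)"
    if "G = growth h T i * growth h T j" for v G
  proof -
    have *: "pair_ratio v T i j = \<rho>" "I T v = G / (weight h T i j - 1)" if "Q v"
    proof -
      have "weight v T i j = weight h T i j" "growth v T i = growth h T i" "growth v T j = growth h T j"
        using that by (auto simp: Q_def intro!: weight_cong growth_cong)
      then show "pair_ratio v T i j = \<rho>" "I T v = G / (weight h T i j - 1)"
        using w by (auto simp: \<rho>_def pair_ratio_def I_def pair_inverse_def \<open>G = _\<close>)
    qed
    show "of_bool (Q v) * pair_ratio v T i j = \<rho> * of_bool (Q v)"
      "of_bool (Q v) * I T v = (G / (weight h T i j - 1)) * of_bool (Q v)" using * by auto
  qed
  define G where "G = growth h T i * growth h T j"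
  have G: "G > 0" by (simp add: G_def growth_pos)
  have PQ: "expectation (\<lambda>\<omega>. of_bool (Q (visits \<omega>))) = prob (cylinder T h)"
  proof -
    have *: "{\<omega> \<in> space M. Q (visits \<omega>)} = cylinder T h" by (auto simp: Q_def cylinder_def visits_def)
    show ?thesis by (subst expectation_of_bool) (simp_all only: * sets_cylinder)
  qed
  have e1: "expectation (\<lambda>\<omega>. of_bool (Q (visits \<omega>)) * pair_ratio (visits \<omega>) t i j) \<le> \<rho> * prob (cylinder T h)"
    using supermartingale_expectation_le_weighted[OF supermartingale_pair_ratio[OF ij] T(2) dQ1]
    by (simp add: atT[OF G_def] PQ)
  have e2: "expectation (\<lambda>\<omega>. of_bool (Q (visits \<omega>)) * I t (visits \<omega>)) \<le> G / (weight h T i j - 1) * prob (cylinder T h)"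
    using supermartingale_expectation_le_weighted[OF sI T(2) dQ1] by (simp add: atT[OF G_def] PQ)
  have i1: "integrable M (\<lambda>\<omega>. of_bool (Q (visits \<omega>)) * pair_ratio (visits \<omega>) t i j)"
    by (rule integrable_determined[OF determined_binop[OF dQt determined_pair_ratio]])
  have i2: "integrable M (\<lambda>\<omega>. of_bool (Q (visits \<omega>)) * I t (visits \<omega>))"
    by (rule integrable_determined[OF determined_binop[OF dQt dI]])
  have i3: "integrable M (\<lambda>\<omega>. of_bool (Q (visits \<omega>)) :: real)"
    by (rule integrable_determined[OF dQt])
  let ?bad = "\<lambda>v. Q v \<and> \<eta> < \<bar>pair_ratio v t i j / \<rho> - 1\<bar>"
  have dbad: "determined t ?bad"
    by (rule determined_binop[where F="\<lambda>x y. x \<and> \<eta> < \<bar>y / \<rho> - 1\<bar>", OF determined_mono[OF dQ T(2)] determined_pair_ratio])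
  have pt: "\<eta>\<^sup>2 / 2 * of_bool (?bad v) \<le> of_bool (Q v) * pair_ratio v t i j / \<rho> + \<rho> * (of_bool (Q v) * I t v) - 2 * of_bool (Q v)" for v
  proof (cases "Q v")
    case True
    have wT: "weight v T i j = weight h T i j" using True by (intro weight_cong) (auto simp: Q_def)
    have w2: "2 \<le> weight v t i j" using weight_mono[OF T(2), of v i j] w wT by linarith
    define c where "c = pair_ratio v t i j / \<rho>"
    have c: "c > 0" using \<rho> pair_ratio_pos[OF ij] by (simp add: c_def)
    have "\<rho> * I t v = \<rho> * pair_inverse v t i j" using wT w by (simp add: I_def)
    also have "\<dots> \<ge> \<rho> * inverse (pair_ratio v t i j)"
      using \<rho> pair_ratio_inverse_le[OF w2] by (intro mult_left_mono) auto
    also have "\<rho> * inverse (pair_ratio v t i j) = 1 / c" using \<rho> by (simp add: c_def divide_simps)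
    finally have I: "1 / c \<le> \<rho> * I t v" .
    have sq: "c + 1 / c - 2 = (c - 1)\<^sup>2 / c" using c by (simp add: field_simps power2_eq_square)
    have "\<eta>\<^sup>2 / 2 * of_bool (\<eta> < \<bar>c - 1\<bar>) \<le> (c - 1)\<^sup>2 / c"
    proof (cases "\<eta> < \<bar>c - 1\<bar>")
      case bad: True
      have "\<eta>\<^sup>2 * c \<le> 2 * (c - 1)\<^sup>2"
      \<comment> \<open>For \<open>c\<close> at most 2 the denominator costs a factor 2; for larger
        \<open>c\<close> the quotient \<open>(c - 1)\<^sup>2 / c\<close> is at least 1/2, which
        suffices because \<open>\<eta> \<le> 1\<close>.\<close>
      proof (cases "c \<le> 2")
        case True
        have "\<eta>\<^sup>2 \<le> (c - 1)\<^sup>2" using bad \<eta> by (intro abs_le_square_iff[THEN iffD1]) auto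
        then show ?thesis using mult_mono[of "\<eta>\<^sup>2" "(c-1)\<^sup>2" c 2] True c by simp
      next
        case False
        have "\<eta>\<^sup>2 \<le> 1" using \<eta> by (simp add: power_le_one)
        then have "\<eta>\<^sup>2 * c \<le> 1 * c" using c by (intro mult_right_mono) auto
        also have "\<dots> \<le> 2 * (c - 1)\<^sup>2"
        proof -
          have "0 \<le> (c - 2) * (2 * c - 1)" using False by (intro mult_nonneg_nonneg) auto
          then show ?thesis by (simp add: power2_eq_square algebra_simps)
        qed
        finally show ?thesis .
      qed
      then show ?thesis using bad c by (simp add: field_simps)
    qed (use c in auto)
    with I sq have "\<eta>\<^sup>2 / 2 * of_bool (\<eta> < \<bar>c - 1\<bar>) \<le> c + \<rho> * I t v - 2" by linarith
    then show ?thesis using True by (simp add: c_def)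
  qed auto
  have "\<eta>\<^sup>2 / 2 * expectation (\<lambda>\<omega>. of_bool (?bad (visits \<omega>)))
      = expectation (\<lambda>\<omega>. \<eta>\<^sup>2 / 2 * of_bool (?bad (visits \<omega>)))"
    by simp
  also have "\<dots> \<le> expectation (\<lambda>\<omega>. of_bool (Q (visits \<omega>)) * pair_ratio (visits \<omega>) t i j / \<rho>
      + \<rho> * (of_bool (Q (visits \<omega>)) * I t (visits \<omega>)) - 2 * of_bool (Q (visits \<omega>)))"
    by (intro integral_mono pt Bochner_Integration.integrable_diff Bochner_Integration.integrable_add
        integrable_mult_right integrable_divide i1 i2 i3 integrable_determined[OF determined_unop[OF dbad]])
  also have "\<dots> = expectation (\<lambda>\<omega>. of_bool (Q (visits \<omega>)) * pair_ratio (visits \<omega>) t i j) / \<rho>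
      + \<rho> * expectation (\<lambda>\<omega>. of_bool (Q (visits \<omega>)) * I t (visits \<omega>)) - 2 * prob (cylinder T h)"
    using i1 i2 i3 by (simp add: PQ)
  also have "\<dots> \<le> \<rho> * prob (cylinder T h) / \<rho> + \<rho> * (G / (weight h T i j - 1) * prob (cylinder T h)) - 2 * prob (cylinder T h)"
    using e1 e2 \<rho> by (intro diff_mono add_mono divide_right_mono mult_left_mono) auto
  also have "\<rho> * (G / (weight h T i j - 1) * prob (cylinder T h)) = weight h T i j / (weight h T i j - 1) * prob (cylinder T h)"
    using growth_pos[of h T i] growth_pos[of h T j] by (simp add: \<rho>_def pair_ratio_def G_def)
  also have "\<rho> * prob (cylinder T h) / \<rho> + weight h T i j / (weight h T i j - 1) * prob (cylinder T h) - 2 * prob (cylinder T h)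
      = prob (cylinder T h) / (weight h T i j - 1)"
    using \<rho> w by (simp add: field_simps)
  finally have *: "\<eta>\<^sup>2 / 2 * expectation (\<lambda>\<omega>. of_bool (?bad (visits \<omega>))) \<le> prob (cylinder T h) / (weight h T i j - 1)" .
  have "{\<omega> \<in> space M. ?bad (visits \<omega>)} \<in> sets M"
    using measurable_sets[OF measurable_determined[OF dbad], of "{True}"] by (simp add: vimage_def Int_def conj_commute)
  from expectation_of_bool[OF this] * have "\<eta>\<^sup>2 / 2 * prob {\<omega> \<in> space M. ?bad (visits \<omega>)} \<le> prob (cylinder T h) / (weight h T i j - 1)"
    by simp
  then show ?thesis using \<eta> w unfolding Q_def \<rho>_def by (simp add: field_simps)
qed

end

section \<open>The limit matrix and its support\<close>

lemma balanced_sequence: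
  fixes A :: "'n::finite \<Rightarrow> real"
  assumes A: "\<And>j. 0 \<le> A j" "(\<Sum>j\<in>UNIV. A j) = 1"
  shows "\<exists>c. (\<forall>t. 0 < A (c t)) \<and>
    (\<forall>t j. \<bar>(\<Sum>s<t. of_bool (c s = j)) - real t * A j\<bar> \<le> real CARD('n))"
proof -
  \<comment> \<open>Greedy apportionment: always choose an index whose count is below its quota for
    the next round.\<close>
  define pick where "pick t k = (SOME j. k j < real (Suc t) * A j)" for t and k :: "'n \<Rightarrow> real"
  define K where "K = rec_nat (\<lambda>_. 0::real) (\<lambda>t k. k(pick t k := k (pick t k) + 1))"
  define c where "c t = pick t (K t)" for t
  have K0: "K 0 = (\<lambda>_. 0)" and KS: "K (Suc t) j = K t j + of_bool (c t = j)" for t j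
    by (simp_all add: K_def c_def)
  have K: "K t j = (\<Sum>s<t. of_bool (c s = j))" for t j
    by (induction t) (simp_all add: K0 KS)
  have sumK: "(\<Sum>j\<in>UNIV. K t j) = real t" for t
    by (induction t) (simp_all add: K0 KS sum.distrib)
  have pick: "K t (c t) < real (Suc t) * A (c t)" for t
    unfolding c_def pick_def
  \<comment> \<open>Such an index exists because the counts add up to \<open>t\<close> and the
    quotas to \<open>t + 1\<close>.\<close>
  proof (rule someI_ex, rule ccontr)
    assume "\<nexists>j. K t j < real (Suc t) * A j"
    then have "(\<Sum>j\<in>UNIV. real (Suc t) * A j) \<le> (\<Sum>j\<in>UNIV. K t j)" by (intro sum_mono) (auto simp: not_less)
    then show False by (simp add: sumK sum_distrib_left[symmetric] A(2) del: of_nat_Suc)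
  qed
  have up: "K t j \<le> real t * A j + 1" for t j
  proof (induction t)
    case (Suc t)
    show ?case
    proof (cases "c t = j")
      case True then show ?thesis using pick[of t] by (simp add: KS)
    next
      case False then show ?thesis using Suc A(1)[of j] by (simp add: KS algebra_simps)
    qed
  qed (simp add: K0)
  \<comment> \<open>No count exceeds its quota by more than 1, so a single count falls short by at
    most the total excess of the others.\<close>
  have lo: "real t * A j - real CARD('n) \<le> K t j" for t j
  proof -
    have "real t = K t j + (\<Sum>k\<in>UNIV - {j}. K t k)" using sumK[of t] by (simp add: sum.remove[of UNIV j])
    also have "\<dots> \<le> K t j + (\<Sum>k\<in>UNIV - {j}. real t * A k + 1)" by (intro add_left_mono sum_mono up)
    also have "(\<Sum>k\<in>UNIV - {j}. real t * A k + 1) = real t * (1 - A j) + real (CARD('n) - 1)"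
      by (simp add: sum.distrib sum_distrib_left[symmetric] sum_diff1 A(2))
    also have "\<dots> \<le> real t - real t * A j + real CARD('n)" by (simp add: algebra_simps)
    finally show ?thesis by simp
  qed
  \<comment> \<open>A chosen index has a positive quota. Hence an agent never chooses itself when
    the diagonal entry is zero.\<close>
  have pos: "0 < A (c t)" for t
  proof -
    have "0 \<le> K t (c t)" by (simp add: K sum_nonneg)
    then have "0 < real (Suc t) * A (c t)" using pick[of t] by linarith
    then show ?thesis by (simp add: zero_less_mult_iff)
  qed
  have one: "1 \<le> real CARD('n)" using zero_less_card_finite[where 'a='n] by linarith
  have "\<bar>(\<Sum>s<t. of_bool (c s = j)) - real t * A j\<bar> \<le> real CARD('n)" for t j
    using up[of t j] lo[of t j] one unfolding K[symmetric] by linarith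
  then show ?thesis using pos by blast
qed

text \<open>Each agent follows the balanced sequence of its row. By symmetry the visits in both
  directions together amount to about \<open>2 * t * A $ i $ j\<close>, and
  \<open>mean_weight\<close> differs from \<open>2 * t\<close> by a constant.\<close>

lemma balanced_visits:
  fixes A :: "real^'n^'n::finite"
  assumes "stochastic_matrix A" "\<And>i. A $ i $ i = 0" "\<And>i j. A $ i $ j = A $ j $ i"
  shows "\<exists>h. (\<forall>s i. h s i \<noteq> i) \<and> (\<forall>i j. (\<lambda>t. weight h t i j / mean_weight CARD('n) t) \<longlonglongrightarrow> A $ i $ j)"
proof -
  have "\<forall>i. \<exists>c. (\<forall>t. 0 < A $ i $ c t) \<and> (\<forall>t j. \<bar>(\<Sum>s<t. of_bool (c s = j)) - real t * A $ i $ j\<bar> \<le> real CARD('n))"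
    using assms(1) by (intro allI balanced_sequence) (auto simp: stochastic_matrix_def)
  then obtain c where c: "\<And>i t. 0 < A $ i $ c i t"
    "\<And>i t j. \<bar>(\<Sum>s<t. of_bool (c i s = j)) - real t * A $ i $ j\<bar> \<le> real CARD('n)" by metis
  define h where "h s i = c i s" for s i
  have lim: "(\<lambda>t. weight h t i j / mean_weight CARD('n) t) \<longlonglongrightarrow> A $ i $ j" for i j
  proof -
    \<comment> \<open>The summands cover the initial weight, the two balancing errors and the offset
      of \<open>mean_weight\<close> from \<open>2 * t\<close>.\<close>
    define K where "K = 1 + 2 * real CARD('n) + \<bar>A $ i $ j\<bar> * (real CARD('n) + 1)"
    have n0: "1 \<le> real CARD('n)" using zero_less_card_finite[where 'a='n] by linarith
    have bound: "norm (weight h t i j / mean_weight CARD('n) t - A $ i $ j) \<le> K / real t" if t: "t \<ge> 1" for t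
    proof -
      have m: "mean_weight CARD('n) t \<ge> real t" "mean_weight CARD('n) t > 0" using t n0 by (auto simp: mean_weight_def)
      have "weight h t i j = of_bool (i \<noteq> j) + (\<Sum>s<t. of_bool (c i s = j)) + (\<Sum>s<t. of_bool (c j s = i))"
        by (simp add: weight_eq_sum h_def sum.distrib)
      then have "\<bar>weight h t i j - 2 * real t * A $ i $ j\<bar> \<le> 1 + 2 * real CARD('n)"
        using c(2)[where i=i and t=t and j=j] c(2)[where i=j and t=t and j=i] assms(3)[of i j] by (auto simp: abs_le_iff)
      moreover have "\<bar>A $ i $ j * (real CARD('n) - 1)\<bar> \<le> \<bar>A $ i $ j\<bar> * (real CARD('n) + 1)"
        using n0 by (simp add: abs_mult mult_left_mono)
      moreover have "weight h t i j - A $ i $ j * mean_weight CARD('n) t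
          = (weight h t i j - 2 * real t * A $ i $ j) - A $ i $ j * (real CARD('n) - 1)"
        by (simp add: mean_weight_def algebra_simps)
      ultimately have "\<bar>weight h t i j - A $ i $ j * mean_weight CARD('n) t\<bar> \<le> K"
        unfolding K_def by linarith
      moreover have "weight h t i j / mean_weight CARD('n) t - A $ i $ j
          = (weight h t i j - A $ i $ j * mean_weight CARD('n) t) / mean_weight CARD('n) t"
        using m by (simp add: field_simps)
      ultimately have "norm (weight h t i j / mean_weight CARD('n) t - A $ i $ j) \<le> K / mean_weight CARD('n) t"
        using m by (simp add: divide_right_mono)
      also have "\<dots> \<le> K / real t" using m t n0 by (intro divide_left_mono) (auto simp: K_def)
      finally show ?thesis .
    qed
    have "(\<lambda>t. K / real t) \<longlonglongrightarrow> 0" by (rule lim_const_over_n)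
    then have "(\<lambda>t. weight h t i j / mean_weight CARD('n) t - A $ i $ j) \<longlonglongrightarrow> 0"
      by (rule Lim_null_comparison[rotated]) (use bound in \<open>auto simp: eventually_sequentially\<close>)
    then show ?thesis by (rule LIM_zero_cancel)
  qed
  have "h s i \<noteq> i" for s i using c(1)[of i s] assms(2)[of i] by (auto simp: h_def)
  then show ?thesis using lim by blast
qed

section \<open>Symmetric stochastic matrices with zero diagonal\<close>

definition admissible :: "(real^'n^'n::finite) set" where
  "admissible = {A. stochastic_matrix A \<and> transpose A = A \<and> (\<forall>i. A $ i $ i = 0)}"

lemma admissibleI:
  assumes "\<And>i j. 0 \<le> A $ i $ j" "\<And>i. (\<Sum>j\<in>UNIV. A $ i $ j) = 1" "\<And>i j. A $ i $ j = A $ j $ i" "\<And>i. A $ i $ i = 0"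
  shows "A \<in> admissible"
  using assms by (auto simp: admissible_def stochastic_matrix_def vec_eq_iff transpose_def)

lemma admissibleD:
  assumes "A \<in> admissible"
  shows "stochastic_matrix A" "0 \<le> A $ i $ j" "(\<Sum>j\<in>UNIV. A $ i $ j) = 1" "A $ i $ j = A $ j $ i" "A $ i $ i = 0"
  using assms by (auto simp: admissible_def stochastic_matrix_def vec_eq_iff transpose_def)

lemma closed_admissible: "closed (admissible :: (real^'n^'n::finite) set)"
proof -
  have "admissible = {A :: real^'n^'n. (\<forall>i j. 0 \<le> A $ i $ j) \<and> (\<forall>i. (\<Sum>j\<in>UNIV. A $ i $ j) = 1)
      \<and> (\<forall>i j. A $ i $ j = A $ j $ i) \<and> (\<forall>i. A $ i $ i = 0)}"
    by (intro set_eqI iffI) (auto simp: admissibleD intro: admissibleI)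
  also have "closed \<dots>"
    by (intro closed_Collect_conj closed_Collect_all closed_Collect_le closed_Collect_eq continuous_intros)
  finally show ?thesis .
qed

lemma zero_diagonal_stochastic_card_2:
  fixes A :: "real^'n^'n::finite"
  assumes "CARD('n) = 2" "\<And>i. (\<Sum>j\<in>UNIV. A $ i $ j) = 1" "\<And>i. A $ i $ i = 0"
  shows "A = (\<chi> i j. if i = j then 0 else 1)"
proof -
  have "A $ i $ j = 1" if "i \<noteq> j" for i j
  proof -
    have U: "UNIV = {i, j}" by (rule card_seteq[symmetric]) (use assms(1) that in auto)
    have "(\<Sum>y\<in>UNIV. A $ i $ y) = A $ i $ i + A $ i $ j" by (subst U) (use that in auto)
    then show ?thesis using assms(2)[of i] assms(3)[of i] by simp
  qed
  then show ?thesis using assms(3) by (simp add: vec_eq_iff)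
qed

text \<open>By symmetry there are three unknown entries, any two of which share a row and sum to
  1.\<close>

lemma admissible_card_3:
  fixes A :: "real^'n^'n::finite"
  assumes n: "CARD('n) = 3" and A: "A \<in> admissible"
  shows "A = (\<chi> i j. if i = j then 0 else 1/2)"
proof -
  have "A $ i $ j = 1/2" if ij: "i \<noteq> j" for i j
  proof -
    have "\<not> UNIV \<subseteq> {i, j}" using card_mono[of "{i, j}" "UNIV :: 'n set"] n ij by auto
    then obtain k where k: "k \<noteq> i" "k \<noteq> j" by auto
    have U: "UNIV = {i, j, k}" by (rule card_seteq[symmetric]) (use n k ij in auto)
    have s: "(\<Sum>y\<in>UNIV. A $ x $ y) = A $ x $ i + A $ x $ j + A $ x $ k" for x
      by (subst U) (use k ij in auto)
    show ?thesis
      using admissibleD(3)[OF A, of i] admissibleD(3)[OF A, of j] admissibleD(3)[OF A, of k]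
        admissibleD(5)[OF A, of i] admissibleD(5)[OF A, of j] admissibleD(5)[OF A, of k]
        admissibleD(4)[OF A, of i j] admissibleD(4)[OF A, of i k] admissibleD(4)[OF A, of j k]
      unfolding s by linarith
  qed
  then show ?thesis using admissibleD(5)[OF A] by (simp add: vec_eq_iff)
qed

lemma open_matrix_entrywise:
  fixes A :: "real^'n^'n::finite"
  assumes "open U" "A \<in> U"
  obtains \<epsilon> where "\<epsilon> > 0" "\<And>B. (\<And>i j. \<bar>B $ i $ j - A $ i $ j\<bar> < \<epsilon>) \<Longrightarrow> B \<in> U"
proof -
  obtain e where e: "e > 0" "ball A e \<subseteq> U" using assms by (auto simp: open_contains_ball)
  define \<epsilon> where "\<epsilon> = e / (real CARD('n) * real CARD('n))"
  have "B \<in> U" if B: "\<And>i j. \<bar>B $ i $ j - A $ i $ j\<bar> < \<epsilon>" for B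
  proof -
    have "norm (B - A) \<le> (\<Sum>i\<in>UNIV. norm ((B - A) $ i))" by (simp add: norm_vec_def L2_set_le_sum)
    also have "\<dots> \<le> (\<Sum>i\<in>UNIV. \<Sum>j\<in>UNIV. \<bar>(B - A) $ i $ j\<bar>)" by (intro sum_mono norm_le_l1_cart)
    also have "\<dots> < (\<Sum>i::'n\<in>UNIV. \<Sum>j::'n\<in>UNIV. \<epsilon>)" using B by (intro sum_strict_mono) auto
    also have "\<dots> = e" by (simp add: \<epsilon>_def)
    finally show ?thesis using e(2) by (auto simp: dist_norm norm_minus_commute)
  qed
  moreover have "\<epsilon> > 0" using e(1) by (simp add: \<epsilon>_def)
  ultimately show ?thesis using that by blast
qed

text \<open>Mixing in a little of the matrix with constant off-diagonal entries keeps the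
  off-diagonal entries away from 0, as rigidity requires.\<close>

lemma admissible_approximation:
  fixes A :: "real^'n^'n::finite"
  assumes n: "CARD('n) \<ge> 2" and A: "A \<in> admissible" and \<epsilon>: "\<epsilon> > 0"
  obtains B \<delta> where "B \<in> admissible" "\<delta> > 0" "\<And>i j. i \<noteq> j \<Longrightarrow> \<delta> < B $ i $ j" "\<And>i j. \<bar>B $ i $ j - A $ i $ j\<bar> \<le> \<epsilon>"
proof -
  define l where "l = min 1 \<epsilon>"
  have l: "0 < l" "l \<le> 1" "l \<le> \<epsilon>" using \<epsilon> by (auto simp: l_def)
  define u where "u = 1 / (real CARD('n) - 1)"
  have u: "0 < u" "u \<le> 1" "(real CARD('n) - 1) * u = 1" using n by (auto simp: u_def)
  define B :: "real^'n^'n" where "B = (\<chi> i j. (1 - l) * A $ i $ j + l * (if i = j then 0 else u))"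
  have row: "(\<Sum>j\<in>UNIV. if i = j then 0 else u) = 1" for i :: 'n
  proof -
    have "(\<Sum>j\<in>UNIV. if i = j then 0 else u) = (\<Sum>j\<in>UNIV. u - (if i = j then u else 0))"
      by (intro sum.cong) auto
    also have "\<dots> = 1" using u(3) by (simp add: sum_subtractf algebra_simps)
    finally show ?thesis .
  qed
  have "B \<in> admissible"
  proof (rule admissibleI)
    show "0 \<le> B $ i $ j" for i j using admissibleD(2)[OF A] l u by (simp add: B_def)
    show "(\<Sum>j\<in>UNIV. B $ i $ j) = 1" for i
      by (simp add: B_def sum.distrib sum_distrib_left[symmetric] admissibleD(3)[OF A] row)
    show "B $ i $ j = B $ j $ i" for i j using admissibleD(4)[OF A, of i j] by (auto simp: B_def)
  qed (simp add: B_def admissibleD(5)[OF A])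
  moreover have "l * u / 2 < B $ i $ j" if "i \<noteq> j" for i j
  proof -
    have "0 < l * u" using l u by simp
    moreover have "0 \<le> (1 - l) * A $ i $ j" using l admissibleD(2)[OF A] by simp
    ultimately show ?thesis using that by (simp add: B_def)
  qed
  moreover have "\<bar>B $ i $ j - A $ i $ j\<bar> \<le> \<epsilon>" for i j
  proof -
    have a: "0 \<le> A $ i $ j" "A $ i $ j \<le> 1"
      using admissibleD(2)[OF A] admissibleD(3)[OF A, of i] member_le_sum[of j UNIV "\<lambda>j. A $ i $ j"] by auto
    have eq: "B $ i $ j - A $ i $ j = l * ((if i = j then 0 else u) - A $ i $ j)" by (simp add: B_def algebra_simps)
    have "\<bar>(if i = j then 0 else u) - A $ i $ j\<bar> \<le> 1" using a u by auto
    then have "\<bar>B $ i $ j - A $ i $ j\<bar> \<le> l * 1" unfolding eq abs_mult using l by (intro mult_mono) auto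
    then show ?thesis using l by simp
  qed
  moreover have "0 < l * u / 2" using l u by simp
  ultimately show ?thesis using that by blast
qed

text \<open>Closeness at infinitely many times already passes to the limit, which is all that
  \<open>prob_infinitely_often\<close> provides.\<close>

lemma frequently_le_limit:
  fixes x :: "nat \<Rightarrow> real"
  assumes "x \<longlonglongrightarrow> l" "\<exists>\<^sub>F t in sequentially. \<bar>x t - a\<bar> \<le> r"
  shows "\<bar>l - a\<bar> \<le> r"
proof (rule ccontr)
  assume "\<not> ?thesis"
  moreover have "(\<lambda>t. \<bar>x t - a\<bar>) \<longlonglongrightarrow> \<bar>l - a\<bar>" by (intro tendsto_intros assms(1))
  ultimately have "eventually (\<lambda>t. r < \<bar>x t - a\<bar>) sequentially" by (intro order_tendstoD(1)) auto
  then have "eventually (\<lambda>t. \<not> \<bar>x t - a\<bar> \<le> r) sequentially" by (rule eventually_mono) auto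
  then show False using assms(2) by (simp add: frequently_def)
qed

section \<open>The random limit matrix\<close>

context friends_II
begin

lemma visits_ne: "\<omega> \<in> space M \<Longrightarrow> visits \<omega> s i \<noteq> i"
  by (simp add: visits_def visits_other)

text \<open>Off-diagonal weights are at least 1, so every history without self-visits is
  possible.\<close>

lemma prob_cylinder_pos:
  assumes n: "CARD('n) \<ge> 2" and h: "\<And>s i. h s i \<noteq> i"
  shows "0 < prob (cylinder t h)"
proof (induction t)
  case 0 then show ?case by (simp add: cylinder_def prob_space)
next
  case (Suc t)
  have "0 < visit_matrix h t $ i $ h t i" for i
    using weight_ge_1[of i "h t i" h t] h[of t i] row_weight_pos[OF n, of h t i] by (auto simp: visit_matrix_nth)
  then have "0 < (\<Prod>i\<in>UNIV. visit_matrix h t $ i $ h t i)" by (intro prod_pos) auto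
  then show ?case using prob_cylinder_Suc[of t h "h t"] Suc by simp
qed

text \<open>\<open>lim\<close> returns some default value where the sequence diverges, so the limit
  is a function on the whole space.\<close>

definition limit_matrix :: "'a \<Rightarrow> real^'n^'n" where
  "limit_matrix \<omega> = lim (\<lambda>t. visit_matrix (visits \<omega>) t)"

lemma measurable_visit_matrix: "(\<lambda>\<omega>. visit_matrix (visits \<omega>) t) \<in> borel_measurable M"
  by (rule borel_measurable_determined) (auto simp: determined_def intro: visit_matrix_cong)

lemma measurable_limit_matrix [measurable]: "limit_matrix \<in> borel_measurable M"
  unfolding limit_matrix_def by (rule borel_measurable_lim_metric) (rule measurable_visit_matrix)

lemma AE_limiting_ratios:
  assumes n: "CARD('n) \<ge> 3" shows "AE \<omega> in M. limiting_ratios (visits \<omega>)"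
proof -
  have "AE \<omega> in M. \<forall>i\<in>UNIV. \<forall>j\<in>UNIV. i \<noteq> j \<longrightarrow> (\<exists>c>0. (\<lambda>t. pair_ratio (visits \<omega>) t i j) \<longlonglongrightarrow> c)"
  proof (intro AE_finite_allI finite)
    fix i j :: 'n
    show "AE \<omega> in M. i \<noteq> j \<longrightarrow> (\<exists>c>0. (\<lambda>t. pair_ratio (visits \<omega>) t i j) \<longlonglongrightarrow> c)"
      using AE_pair_ratio_limit[OF _ n, of i j] by (cases "i = j") auto
  qed
  then show ?thesis
  proof (rule AE_mp, intro AE_I2 impI)
    fix \<omega> assume "\<omega> \<in> space M" "\<forall>i\<in>UNIV. \<forall>j\<in>UNIV. i \<noteq> j \<longrightarrow> (\<exists>c>0. (\<lambda>t. pair_ratio (visits \<omega>) t i j) \<longlonglongrightarrow> c)"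
    then show "limiting_ratios (visits \<omega>)" using n by unfold_locales (auto simp: visits_ne)
  qed
qed

text \<open>Each row has a single off-diagonal entry, so nothing is random. This case is separate
  because the rigidity argument uses a third agent.\<close>

lemma limit_matrix_card_2:
  assumes n: "CARD('n) = 2" and \<omega>: "\<omega> \<in> space M"
  shows "visit_matrix (visits \<omega>) t = (\<chi> i j. if i = j then 0 else 1)"
    and "limit_matrix \<omega> = (\<chi> i j. if i = j then 0 else 1)"
proof -
  show *: "visit_matrix (visits \<omega>) t = (\<chi> i j. if i = j then 0 else 1)" for t
  proof (rule zero_diagonal_stochastic_card_2[OF n])
    show "(\<Sum>j\<in>UNIV. visit_matrix (visits \<omega>) t $ i $ j) = 1" for i using n by (simp add: sum_visit_matrix)
    show "visit_matrix (visits \<omega>) t $ i $ i = 0" for i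
      using visits_ne[OF \<omega>] by (simp add: visit_matrix_nth weight_diag)
  qed
  show "limit_matrix \<omega> = (\<chi> i j. if i = j then 0 else 1)"
    unfolding limit_matrix_def * by (rule limI) simp
qed

lemma limiting_ratios_limit:
  assumes "limiting_ratios (visits \<omega>)"
  shows "(\<lambda>t. visit_matrix (visits \<omega>) t) \<longlonglongrightarrow> limit_matrix \<omega>"
    and "(\<lambda>t. weight (visits \<omega>) t i j / mean_weight CARD('n) t) \<longlonglongrightarrow> limit_matrix \<omega> $ i $ j"
  using limiting_ratios.visit_matrix_limit[OF assms] limI unfolding limit_matrix_def by blast+

lemma AE_limit:
  assumes n: "CARD('n) \<ge> 2"
  shows "AE \<omega> in M. (\<lambda>t. visit_matrix (visits \<omega>) t) \<longlonglongrightarrow> limit_matrix \<omega> \<and> limit_matrix \<omega> \<in> admissible"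
proof (cases "CARD('n) = 2")
  case True
  show ?thesis
  proof (intro AE_I2 conjI)
    fix \<omega> assume \<omega>: "\<omega> \<in> space M"
    show "(\<lambda>t. visit_matrix (visits \<omega>) t) \<longlonglongrightarrow> limit_matrix \<omega>"
      by (simp add: limit_matrix_card_2[OF True \<omega>])
    have eq: "limit_matrix \<omega> = visit_matrix (visits \<omega>) 0" by (simp only: limit_matrix_card_2[OF True \<omega>])
    show "limit_matrix \<omega> \<in> admissible"
    proof (rule admissibleI)
      show "(\<Sum>j\<in>UNIV. limit_matrix \<omega> $ i $ j) = 1" for i unfolding eq by (rule sum_visit_matrix[OF n])
    qed (auto simp: limit_matrix_card_2(2)[OF True \<omega>])
  qed
next
  case False
  then have n3: "CARD('n) \<ge> 3" using n by simp
  show ?thesis using AE_limiting_ratios[OF n3]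
  proof (rule AE_mp, intro AE_I2 impI conjI)
    fix \<omega> assume \<omega>: "\<omega> \<in> space M" and r: "limiting_ratios (visits \<omega>)"
    show lim: "(\<lambda>t. visit_matrix (visits \<omega>) t) \<longlonglongrightarrow> limit_matrix \<omega>" by (rule limiting_ratios_limit[OF r])
    have lim': "(\<lambda>t. visit_matrix (visits \<omega>) t $ i $ j) \<longlonglongrightarrow> limit_matrix \<omega> $ i $ j" for i j
      by (intro tendsto_vec_nth lim)
    show "limit_matrix \<omega> \<in> admissible"
    proof (rule admissibleI)
      show "0 \<le> limit_matrix \<omega> $ i $ j" for i j
        by (rule LIMSEQ_le_const[OF lim']) (simp add: visit_matrix_nonneg)
      have "(\<lambda>t. \<Sum>j\<in>UNIV. visit_matrix (visits \<omega>) t $ i $ j) \<longlonglongrightarrow> (\<Sum>j\<in>UNIV. limit_matrix \<omega> $ i $ j)" for i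
        by (intro tendsto_sum lim')
      then show "(\<Sum>j\<in>UNIV. limit_matrix \<omega> $ i $ j) = 1" for i
        using n by (simp add: sum_visit_matrix LIMSEQ_const_iff)
      \<comment> \<open>Visit matrices need not be symmetric; symmetry of the limit comes from the
        weights divided by their common mean.\<close>
      show "limit_matrix \<omega> $ i $ j = limit_matrix \<omega> $ j $ i" for i j
        using limiting_ratios_limit(2)[OF r, of i j] limiting_ratios_limit(2)[OF r, of j i]
        by (intro LIMSEQ_unique) (simp_all add: weight_commute[of _ _ i j])
      show "limit_matrix \<omega> $ i $ i = 0" for i
        using limiting_ratios_limit(2)[OF r, of i i] visits_ne[OF \<omega>]
        by (simp add: weight_diag LIMSEQ_const_iff)
    qed
  qed
qed

section \<open>The support of the limit law\<close>

lemma prob_close_ratios: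
  assumes n: "CARD('n) \<ge> 3" and T: "1 \<le> T" "T \<le> t" and \<eta>: "0 < \<eta>" "\<eta> \<le> 1"
    and w: "\<And>i j. i \<noteq> j \<Longrightarrow> 1 + 4 * (real CARD('n))\<^sup>2 / \<eta>\<^sup>2 \<le> weight h T i j"
  defines "G \<equiv> {\<omega> \<in> space M. (\<forall>s<T. visits \<omega> s = h s)
    \<and> (\<forall>i j. i \<noteq> j \<longrightarrow> \<bar>pair_ratio (visits \<omega>) t i j / pair_ratio h T i j - 1\<bar> \<le> \<eta>)}"
  shows "G \<in> sets M" "prob (cylinder T h) / 2 \<le> prob G"
proof -
  let ?dev = "\<lambda>\<omega> i j. \<bar>pair_ratio (visits \<omega>) t i j / pair_ratio h T i j - 1\<bar>"
  have m [measurable]: "(\<lambda>\<omega>. pair_ratio (visits \<omega>) t i j) \<in> borel_measurable M" for i j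
    by (rule borel_measurable_determined[OF determined_pair_ratio])
  define bad where "bad i j = {\<omega> \<in> space M. (\<forall>s<T. visits \<omega> s = h s) \<and> \<eta> < ?dev \<omega> i j}" for i j
  have cyl: "cylinder T h = {\<omega> \<in> space M. \<forall>s<T. visits \<omega> s = h s}" by (simp add: cylinder_def visits_def)
  have sbad [measurable]: "bad i j \<in> sets M" for i j
  proof -
    have "bad i j = cylinder T h \<inter> {\<omega> \<in> space M. \<eta> < ?dev \<omega> i j}" by (auto simp: bad_def cyl)
    also have "\<dots> \<in> sets M" by measurable
    finally show ?thesis .
  qed
  have G: "G = cylinder T h - (\<Union>(i, j)\<in>{(i, j). i \<noteq> j}. bad i j)"
    by (auto simp: G_def cyl bad_def not_less) (meson not_less)
  show sG: "G \<in> sets M" unfolding G by (intro sets.Diff sets.finite_UN sets_cylinder) auto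
  \<comment> \<open>The threshold on the weights limits each deviation to the share
    \<open>1 / (2 * (real CARD('n))\<^sup>2)\<close> of the cylinder, so a union bound over the
    ordered pairs leaves at least half of it.\<close>
  have pbad: "prob (bad i j) \<le> prob (cylinder T h) / (2 * (real CARD('n))\<^sup>2)" if ij: "i \<noteq> j" for i j
  proof -
    have n1: "1 \<le> (real CARD('n))\<^sup>2" using n by (simp add: one_le_power)
    have "\<eta>\<^sup>2 \<le> 1" using \<eta> by (simp add: power_le_one)
    then have "4 * (real CARD('n))\<^sup>2 \<le> 4 * (real CARD('n))\<^sup>2 / \<eta>\<^sup>2" using \<eta> n1 by (simp add: field_simps mult_left_le)
    then have w2: "2 \<le> weight h T i j" using w[OF ij] n1 by linarith
    have "4 * (real CARD('n))\<^sup>2 / \<eta>\<^sup>2 \<le> weight h T i j - 1" using w[OF ij] by linarith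
    then have "4 * (real CARD('n))\<^sup>2 \<le> \<eta>\<^sup>2 * (weight h T i j - 1)" using \<eta> by (simp add: field_simps)
    then have "2 / (\<eta>\<^sup>2 * (weight h T i j - 1)) \<le> 2 / (4 * (real CARD('n))\<^sup>2)"
      using n1 \<eta> w2 n by (intro divide_left_mono mult_pos_pos) auto
    then have "2 / (\<eta>\<^sup>2 * (weight h T i j - 1)) * prob (cylinder T h) \<le> 2 / (4 * (real CARD('n))\<^sup>2) * prob (cylinder T h)"
      by (intro mult_right_mono) auto
    with prob_pair_ratio_deviation[OF ij n T w2 \<eta>] show ?thesis
      unfolding bad_def by simp
  qed
  have "prob (\<Union>(i, j)\<in>{(i, j). i \<noteq> j}. bad i j) \<le> (\<Sum>(i, j)\<in>{(i::'n, j). i \<noteq> j}. prob (bad i j))"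
  proof -
    let ?S = "{(i::'n, j). i \<noteq> j}" and ?b = "\<lambda>p. bad (fst p) (snd p)"
    have "prob (\<Union>p\<in>?S. ?b p) \<le> (\<Sum>p\<in>?S. prob (?b p))"
      by (intro finite_measure_subadditive_finite) (auto intro: sbad)
    then show ?thesis by (simp add: case_prod_unfold)
  qed
  also have "\<dots> \<le> (\<Sum>(i, j)\<in>{(i::'n, j). i \<noteq> j}. prob (cylinder T h) / (2 * (real CARD('n))\<^sup>2))"
    by (intro sum_mono) (auto intro: pbad)
  also have "\<dots> = real (card {(i::'n, j). i \<noteq> j}) * (prob (cylinder T h) / (2 * (real CARD('n))\<^sup>2))"
    by (simp add: case_prod_unfold)
  also have "\<dots> \<le> real (CARD('n) * CARD('n)) * (prob (cylinder T h) / (2 * (real CARD('n))\<^sup>2))"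
    using card_mono[of "UNIV :: ('n \<times> 'n) set" "{(i, j). i \<noteq> j}"]
    by (intro mult_right_mono of_nat_mono) auto
  also have "\<dots> = prob (cylinder T h) / 2" by (simp add: power2_eq_square)
  finally have "prob (\<Union>(i, j)\<in>{(i, j). i \<noteq> j}. bad i j) \<le> prob (cylinder T h) / 2" .
  moreover have "prob (cylinder T h) \<le> prob G + prob (\<Union>(i, j)\<in>{(i, j). i \<noteq> j}. bad i j)"
  proof -
    have "prob (cylinder T h) \<le> prob (G \<union> (\<Union>(i, j)\<in>{(i, j). i \<noteq> j}. bad i j))"
      using sG by (intro finite_measure_mono sets.Un sets.finite_UN) (auto simp: G)
    also have "\<dots> \<le> prob G + prob (\<Union>(i, j)\<in>{(i, j). i \<noteq> j}. bad i j)"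
      using sG by (intro measure_Un_le sets.finite_UN) auto
    finally show ?thesis .
  qed
  ultimately show "prob (cylinder T h) / 2 \<le> prob G" by linarith
qed

text \<open>The tail unions decrease to the event of infinitely many occurrences, and each has
  probability at least \<open>p\<close>. This turns a bound at every single time into one event of
  positive probability.\<close>

lemma prob_infinitely_often:
  assumes G: "\<And>t. G t \<in> sets M" and p: "0 < p" "\<And>t. p \<le> prob (G t)"
  shows "\<not> (AE \<omega> in M. \<not> (\<exists>\<^sub>F t in sequentially. \<omega> \<in> G t))"
proof
  assume *: "AE \<omega> in M. \<not> (\<exists>\<^sub>F t in sequentially. \<omega> \<in> G t)"
  define D where "D k = (\<Union>t\<in>{k..}. G t)" for k
  have D: "D k \<in> sets M" for k unfolding D_def using G by auto
  have "decseq D" unfolding D_def decseq_def by (intro allI impI UN_mono) auto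
  then have lim: "(\<lambda>k. prob (D k)) \<longlonglongrightarrow> prob (\<Inter>k. D k)"
    using D by (intro finite_Lim_measure_decseq) auto
  have "p \<le> prob (D k)" for k
    using p(2)[of k] finite_measure_mono[of "G k" "D k"] D by (force simp: D_def)
  then have "p \<le> prob (\<Inter>k. D k)" by (intro LIMSEQ_le_const[OF lim]) auto
  moreover have "prob (\<Inter>k. D k) = 0"
  proof -
    have "AE \<omega> in M. \<omega> \<notin> (\<Inter>k. D k)"
      using * by eventually_elim (auto simp: D_def frequently_sequentially)
    moreover have "(\<Inter>k. D k) \<in> sets M" using D by (intro sets.countable_INT) auto
    ultimately show ?thesis using prob_eq_0 by blast
  qed
  ultimately show False using p(1) by simp
qed

text \<open>Three errors of at most \<open>\<epsilon> / 4\<close> add up: moving to a matrix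
  \<open>B\<close> with positive off-diagonal entries, steering close to \<open>B\<close> until time
  \<open>T\<close>, and the random drift after \<open>T\<close>.\<close>

lemma limit_matrix_near_admissible:
  assumes n: "CARD('n) \<ge> 3" and A: "A \<in> admissible" and \<epsilon>: "\<epsilon> > 0"
  shows "\<not> (AE \<omega> in M. \<not> (\<forall>i j. \<bar>limit_matrix \<omega> $ i $ j - A $ i $ j\<bar> < \<epsilon>))"
proof
  assume never: "AE \<omega> in M. \<not> (\<forall>i j. \<bar>limit_matrix \<omega> $ i $ j - A $ i $ j\<bar> < \<epsilon>)"
  let ?m = "mean_weight CARD('n)"
  have n2: "CARD('n) \<ge> 2" using n by simp
  obtain B \<delta>' where B: "B \<in> admissible" "\<delta>' > 0" "\<And>i j. i \<noteq> j \<Longrightarrow> \<delta>' < B $ i $ j"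
    "\<And>i j. \<bar>B $ i $ j - A $ i $ j\<bar> \<le> \<epsilon> / 4"
    using admissible_approximation[OF n2 A, of "\<epsilon> / 4"] \<epsilon> by (auto simp: field_simps)
  define \<delta> where "\<delta> = min \<delta>' 1"
  have \<delta>: "0 < \<delta>" "\<delta> \<le> 1" "\<delta> \<le> \<delta>'" using B(2) by (auto simp: \<delta>_def)
  \<comment> \<open>The first bound is the hypothesis of the rigidity lemma, the second limits the
    drift to \<open>\<epsilon> / 4\<close>.\<close>
  define \<eta> where "\<eta> = min (\<delta> / 600) (\<epsilon> * \<delta> / 6400)"
  have \<eta>: "0 < \<eta>" "600 * \<eta> \<le> \<delta>" "1600 * \<eta> / \<delta> \<le> \<epsilon> / 4"
    using \<delta> \<epsilon> by (auto simp: \<eta>_def min_def field_simps)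
  have \<eta>1: "\<eta> \<le> 1" using \<eta> \<delta> by linarith
  obtain h where h: "\<And>s i. h s i \<noteq> i" "\<And>i j. (\<lambda>t. weight h t i j / ?m t) \<longlonglongrightarrow> B $ i $ j"
    using balanced_visits[of B] admissibleD[OF B(1)] by blast
  have m: "?m t > 0" for t by (rule mean_weight_pos[OF n2])
  have "(\<lambda>t. \<Sum>j\<in>UNIV. weight h t i j / ?m t) \<longlonglongrightarrow> (\<Sum>j\<in>UNIV. B $ i $ j)" for i
    by (intro tendsto_sum h(2))
  then have rowlim: "(\<lambda>t. row_weight h t i / ?m t) \<longlonglongrightarrow> 1" for i
    by (simp add: row_weight_def sum_divide_distrib admissibleD(3)[OF B(1)])
  have minf: "filterlim ?m at_top sequentially"
    unfolding filterlim_at_top eventually_sequentially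
  proof (intro allI)
    fix Z :: real
    obtain k :: nat where "Z \<le> real k" using real_arch_simple by blast
    then show "\<exists>k. \<forall>t\<ge>k. Z \<le> ?m t" using mean_weight_ge[OF n2]
      by (intro exI[of _ k] allI impI) (smt (verit) of_nat_mono)
  qed
  have e1: "eventually (\<lambda>t. \<forall>i j. \<bar>weight h t i j / ?m t - B $ i $ j\<bar> < \<epsilon> / 4) sequentially"
    using tendstoD[OF h(2), of "\<epsilon> / 4"] \<epsilon> by (simp add: eventually_all_finite dist_real_def)
  have e2: "eventually (\<lambda>t. \<forall>i. \<bar>row_weight h t i / ?m t - 1\<bar> < \<eta>) sequentially"
    using tendstoD[OF rowlim \<eta>(1)] by (simp add: eventually_all_finite dist_real_def)
  have e3: "eventually (\<lambda>t. \<forall>i j. i \<noteq> j \<longrightarrow> \<delta> < weight h t i j / ?m t) sequentially"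
  proof (intro eventually_all_finite)
    fix i j
    show "eventually (\<lambda>t. i \<noteq> j \<longrightarrow> \<delta> < weight h t i j / ?m t) sequentially"
    proof (cases "i = j")
      case False
      have "\<delta> < B $ i $ j" using B(3)[OF False] \<delta>(3) by simp
      then show ?thesis using order_tendstoD(1)[OF h(2)] by (auto elim: eventually_mono)
    qed simp
  qed
  \<comment> \<open>A large mean turns the lower bound \<delta> on the normalized entries into the
    weight threshold of \<open>prob_close_ratios\<close>.\<close>
  have e4: "eventually (\<lambda>t. (1 + 4 * (real CARD('n))\<^sup>2 / \<eta>\<^sup>2) / \<delta> \<le> ?m t) sequentially"
    using minf by (simp add: filterlim_at_top)
  have "eventually (\<lambda>t. 1 \<le> t \<and> (\<forall>i j. \<bar>weight h t i j / ?m t - B $ i $ j\<bar> < \<epsilon> / 4)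
      \<and> (\<forall>i. \<bar>row_weight h t i / ?m t - 1\<bar> < \<eta>) \<and> (\<forall>i j. i \<noteq> j \<longrightarrow> \<delta> < weight h t i j / ?m t)
      \<and> (1 + 4 * (real CARD('n))\<^sup>2 / \<eta>\<^sup>2) / \<delta> \<le> ?m t) sequentially"
    using eventually_ge_at_top[of 1] e1 e2 e3 e4 by eventually_elim auto
  then obtain T where T: "1 \<le> T" "\<And>i j. \<bar>weight h T i j / ?m T - B $ i $ j\<bar> < \<epsilon> / 4"
    "\<And>i. \<bar>row_weight h T i / ?m T - 1\<bar> < \<eta>" "\<And>i j. i \<noteq> j \<Longrightarrow> \<delta> < weight h T i j / ?m T"
    "(1 + 4 * (real CARD('n))\<^sup>2 / \<eta>\<^sup>2) / \<delta> \<le> ?m T"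
    by (metis (mono_tags, lifting) eventually_happens trivial_limit_sequentially)
  have low: "\<delta> * ?m T \<le> weight h T i j" if "i \<noteq> j" for i j
    using T(4)[OF that] m[of T] by (simp add: field_simps)
  have w: "1 + 4 * (real CARD('n))\<^sup>2 / \<eta>\<^sup>2 \<le> weight h T i j" if "i \<noteq> j" for i j
  proof -
    have "1 + 4 * (real CARD('n))\<^sup>2 / \<eta>\<^sup>2 = \<delta> * ((1 + 4 * (real CARD('n))\<^sup>2 / \<eta>\<^sup>2) / \<delta>)" using \<delta> by simp
    also have "\<dots> \<le> \<delta> * ?m T" using T(5) \<delta> by (intro mult_left_mono) auto
    finally show ?thesis using low[OF that] by linarith
  qed
  define G where "G t = {\<omega> \<in> space M. (\<forall>s<T. visits \<omega> s = h s)
    \<and> (\<forall>i j. i \<noteq> j \<longrightarrow> \<bar>pair_ratio (visits \<omega>) (T + t) i j / pair_ratio h T i j - 1\<bar> \<le> \<eta>)}" for t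
  have "\<not> (AE \<omega> in M. \<not> (\<exists>\<^sub>F t in sequentially. \<omega> \<in> G t))"
  proof (rule prob_infinitely_often)
    show "G t \<in> sets M" "prob (cylinder T h) / 2 \<le> prob (G t)" for t
      unfolding G_def by (rule prob_close_ratios[OF n T(1) _ \<eta>(1) \<eta>1 w]; simp)+
    show "0 < prob (cylinder T h) / 2" using prob_cylinder_pos[OF n2 h(1)] by simp
  qed
  moreover have "AE \<omega> in M. \<not> (\<exists>\<^sub>F t in sequentially. \<omega> \<in> G t)"
    using never AE_limiting_ratios[OF n] AE_space
  proof eventually_elim
    case (elim \<omega>)
    let ?v = "visits \<omega>"
    interpret r: limiting_ratios ?v by (rule elim(2))
    show ?case
    proof
      assume io: "\<exists>\<^sub>F t in sequentially. \<omega> \<in> G t"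
      \<comment> \<open>Row sums are close to the mean only from a random time on, so the good event
        has to occur at arbitrarily late times.\<close>
      have "eventually (\<lambda>t. \<forall>i. \<bar>row_weight ?v (t + T) i / ?m (t + T) - 1\<bar> < \<eta>) sequentially"
        using r.eventually_row_weight[OF \<eta>(1)] by (rule eventually_all_ge_at_top[THEN eventually_mono, THEN sequentially_offset]) auto
      then have imp: "eventually (\<lambda>t. \<omega> \<in> G t \<longrightarrow> (\<forall>i j. \<bar>weight ?v (t + T) i j / ?m (t + T) - weight h T i j / ?m T\<bar> \<le> 1600 * \<eta> / \<delta>)) sequentially"
      proof (rule eventually_mono)
        fix t assume row: "\<forall>i. \<bar>row_weight ?v (t + T) i / ?m (t + T) - 1\<bar> < \<eta>"
        show "\<omega> \<in> G t \<longrightarrow> (\<forall>i j. \<bar>weight ?v (t + T) i j / ?m (t + T) - weight h T i j / ?m T\<bar> \<le> 1600 * \<eta> / \<delta>)"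
        proof (intro impI allI normalized_weight_close[OF n \<delta>(1,2) _ \<eta>(2)])
          assume g: "\<omega> \<in> G t"
          show "0 \<le> \<eta>" using \<eta> by simp
          show "weight h T i i = 0" for i using h(1) by (intro weight_diag)
          show "weight ?v (t + T) i i = 0" for i using visits_ne[OF elim(3)] by (intro weight_diag)
          show "\<bar>pair_ratio ?v (t + T) i j / pair_ratio h T i j - 1\<bar> \<le> \<eta>" if "i \<noteq> j" for i j
            using g that by (simp add: G_def add.commute)
          show "\<bar>row_weight h T i / ?m T - 1\<bar> \<le> \<eta>" for i using T(3)[of i] by simp
          show "\<bar>row_weight ?v (t + T) i / ?m (t + T) - 1\<bar> \<le> \<eta>" for i using row by (simp add: less_imp_le)
        qed (use low in auto)
      qed
      have close: "\<exists>\<^sub>F t in sequentially. \<forall>i j. \<bar>weight ?v (t + T) i j / ?m (t + T) - weight h T i j / ?m T\<bar> \<le> 1600 * \<eta> / \<delta>"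
        by (rule frequently_rev_mp[OF io imp])
      have "\<bar>limit_matrix \<omega> $ i $ j - A $ i $ j\<bar> < \<epsilon>" for i j
      proof -
        have lim: "(\<lambda>t. weight ?v (t + T) i j / ?m (t + T)) \<longlonglongrightarrow> limit_matrix \<omega> $ i $ j"
          by (rule LIMSEQ_ignore_initial_segment[OF limiting_ratios_limit(2)[OF elim(2)]])
        have "\<bar>limit_matrix \<omega> $ i $ j - weight h T i j / ?m T\<bar> \<le> 1600 * \<eta> / \<delta>"
          by (rule frequently_le_limit[OF lim frequently_elim1[OF close]]) auto
        then show ?thesis using \<eta>(3) T(2)[of i j] B(4)[of i j] by linarith
      qed
      then show False using elim(1) by blast
    qed
  qed
  ultimately show False by blast
qed

text \<open>A closed set of full measure contains the support; conversely
  \<open>limit_matrix_near_admissible\<close> gives mass to every neighbourhood of an admissible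
  matrix. For two agents the law is a point mass.\<close>

lemma closed_support_limit_matrix:
  assumes n: "CARD('n) \<ge> 2"
  shows "closed_support (distr M borel limit_matrix) = admissible"
proof (intro equalityI subsetI)
  fix A assume A: "A \<in> closed_support (distr M borel limit_matrix)"
  show "A \<in> admissible"
  proof (rule ccontr)
    assume "A \<notin> admissible"
    moreover have "open (- admissible :: (real^'n^'n) set)" using closed_admissible by auto
    ultimately have "0 < emeasure (distr M borel limit_matrix) (- admissible)"
      using A by (auto simp: closed_support_def)
    also have "emeasure (distr M borel limit_matrix) (- admissible) = emeasure M (limit_matrix -` (- admissible) \<inter> space M)"
      using closed_admissible by (intro emeasure_distr measurable_limit_matrix) (auto intro: borel_open)
    also have "\<dots> = 0"
    proof -
      have "AE \<omega> in M. limit_matrix \<omega> \<notin> - admissible" using AE_limit[OF n] by eventually_elim auto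
      moreover have "limit_matrix -` (- admissible) \<inter> space M \<in> sets M"
        using closed_admissible by (intro measurable_sets[OF measurable_limit_matrix]) (auto intro: borel_open)
      ultimately show ?thesis by (subst (asm) AE_iff_measurable) auto
    qed
    finally show False by simp
  qed
next
  fix A :: "real^'n^'n" assume A: "A \<in> admissible"
  have pos: "\<not> (AE \<omega> in M. limit_matrix \<omega> \<notin> U)" if U: "open U" "A \<in> U" for U
  proof (cases "CARD('n) = 2")
    case True
    have "A = (\<chi> i j. if i = j then 0 else 1)"
      by (rule zero_diagonal_stochastic_card_2[OF True]) (simp_all add: admissibleD[OF A])
    then have *: "limit_matrix \<omega> \<in> U" if "\<omega> \<in> space M" for \<omega>
      using limit_matrix_card_2(2)[OF True that] U(2) by simp
    show ?thesis
    proof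
      assume "AE \<omega> in M. limit_matrix \<omega> \<notin> U"
      then have "AE \<omega> in M. False" using AE_space by eventually_elim (use * in blast)
      then show False by simp
    qed
  next
    case False
    then have n3: "CARD('n) \<ge> 3" using n by simp
    obtain \<epsilon> where \<epsilon>: "\<epsilon> > 0" "\<And>B. (\<And>i j. \<bar>B $ i $ j - A $ i $ j\<bar> < \<epsilon>) \<Longrightarrow> B \<in> U"
      using open_matrix_entrywise[OF U] by blast
    show ?thesis
    proof
      assume "AE \<omega> in M. limit_matrix \<omega> \<notin> U"
      then have "AE \<omega> in M. \<not> (\<forall>i j. \<bar>limit_matrix \<omega> $ i $ j - A $ i $ j\<bar> < \<epsilon>)"
        by eventually_elim (use \<epsilon>(2) in blast)
      then show False using limit_matrix_near_admissible[OF n3 A \<epsilon>(1)] by blast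
    qed
  qed
  show "A \<in> closed_support (distr M borel limit_matrix)"
    unfolding closed_support_def
  proof (intro CollectI allI impI)
    fix U assume U: "open U" "A \<in> U"
    have "limit_matrix -` U \<inter> space M \<in> sets M" using U(1) by (intro measurable_sets[OF measurable_limit_matrix]) auto
    then have "emeasure M (limit_matrix -` U \<inter> space M) \<noteq> 0"
      using pos[OF U] by (subst (asm) AE_iff_measurable) auto
    then show "0 < emeasure (distr M borel limit_matrix) U"
      using U(1) by (subst emeasure_distr) (auto simp: zero_less_iff_neq_zero)
  qed
qed

end

theorem theorem2:
  fixes M :: "'a measure" and V :: "nat \<Rightarrow> 'a \<Rightarrow> 'n::finite \<Rightarrow> 'n"
  assumes "CARD('n) \<ge> 2"
    and "friends_II M V"
  shows "\<exists>P :: 'a \<Rightarrow> real^'n^'n. P \<in> borel_measurable M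
    \<and> (AE \<omega> in M. (\<lambda>t. visit_matrix (\<lambda>s. V s \<omega>) t) \<longlonglongrightarrow> P \<omega>)
    \<and> (CARD('n) = 3 \<longrightarrow> (AE \<omega> in M. P \<omega> = (\<chi> i j. if i = j then 0 else 1/2)))
    \<and> closed_support (distr M borel P)
        = {A. stochastic_matrix A \<and> transpose A = A \<and> (\<forall>i. A $ i $ i = 0)}"
proof -
  interpret friends_II M V by (rule assms(2))
  note lim = AE_limit[OF assms(1)]
  have "AE \<omega> in M. (\<lambda>t. visit_matrix (\<lambda>s. V s \<omega>) t) \<longlonglongrightarrow> limit_matrix \<omega>"
    using lim by eventually_elim (simp add: visits_def)
  moreover have "AE \<omega> in M. limit_matrix \<omega> = (\<chi> i j. if i = j then 0 else 1/2)" if "CARD('n) = 3"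
    using lim by eventually_elim (use admissible_card_3[OF that] in blast)
  ultimately show ?thesis
    using measurable_limit_matrix closed_support_limit_matrix[OF assms(1)] unfolding admissible_def by blast
qed

end
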